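(* Let $(X,G)$ be a dynamical system and $\mathcal{F}=\{F_n\}$ a F{\o}lner sequence with $\frac{|F_n|}{\log n}\to\infty$. Suppose the system has the specification property and the uniform separation property. If $\varphi\in C(X,\mathbb R)$ and the set $$\hat X(\varphi,\mathcal F)=\Big\{x\in X\;\Big|\;\lim_{n\to\infty}\frac1{|F_n|}\sum_{s\in F_n}\varphi(sx)\text{ does not exist}\Big\}$$ is non-empty, then $$h^B_{top}(\hat X(\varphi,\mathcal F),\mathcal F)=h_{top}(X,G).$$
   Context: A dynamical system $(X,G)$ consists of a compact metric space $X$, with a fixed metric $\rho$ inducing its topology, and a countable infinite discrete amenable group $G$ acting continuously on $X$. $M(X)$ is the set of Borel probability measures on $X$ with the weak$^*$ topology, $M(X,G)$ the subset of $G$-invariant measures, $E(X,G)$ the subset of ergodic $G$-invariant measures; $\mathcal N(\mu)$ is the family of weak$^*$ neighborhoods of $\mu$ in $M(X)$. $h_{top}(X,G)$ is the usual topological entropy of the amenable group action. F{\o}lner sequences: a sequence $\{F_n\}$ of non-empty finite subsets of $G$ is a F{\o}lner sequence if $|sF_n\triangle F_n|/|F_n|\to 0$ for every $s\in G$. It is tempered if for some $C>0$ and all $n$, $|\bigcup_{k\le n}F_k^{-1}F_{n+1}|<C|F_{n+1}|$. Empirical measures: $\mathcal{E}_F(x)=\frac1{|F|}\sum_{s\in F}\delta_{sx}$. Metric entropy: for $\mu\in M(X,G)$ and a finite measurable partition $\beta$, $h_\mu(\beta,G)=\lim_n\frac1{|F_n|}H_\mu(\bigvee_{s\in F_n}s^{-1}\beta)$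 with $H_\mu(\beta)=-\sum_{B\in\beta}\mu(B)\log\mu(B)$ (independent of the F{\o}lner sequence), and $h_\mu(X,G)=\sup_\beta h_\mu(\beta,G)$. Bowen topological entropy: $\rho_F(x,y)=\max_{s\in F}\rho(sx,sy)$, $B_F(x,\varepsilon)=\{y\in X:\rho_F(x,y)<\varepsilon\}$. For $Y\subset X$, $\varepsilon>0$, $N\in\mathbb N$, let $\mathcal C_N(Y,\varepsilon,\mathcal F)$ be the collection of finite or countable covers $\mathcal C=\{B_{F_{n_i}}(x_i,\varepsilon)\}$ of $Y$ with all $n_i\ge N$. For $s>0$, $M(Y,\varepsilon,N,s,\mathcal F)=\inf_{\mathcal C\in\mathcal C_N(Y,\varepsilon,\mathcal F)}\sum_{B_{F_m}(x,\varepsilon)\in\mathcal C}e^{-s|F_m|}$, $M(Y,\varepsilon,s,\mathcal F)=\lim_{N\to\infty}M(Y,\varepsilon,N,s,\mathcal F)$, $h^B_{top}(Y,\varepsilon,\mathcal F)=\inf\{s\mid M(Y,\varepsilon,s,\mathcal F)=0\}$, and $h^B_{top}(Y,\mathcal F)=\lim_{\varepsilon\to0}h^B_{top}(Y,\varepsilon,\mathcal F)$. Specification property: for every $\varepsilon>0$ there is a non-empty finite $F\subset G$ such that for any finite collection of finite subsets $F_1,\dots,F_m$ of $G$ with $FF_i\cap F_j=\emptyset$ for $1\le i\neq j\le m$, and any $x^1,\dots,x^m\in X$, there is $y\in X$ with $\rho(sx^i,sy)\le\varepsilon$ for all $s\in F_i$, $1\le i\le m$. Separated sets: for finite non-empty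 $F\subset G$ and $\delta,\varepsilon>0$, a set $\Gamma\subset X$ is $(\delta,F,\varepsilon)$-separated if $|\{s\in F:\rho(sx,sy)>\varepsilon\}|\ge\delta|F|$ for all $x\ne y$ in $\Gamma$. $X_{F,C}=\{x\in X:\mathcal E_F(x)\in C\}$ and $N(C;\delta,F,\varepsilon)$ is the maximal cardinality of a $(\delta,F,\varepsilon)$-separated subset of $X_{F,C}$. Uniform separation property: for every tempered F{\o}lner sequence $\{K_n\}$ and every $\eta>0$ there exist $\varepsilon^*>0$ and $\delta^*>0$ such that for every $\mu\in E(X,G)$ and every $C\in\mathcal N(\mu)$ there is $n^*_{C;\mu,\eta}\in\mathbb N$ with $N(C;\delta^*,K_n,\varepsilon^* )\ge e^{|K_n|(h_\mu(X,G)-\eta)}$ for all $n\ge n^*_{C;\mu,\eta}$. *)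

theory Defs
  imports "HOL-Probability.Probability_Measure" "HOL-Analysis.Infinite_Sum"
    "HOL-Analysis.Function_Topology" "HOL-Algebra.Group_Action"
begin

section \<open>F\o{}lner sequences and dynamical systems\<close>

definition folner_seq :: "('g, 'b) monoid_scheme \<Rightarrow> (nat \<Rightarrow> 'g set) \<Rightarrow> bool" where
  "folner_seq G F \<longleftrightarrow>
     (\<forall>n. F n \<noteq> {} \<and> finite (F n) \<and> F n \<subseteq> carrier G) \<and>
     (\<forall>s\<in>carrier G.
        (\<lambda>n. real (card (sym_diff (s <#\<^bsub>G\<^esub> F n) (F n))) / real (card (F n))) \<longlonglongrightarrow> 0)"

definition tempered :: "('g, 'b) monoid_scheme \<Rightarrow> (nat \<Rightarrow> 'g set) \<Rightarrow> bool" where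
  "tempered G F \<longleftrightarrow>
     (\<exists>C>0. \<forall>n. real (card (\<Union>k\<in>{..n}. set_inv\<^bsub>G\<^esub> (F k) <#>\<^bsub>G\<^esub> F (Suc n)))
        < C * real (card (F (Suc n))))"

text \<open>For countable discrete groups, amenability is the existence of a F\o{}lner sequence.\<close>

definition amenable :: "('g, 'b) monoid_scheme \<Rightarrow> bool" where
  "amenable G \<longleftrightarrow> (\<exists>F. folner_seq G F)"

text \<open>The compact metric space \<open>X\<close> is the type \<open>'x\<close>, with \<open>\<rho> = dist\<close>;
  \<open>s x\<close> is written \<open>\<alpha> s x\<close>. As \<open>G\<close> is discrete, continuity of the action is continuity of
  each \<open>\<alpha> s\<close>.\<close>

locale dynamical_system = group_action G UNIV \<alpha>
  for G :: "('g, 'b) monoid_scheme" (structure) and \<alpha> :: "'g \<Rightarrow> 'x::metric_space \<Rightarrow> 'x" +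
  assumes compact_space: "compact (UNIV :: 'x set)"
    and continuous_action: "\<And>s. s \<in> carrier G \<Longrightarrow> continuous_on UNIV (\<alpha> s)"
    and countable_group: "countable (carrier G)"
    and infinite_group: "infinite (carrier G)"
    and amenable_group: "amenable G"

section \<open>Measures\<close>

definition prob_measures :: "'x::metric_space measure set" where
  "prob_measures = {\<mu>. prob_space \<mu> \<and> sets \<mu> = sets borel}"

definition invariant_measures ::
  "('g, 'b) monoid_scheme \<Rightarrow> ('g \<Rightarrow> 'x::metric_space \<Rightarrow> 'x) \<Rightarrow> 'x measure set" where
  "invariant_measures G \<alpha> = {\<mu>\<in>prob_measures. \<forall>s\<in>carrier G. distr \<mu> borel (\<alpha> s) = \<mu>}"

definition ergodic_measures ::
  "('g, 'b) monoid_scheme \<Rightarrow> ('g \<Rightarrow> 'x::metric_space \<Rightarrow> 'x) \<Rightarrow> 'x measure set" where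
  "ergodic_measures G \<alpha> = {\<mu>\<in>invariant_measures G \<alpha>.
     \<forall>A\<in>sets borel. (\<forall>s\<in>carrier G. \<alpha> s -` A = A) \<longrightarrow> measure \<mu> A = 0 \<or> measure \<mu> A = 1}"

text \<open>The weak* topology is the coarsest one making \<open>\<mu> \<mapsto> \<integral>f d\<mu>\<close> continuous for every continuous \<open>f\<close>.\<close>

definition weak_star_topology :: "'x::metric_space measure topology" where
  "weak_star_topology = pullback_topology prob_measures
     (\<lambda>\<mu>. \<lambda>f\<in>{f. continuous_on UNIV f}. integral\<^sup>L \<mu> f)
     (product_topology (\<lambda>_. euclideanreal) {f. continuous_on UNIV f})"

definition weak_star_nhds :: "'x::metric_space measure \<Rightarrow> 'x measure set set" where
  "weak_star_nhds \<mu> =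
     {C. C \<subseteq> prob_measures \<and> (\<exists>U. openin weak_star_topology U \<and> \<mu> \<in> U \<and> U \<subseteq> C)}"

text \<open>The average of the Dirac masses \<open>\<delta>\<^bsub>sx\<^esub>\<close>, \<open>s \<in> F\<close>, is the image of the uniform
  probability measure on \<open>F\<close> under \<open>s \<mapsto> sx\<close>.\<close>

definition empirical_measure ::
  "('g \<Rightarrow> 'x::metric_space \<Rightarrow> 'x) \<Rightarrow> 'g set \<Rightarrow> 'x \<Rightarrow> 'x measure" where
  "empirical_measure \<alpha> F x = distr (uniform_count_measure F) borel (\<lambda>s. \<alpha> s x)"

section \<open>Metric and topological entropy\<close>

text \<open>\<open>\<Or>\<^bsub>s\<in>F\<^esub> s\<^sup>-\<^sup>1 U\<close>, for a partition or a cover \<open>U\<close>. For partitions the result may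
  contain the empty set, which does not contribute to the entropy.\<close>

definition join_over :: "('g \<Rightarrow> 'x \<Rightarrow> 'x) \<Rightarrow> 'g set \<Rightarrow> 'x set set \<Rightarrow> 'x set set" where
  "join_over \<alpha> F U = {(\<Inter>s\<in>F. \<alpha> s -` c s) | c. \<forall>s\<in>F. c s \<in> U}"

definition finite_measurable_partition :: "'x::metric_space set set \<Rightarrow> bool" where
  "finite_measurable_partition \<beta> \<longleftrightarrow> finite \<beta> \<and> \<beta> \<subseteq> sets borel \<and> partition_on UNIV \<beta>"

definition partition_entropy :: "'x measure \<Rightarrow> 'x set set \<Rightarrow> real" where
  "partition_entropy \<mu> \<beta> = - (\<Sum>B\<in>\<beta>. measure \<mu> B * ln (measure \<mu> B))"

text \<open>Both entropies below are limits along a F\o{}lner sequence which do not depend on the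
  sequence (Ornstein--Weiss); they are defined as the common value of all these limits.\<close>

definition metric_entropy_partition ::
  "('g, 'b) monoid_scheme \<Rightarrow> ('g \<Rightarrow> 'x::metric_space \<Rightarrow> 'x) \<Rightarrow> 'x measure \<Rightarrow> 'x set set \<Rightarrow> real" where
  "metric_entropy_partition G \<alpha> \<mu> \<beta> = (THE h. \<forall>F. folner_seq G F \<longrightarrow>
     (\<lambda>n. partition_entropy \<mu> (join_over \<alpha> (F n) \<beta>) / real (card (F n))) \<longlonglongrightarrow> h)"

definition metric_entropy ::
  "('g, 'b) monoid_scheme \<Rightarrow> ('g \<Rightarrow> 'x::metric_space \<Rightarrow> 'x) \<Rightarrow> 'x measure \<Rightarrow> ereal" where
  "metric_entropy G \<alpha> \<mu> =
     (SUP \<beta>\<in>{\<beta>. finite_measurable_partition \<beta>}. ereal (metric_entropy_partition G \<alpha> \<mu> \<beta>))"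

definition open_cover :: "'x::metric_space set set \<Rightarrow> bool" where
  "open_cover U \<longleftrightarrow> (\<forall>A\<in>U. open A) \<and> \<Union>U = UNIV"

definition min_subcover_card :: "'x set set \<Rightarrow> nat" where
  "min_subcover_card U = (LEAST n. \<exists>V\<subseteq>U. finite V \<and> \<Union>V = UNIV \<and> card V = n)"

definition top_entropy_cover ::
  "('g, 'b) monoid_scheme \<Rightarrow> ('g \<Rightarrow> 'x::metric_space \<Rightarrow> 'x) \<Rightarrow> 'x set set \<Rightarrow> real" where
  "top_entropy_cover G \<alpha> U = (THE h. \<forall>F. folner_seq G F \<longrightarrow>
     (\<lambda>n. ln (real (min_subcover_card (join_over \<alpha> (F n) U))) / real (card (F n))) \<longlonglongrightarrow> h)"

definition top_entropy ::
  "('g, 'b) monoid_scheme \<Rightarrow> ('g \<Rightarrow> 'x::metric_space \<Rightarrow> 'x) \<Rightarrow> ereal" where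
  "top_entropy G \<alpha> = (SUP U\<in>{U. open_cover U}. ereal (top_entropy_cover G \<alpha> U))"

section \<open>Bowen topological entropy of a subset\<close>

definition bowen_ball ::
  "('g \<Rightarrow> 'x::metric_space \<Rightarrow> 'x) \<Rightarrow> 'g set \<Rightarrow> 'x \<Rightarrow> real \<Rightarrow> 'x set" where
  "bowen_ball \<alpha> F x \<epsilon> = {y. (MAX s\<in>F. dist (\<alpha> s x) (\<alpha> s y)) < \<epsilon>}"

text \<open>A cover by Bowen balls is given by the set of its labels \<open>(m, x)\<close>, standing for the ball
  \<open>B\<^bsub>F\<^sub>m\<^esub>(x, \<epsilon>)\<close>, because \<open>m\<close> need not be determined by the ball as a set.\<close>

definition bowen_covers ::
  "('g \<Rightarrow> 'x::metric_space \<Rightarrow> 'x) \<Rightarrow> (nat \<Rightarrow> 'g set) \<Rightarrow> 'x set \<Rightarrow> real \<Rightarrow> nat \<Rightarrow> (nat \<times> 'x) set set" where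
  "bowen_covers \<alpha> F Y \<epsilon> N =
     {C. countable C \<and> (\<forall>(m, x)\<in>C. N \<le> m) \<and> Y \<subseteq> (\<Union>(m, x)\<in>C. bowen_ball \<alpha> (F m) x \<epsilon>)}"

definition bowen_sum_inf ::
  "('g \<Rightarrow> 'x::metric_space \<Rightarrow> 'x) \<Rightarrow> (nat \<Rightarrow> 'g set) \<Rightarrow> 'x set \<Rightarrow> real \<Rightarrow> nat \<Rightarrow> real \<Rightarrow> ennreal" where
  "bowen_sum_inf \<alpha> F Y \<epsilon> N s =
     (INF C\<in>bowen_covers \<alpha> F Y \<epsilon> N. \<Sum>\<^sub>\<infinity>(m, x)\<in>C. ennreal (exp (- s * real (card (F m)))))"

definition bowen_measure ::
  "('g \<Rightarrow> 'x::metric_space \<Rightarrow> 'x) \<Rightarrow> (nat \<Rightarrow> 'g set) \<Rightarrow> 'x set \<Rightarrow> real \<Rightarrow> real \<Rightarrow> ennreal" where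
  "bowen_measure \<alpha> F Y \<epsilon> s = lim (\<lambda>N. bowen_sum_inf \<alpha> F Y \<epsilon> N s)"

definition bowen_entropy_scale ::
  "('g \<Rightarrow> 'x::metric_space \<Rightarrow> 'x) \<Rightarrow> (nat \<Rightarrow> 'g set) \<Rightarrow> 'x set \<Rightarrow> real \<Rightarrow> ereal" where
  "bowen_entropy_scale \<alpha> F Y \<epsilon> = Inf {ereal s | s. 0 < s \<and> bowen_measure \<alpha> F Y \<epsilon> s = 0}"

definition bowen_entropy ::
  "('g \<Rightarrow> 'x::metric_space \<Rightarrow> 'x) \<Rightarrow> (nat \<Rightarrow> 'g set) \<Rightarrow> 'x set \<Rightarrow> ereal" where
  "bowen_entropy \<alpha> F Y = Lim (at_right 0) (\<lambda>\<epsilon>. bowen_entropy_scale \<alpha> F Y \<epsilon>)"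

section \<open>Specification and uniform separation\<close>

definition specification_property ::
  "('g, 'b) monoid_scheme \<Rightarrow> ('g \<Rightarrow> 'x::metric_space \<Rightarrow> 'x) \<Rightarrow> bool" where
  "specification_property G \<alpha> \<longleftrightarrow>
     (\<forall>\<epsilon>>0. \<exists>F. F \<noteq> {} \<and> finite F \<and> F \<subseteq> carrier G \<and>
        (\<forall>(m::nat) (E :: nat \<Rightarrow> 'g set) (x :: nat \<Rightarrow> 'x).
           (\<forall>i\<in>{1..m}. finite (E i) \<and> E i \<subseteq> carrier G) \<and>
           (\<forall>i\<in>{1..m}. \<forall>j\<in>{1..m}. i \<noteq> j \<longrightarrow> (F <#>\<^bsub>G\<^esub> E i) \<inter> E j = {}) \<longrightarrow>
           (\<exists>y. \<forall>i\<in>{1..m}. \<forall>s\<in>E i. dist (\<alpha> s (x i)) (\<alpha> s y) \<le> \<epsilon>)))"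

definition separated_set ::
  "('g \<Rightarrow> 'x::metric_space \<Rightarrow> 'x) \<Rightarrow> real \<Rightarrow> 'g set \<Rightarrow> real \<Rightarrow> 'x set \<Rightarrow> bool" where
  "separated_set \<alpha> \<delta> F \<epsilon> \<Gamma> \<longleftrightarrow>
     (\<forall>x\<in>\<Gamma>. \<forall>y\<in>\<Gamma>. x \<noteq> y \<longrightarrow>
        real (card {s\<in>F. dist (\<alpha> s x) (\<alpha> s y) > \<epsilon>}) \<ge> \<delta> * real (card F))"

definition empirical_in ::
  "('g \<Rightarrow> 'x::metric_space \<Rightarrow> 'x) \<Rightarrow> 'g set \<Rightarrow> 'x measure set \<Rightarrow> 'x set" where
  "empirical_in \<alpha> F C = {x. empirical_measure \<alpha> F x \<in> C}"

text \<open>The maximal cardinality, as a supremum over the finite separated sets: an infinite one,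
  all of whose subsets are again separated, would give \<open>\<infinity>\<close>.\<close>

definition max_separated ::
  "('g \<Rightarrow> 'x::metric_space \<Rightarrow> 'x) \<Rightarrow> 'x measure set \<Rightarrow> real \<Rightarrow> 'g set \<Rightarrow> real \<Rightarrow> ereal" where
  "max_separated \<alpha> C \<delta> F \<epsilon> =
     (SUP \<Gamma>\<in>{\<Gamma>. finite \<Gamma> \<and> \<Gamma> \<subseteq> empirical_in \<alpha> F C \<and> separated_set \<alpha> \<delta> F \<epsilon> \<Gamma>}. ereal (real (card \<Gamma>)))"

text \<open>The metric entropy may a priori be infinite, so \<open>exp\<close> is extended to extended reals.\<close>

definition exp_ereal :: "ereal \<Rightarrow> ereal" where
  "exp_ereal x = (case x of ereal r \<Rightarrow> ereal (exp r) | PInfty \<Rightarrow> \<infinity> | MInfty \<Rightarrow> 0)"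

definition uniform_separation_property ::
  "('g, 'b) monoid_scheme \<Rightarrow> ('g \<Rightarrow> 'x::metric_space \<Rightarrow> 'x) \<Rightarrow> bool" where
  "uniform_separation_property G \<alpha> \<longleftrightarrow>
     (\<forall>K. folner_seq G K \<and> tempered G K \<longrightarrow>
       (\<forall>\<eta>::real. \<eta> > 0 \<longrightarrow>
         (\<exists>\<epsilon>>0. \<exists>\<delta>>0. \<forall>\<mu>\<in>ergodic_measures G \<alpha>. \<forall>C\<in>weak_star_nhds \<mu>.
            \<exists>n0::nat. \<forall>n\<ge>n0.
              max_separated \<alpha> C \<delta> (K n) \<epsilon>
                \<ge> exp_ereal (ereal (real (card (K n))) * (metric_entropy G \<alpha> \<mu> - ereal \<eta>)))))"

section \<open>Irregular points\<close>

definition irregular_set ::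
  "('g \<Rightarrow> 'x::metric_space \<Rightarrow> 'x) \<Rightarrow> (nat \<Rightarrow> 'g set) \<Rightarrow> ('x \<Rightarrow> real) \<Rightarrow> 'x set" where
  "irregular_set \<alpha> F \<phi> =
     {x. \<not> convergent (\<lambda>n. (\<Sum>s\<in>F n. \<phi> (\<alpha> s x)) / real (card (F n)))}"

end

theory Submission
  imports Defs "HOL-Probability.Infinite_Product_Measure"
begin

text \<open>The Ornstein--Weiss quasi-tiling theorem gives a family of pairwise separated finite
  pieces of \<open>G\<close>, each nearly a translate of a Folner set, that nearly
  fills every sufficiently invariant set. It yields the Ornstein--Weiss lemma, so that the entropy
  of a cover is a genuine limit, and by specification every choice of one orbit segment per piece
  is shadowed by a point. On each piece there are two families of segments, both of nearly full
  entropy: on a small invariant part the segments follow a point whose averages over all invariant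
  sets are close to one of two limit points of the averages of a given irregular point, and
  elsewhere they run through a separated set on which \<open>\<phi>\<close> has nearly constant averages.
  Switching between the families along a sparse subsequence of \<open>F\<close> makes all shadowing points
  irregular, while the product of the uniform measures on the families gives every Bowen ball
  over \<open>F\<^bsub>n\<^esub>\<close> mass at most \<open>exp (- s |F\<^bsub>n\<^esub>|)\<close>.\<close>

section \<open>Almost invariant sets\<close>

text \<open>The pieces live in all of G at once and do not depend on n, so one product measure and
  one choice of shadowing points serve every \<open>F n\<close>; hence a single packing of G, nearly
  filling every sufficiently invariant set, rather than a tiling of each \<open>F n\<close>. The
  obstacle is to change averages of \<phi> without losing entropy. Segments that realise an extreme
  average may carry little entropy, so they occupy only a proportion \<theta> of a piece. If M is
  the entropy of the cover at the identity, this costs at most 3\<theta>M per element and moves the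
  average by at least \<theta>g, where g measures the oscillation at the given irregular point. So
  \<theta> is fixed first by the entropy budget, and all errors \<kappa> are then taken small
  against \<theta>g. The averages attached to the pieces need not converge along \<open>F\<close>. A
  subsequence along which those of the lower family converge suffices: the upper family stays a
  definite distance above, so alternating between the two prevents convergence.\<close>

context group
begin

text \<open>Invariance is tested by left multiplication, so it survives right translation. Tiles are
  right translates because \<alpha> (t \<otimes> c) x is \<alpha> t applied to \<alpha> c x: moving
  a shape to the right only changes the base point of the orbit segment.\<close>

definition almost_inv :: "'a set \<Rightarrow> real \<Rightarrow> 'a set \<Rightarrow> bool" where
  "almost_inv K d A \<longleftrightarrow> finite A \<and> A \<noteq> {} \<and> A \<subseteq> carrier G \<and>
     real (card {a\<in>A. \<exists>k\<in>K. k \<otimes> a \<notin> A}) \<le> d * real (card A)"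

lemma almost_invD:
  assumes "almost_inv K d A"
  shows "finite A" "A \<noteq> {}" "A \<subseteq> carrier G" "card A > 0"
    "real (card {a\<in>A. \<exists>k\<in>K. k \<otimes> a \<notin> A}) \<le> d * real (card A)"
  using assms unfolding almost_inv_def by (auto simp: card_gt_0_iff)

lemma almost_inv_mono:
  assumes "almost_inv K' d' A" "K \<subseteq> K'" "d' \<le> d"
  shows "almost_inv K d A"
proof -
  have "card {a\<in>A. \<exists>k\<in>K. k \<otimes> a \<notin> A} \<le> card {a\<in>A. \<exists>k\<in>K'. k \<otimes> a \<notin> A}"
    using assms by (intro card_mono) (auto simp: almost_inv_def)
  moreover have "d' * real (card A) \<le> d * real (card A)"
    using assms by (intro mult_right_mono) auto
  ultimately show ?thesis using assms(1) unfolding almost_inv_def by auto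
qed

lemma inj_on_left_mult: "t \<in> carrier G \<Longrightarrow> S \<subseteq> carrier G \<Longrightarrow> inj_on (\<lambda>s. t \<otimes> s) S"
  by (rule inj_onI) (auto simp: subset_iff)

lemma inj_on_right_mult: "t \<in> carrier G \<Longrightarrow> S \<subseteq> carrier G \<Longrightarrow> inj_on (\<lambda>s. s \<otimes> t) S"
  by (rule inj_onI) (auto simp: subset_iff)

lemma card_r_coset:
  assumes "A \<subseteq> carrier G" "c \<in> carrier G"
  shows "card (A #> c) = card A"
proof -
  have "A #> c = (\<lambda>a. a \<otimes> c) ` A" by (auto simp: r_coset_def)
  moreover have "inj_on (\<lambda>a. a \<otimes> c) A"
    using assms by (rule inj_on_right_mult[rotated])
  ultimately show ?thesis by (simp add: card_image)
qed

lemma finite_r_coset: "finite A \<Longrightarrow> finite (A #> c)"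
  by (simp add: r_coset_def)

lemma mem_r_coset: "x \<in> A #> c \<longleftrightarrow> (\<exists>a\<in>A. x = a \<otimes> c)"
  by (auto simp: r_coset_def)

lemma mult_mem_r_coset_iff:
  assumes "x \<in> carrier G" "A \<subseteq> carrier G" "c \<in> carrier G"
  shows "x \<otimes> c \<in> A #> c \<longleftrightarrow> x \<in> A"
proof
  assume "x \<otimes> c \<in> A #> c"
  then obtain a where "a \<in> A" "x \<otimes> c = a \<otimes> c" by (auto simp: mem_r_coset)
  then show "x \<in> A" using assms right_cancel[of c x a] by auto
qed (auto simp: mem_r_coset)

lemma almost_inv_r_coset:
  assumes "almost_inv K d A" "K \<subseteq> carrier G" "c \<in> carrier G"
  shows "almost_inv K d (A #> c)"
proof -
  have A: "finite A" "A \<noteq> {}" "A \<subseteq> carrier G" using assms almost_invD by auto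
  have eq: "k \<otimes> (a \<otimes> c) \<in> A #> c \<longleftrightarrow> k \<otimes> a \<in> A" if "k \<in> carrier G" "a \<in> carrier G" for k a
  proof -
    have "k \<otimes> (a \<otimes> c) = (k \<otimes> a) \<otimes> c" using that assms by (simp add: m_assoc)
    then show ?thesis
      using that assms A by (simp add: mult_mem_r_coset_iff)
  qed
  have "{b \<in> A #> c. \<exists>k\<in>K. k \<otimes> b \<notin> A #> c} = {a\<in>A. \<exists>k\<in>K. k \<otimes> a \<notin> A} #> c"
  proof (rule Set.set_eqI, rule iffI)
    fix b assume b: "b \<in> {b \<in> A #> c. \<exists>k\<in>K. k \<otimes> b \<notin> A #> c}"
    then obtain a k where "a \<in> A" "b = a \<otimes> c" "k \<in> K" "k \<otimes> b \<notin> A #> c" by (auto simp: mem_r_coset)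
    then show "b \<in> {a\<in>A. \<exists>k\<in>K. k \<otimes> a \<notin> A} #> c"
      using eq[of k a] A(3) assms(2) unfolding mem_r_coset by blast
  next
    fix b assume "b \<in> {a\<in>A. \<exists>k\<in>K. k \<otimes> a \<notin> A} #> c"
    then obtain a k where "a \<in> A" "b = a \<otimes> c" "k \<in> K" "k \<otimes> a \<notin> A" by (auto simp: mem_r_coset)
    then show "b \<in> {b \<in> A #> c. \<exists>k\<in>K. k \<otimes> b \<notin> A #> c}"
      using eq[of k a] A(3) assms(2) unfolding mem_r_coset by blast
  qed
  then have "card {b \<in> A #> c. \<exists>k\<in>K. k \<otimes> b \<notin> A #> c} = card {a\<in>A. \<exists>k\<in>K. k \<otimes> a \<notin> A}"
    using A assms(3) by (simp add: card_r_coset subset_iff)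
  then show ?thesis
    using assms A unfolding almost_inv_def
    by (auto simp: card_r_coset finite_r_coset r_coset_subset_G) (auto simp: r_coset_def)
qed

lemma folner_eventually_almost_inv:
  assumes F: "folner_seq G F" and K: "finite K" "K \<subseteq> carrier G" and d: "d > 0"
  shows "eventually (\<lambda>n. almost_inv K d (F n)) sequentially"
proof -
  have Fn: "F n \<noteq> {}" "finite (F n)" "F n \<subseteq> carrier G" for n
    using F unfolding folner_seq_def by auto
  have "(\<lambda>n. \<Sum>s\<in>K. real (card (sym_diff (l_coset G s (F n)) (F n))) / real (card (F n))) \<longlonglongrightarrow> (\<Sum>s\<in>K. 0)"
    using F K unfolding folner_seq_def by (intro tendsto_sum) auto
  then have "eventually (\<lambda>n. (\<Sum>s\<in>K. real (card (sym_diff (l_coset G s (F n)) (F n))) / real (card (F n))) < d) sequentially"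
    using d by (simp add: order_tendsto_iff)
  then show ?thesis
  proof eventually_elim
    case (elim n)
    let ?B = "{a\<in>F n. \<exists>k\<in>K. k \<otimes> a \<notin> F n}"
    have "?B \<subseteq> (\<Union>s\<in>K. {a\<in>F n. s \<otimes> a \<notin> F n})" by auto
    then have "card ?B \<le> card (\<Union>s\<in>K. {a\<in>F n. s \<otimes> a \<notin> F n})"
      using K Fn by (intro card_mono) auto
    also have "\<dots> \<le> (\<Sum>s\<in>K. card {a\<in>F n. s \<otimes> a \<notin> F n})"
      using K by (intro card_UN_le)
    also have "\<dots> \<le> (\<Sum>s\<in>K. card (sym_diff (l_coset G s (F n)) (F n)))"
    proof (rule sum_mono)
      fix s assume s: "s \<in> K"
      have "card {a\<in>F n. s \<otimes> a \<notin> F n} = card ((\<lambda>a. s \<otimes> a) ` {a\<in>F n. s \<otimes> a \<notin> F n})"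
        using s K Fn(3)[of n] by (intro card_image[symmetric] inj_on_left_mult) auto
      also have "\<dots> \<le> card (sym_diff (l_coset G s (F n)) (F n))"
        using Fn by (intro card_mono) (auto simp: l_coset_def)
      finally show "card {a\<in>F n. s \<otimes> a \<notin> F n} \<le> card (sym_diff (l_coset G s (F n)) (F n))" .
    qed
    finally have "real (card ?B) \<le> (\<Sum>s\<in>K. real (card (sym_diff (l_coset G s (F n)) (F n))))"
      unfolding of_nat_sum[symmetric] of_nat_le_iff .
    also have "\<dots> \<le> d * card (F n)"
    proof -
      have "card (F n) > 0" using Fn by (simp add: card_gt_0_iff)
      then show ?thesis using elim by (simp add: sum_divide_distrib[symmetric] divide_less_eq)
    qed
    finally show ?case using Fn unfolding almost_inv_def by auto
  qed
qed

section \<open>Inner and outer boundaries of almost invariant sets\<close>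

lemma card_outer_boundary_translate:
  assumes S: "finite S" "S \<subseteq> carrier G" and t: "t \<in> carrier G"
  shows "card {a\<in>carrier G. a \<notin> S \<and> t \<otimes> a \<in> S} = card {a\<in>S. t \<otimes> a \<notin> S}"
    and "finite {a\<in>carrier G. a \<notin> S \<and> t \<otimes> a \<in> S}"
    and "card {a\<in>carrier G. t \<otimes> a \<in> S} = card S"
    and "finite {a\<in>carrier G. t \<otimes> a \<in> S}"
proof -
  let ?P = "{a\<in>carrier G. t \<otimes> a \<in> S}"
  have P: "?P = (\<lambda>s. inv t \<otimes> s) ` S"
  proof
    show "?P \<subseteq> (\<lambda>s. inv t \<otimes> s) ` S"
    proof
      fix a assume "a \<in> ?P"
      then show "a \<in> (\<lambda>s. inv t \<otimes> s) ` S"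
        using t by (intro image_eqI[of _ _ "t \<otimes> a"]) (auto simp: m_assoc[symmetric])
    qed
    show "(\<lambda>s. inv t \<otimes> s) ` S \<subseteq> ?P"
      using t S by (auto simp: m_assoc[symmetric])
  qed
  have inj: "inj_on (\<lambda>s. inv t \<otimes> s) S"
    using t S by (intro inj_on_left_mult) auto
  show cP: "card ?P = card S" using P inj by (simp add: card_image)
  show fP: "finite ?P" using P S by simp
  show fin: "finite {a\<in>carrier G. a \<notin> S \<and> t \<otimes> a \<in> S}"
    by (rule finite_subset[OF _ fP]) auto
  \<comment> \<open>The preimage of \<open>S\<close> under left multiplication by t has the size of
    \<open>S\<close>, and the two share the points that stay inside; so as many points enter
    \<open>S\<close> as leave it.\<close>
  have "card ?P = card ({a\<in>carrier G. a \<notin> S \<and> t \<otimes> a \<in> S} \<union> {a\<in>S. t \<otimes> a \<in> S})"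
    using S by (intro arg_cong[of _ _ card]) auto
  also have "\<dots> = card {a\<in>carrier G. a \<notin> S \<and> t \<otimes> a \<in> S} + card {a\<in>S. t \<otimes> a \<in> S}"
    using fin S by (intro card_Un_disjoint) auto
  finally have 1: "card S = card {a\<in>carrier G. a \<notin> S \<and> t \<otimes> a \<in> S} + card {a\<in>S. t \<otimes> a \<in> S}"
    using cP by simp
  have "card S = card ({a\<in>S. t \<otimes> a \<notin> S} \<union> {a\<in>S. t \<otimes> a \<in> S})"
    by (intro arg_cong[of _ _ card]) auto
  also have "\<dots> = card {a\<in>S. t \<otimes> a \<notin> S} + card {a\<in>S. t \<otimes> a \<in> S}"
    using S by (intro card_Un_disjoint) auto
  finally show "card {a\<in>carrier G. a \<notin> S \<and> t \<otimes> a \<in> S} = card {a\<in>S. t \<otimes> a \<notin> S}"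
    using 1 by simp
qed

lemma card_outer_boundary:
  fixes d :: real
  assumes S: "almost_inv T d S" and T: "finite T" "T \<subseteq> carrier G"
  shows "real (card {a\<in>carrier G. a \<notin> S \<and> (\<exists>t\<in>T. t \<otimes> a \<in> S)}) \<le> card T * (d * card S)"
    and "finite {a\<in>carrier G. a \<notin> S \<and> (\<exists>t\<in>T. t \<otimes> a \<in> S)}"
proof -
  note S' = almost_invD[OF S]
  have eq: "{a\<in>carrier G. a \<notin> S \<and> (\<exists>t\<in>T. t \<otimes> a \<in> S)} = (\<Union>t\<in>T. {a\<in>carrier G. a \<notin> S \<and> t \<otimes> a \<in> S})"
    by auto
  show "finite {a\<in>carrier G. a \<notin> S \<and> (\<exists>t\<in>T. t \<otimes> a \<in> S)}"
    unfolding eq using T S' by (intro finite_UN_I card_outer_boundary_translate(2)) auto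
  have le: "real (card {a\<in>carrier G. a \<notin> S \<and> t \<otimes> a \<in> S}) \<le> d * card S" if "t \<in> T" for t
  proof -
    have "card {a\<in>carrier G. a \<notin> S \<and> t \<otimes> a \<in> S} = card {a\<in>S. t \<otimes> a \<notin> S}"
      using that S' T by (intro card_outer_boundary_translate) auto
    also have "\<dots> \<le> card {a\<in>S. \<exists>k\<in>T. k \<otimes> a \<notin> S}"
      using that S' by (intro card_mono) auto
    finally show ?thesis using S'(5) by linarith
  qed
  have "card {a\<in>carrier G. a \<notin> S \<and> (\<exists>t\<in>T. t \<otimes> a \<in> S)} \<le> (\<Sum>t\<in>T. card {a\<in>carrier G. a \<notin> S \<and> t \<otimes> a \<in> S})"
    unfolding eq using T by (intro card_UN_le) auto
  also have "real \<dots> \<le> (\<Sum>t\<in>T. d * card S)"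
    unfolding of_nat_sum using le by (intro sum_mono) auto
  finally show "real (card {a\<in>carrier G. a \<notin> S \<and> (\<exists>t\<in>T. t \<otimes> a \<in> S)}) \<le> card T * (d * card S)"
    by simp
qed

text \<open>As d < 1, some a in A is not on the boundary, and k \<mapsto> k \<otimes> a embeds K
  into A. Thus invariance forces size in an infinite group.\<close>

lemma almost_inv_card_ge:
  assumes A: "almost_inv K d A" and d: "d < 1" and K: "finite K" "K \<subseteq> carrier G"
  shows "card K \<le> card A"
proof -
  note A' = almost_invD[OF A]
  have "real (card {a\<in>A. \<exists>k\<in>K. k \<otimes> a \<notin> A}) < card A"
    using A'(5) mult_strict_right_mono[OF d, of "real (card A)"] A'(4) by linarith
  then have "{a\<in>A. \<exists>k\<in>K. k \<otimes> a \<notin> A} \<noteq> A" by force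
  then obtain a where a: "a \<in> A" "\<forall>k\<in>K. k \<otimes> a \<in> A" by blast
  have "card K = card ((\<lambda>k. k \<otimes> a) ` K)"
    using a A' K by (intro card_image[symmetric] inj_on_right_mult) auto
  also have "\<dots> \<le> card A" using a A' by (intro card_mono) auto
  finally show ?thesis .
qed

lemma almost_inv_Union:
  assumes "finite \<Q>" "\<Q> \<noteq> {}" "\<And>A. A \<in> \<Q> \<Longrightarrow> almost_inv K d A" "disjoint \<Q>"
  shows "almost_inv K d (\<Union>\<Q>)"
proof -
  have A: "finite A" "A \<noteq> {}" "A \<subseteq> carrier G"
    "real (card {a\<in>A. \<exists>k\<in>K. k \<otimes> a \<notin> A}) \<le> d * real (card A)" if "A \<in> \<Q>" for A
    using almost_invD[OF assms(3)[OF that]] by auto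
  have "card {a\<in>\<Union>\<Q>. \<exists>k\<in>K. k \<otimes> a \<notin> \<Union>\<Q>} \<le> card (\<Union>A\<in>\<Q>. {a\<in>A. \<exists>k\<in>K. k \<otimes> a \<notin> A})"
    using A(1) assms(1) by (intro card_mono) auto
  also have "\<dots> \<le> (\<Sum>A\<in>\<Q>. card {a\<in>A. \<exists>k\<in>K. k \<otimes> a \<notin> A})"
    using assms(1) by (rule card_UN_le)
  also have "real \<dots> \<le> (\<Sum>A\<in>\<Q>. d * card A)"
    unfolding of_nat_sum using A(4) by (intro sum_mono)
  also have "\<dots> = d * card (\<Union>\<Q>)"
    using card_Union_disjoint[OF assms(4)] A(1) by (simp add: sum_distrib_left)
  finally have le: "real (card {a\<in>\<Union>\<Q>. \<exists>k\<in>K. k \<otimes> a \<notin> \<Union>\<Q>}) \<le> d * card (\<Union>\<Q>)" by simp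
  have "finite (\<Union>\<Q>)" "\<Union>\<Q> \<subseteq> carrier G" using A(1,3) assms(1) by auto
  moreover have "\<Union>\<Q> \<noteq> {}" using A(2) assms(2) by auto
  ultimately show ?thesis using le unfolding almost_inv_def by blast
qed

text \<open>A point of D that some k moves out of D either leaves S or is moved into the removed
  part S - D; each k has only card (S - D) points of the latter kind.\<close>

lemma inner_boundary_subset:
  fixes d e :: real
  assumes S: "almost_inv K d S" and K: "finite K" "K \<subseteq> carrier G"
    and D: "D \<subseteq> S" "(1 - e) * card S \<le> real (card D)"
  shows "real (card {a\<in>D. \<exists>k\<in>K. k \<otimes> a \<notin> D}) \<le> (d + card K * e) * card S"
proof -
  note S' = almost_invD[OF S]
  have finD: "finite D" using S' D finite_subset by auto
  let ?U = "\<Union>k\<in>K. {a\<in>carrier G. k \<otimes> a \<in> S - D}"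
  have finU: "finite ?U"
    using K S' by (intro finite_UN_I card_outer_boundary_translate(4)) auto
  have "{a\<in>D. \<exists>k\<in>K. k \<otimes> a \<notin> D} \<subseteq> {a\<in>S. \<exists>k\<in>K. k \<otimes> a \<notin> S} \<union> ?U"
    using D S' by auto
  then have "card {a\<in>D. \<exists>k\<in>K. k \<otimes> a \<notin> D} \<le> card ({a\<in>S. \<exists>k\<in>K. k \<otimes> a \<notin> S} \<union> ?U)"
    using S' finU by (intro card_mono) auto
  also have "\<dots> \<le> card {a\<in>S. \<exists>k\<in>K. k \<otimes> a \<notin> S} + card ?U" by (rule card_Un_le)
  also have "card ?U \<le> (\<Sum>k\<in>K. card {a\<in>carrier G. k \<otimes> a \<in> S - D})"
    using K by (intro card_UN_le)
  also have "\<dots> = (\<Sum>k\<in>K. card (S - D))"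
    using K S' by (intro sum.cong card_outer_boundary_translate(3)) auto
  also have "\<dots> = card K * card (S - D)" by simp
  finally have "card {a\<in>D. \<exists>k\<in>K. k \<otimes> a \<notin> D} \<le> card {a\<in>S. \<exists>k\<in>K. k \<otimes> a \<notin> S} + card K * card (S - D)"
    by simp
  then have 1: "real (card {a\<in>D. \<exists>k\<in>K. k \<otimes> a \<notin> D}) \<le> real (card {a\<in>S. \<exists>k\<in>K. k \<otimes> a \<notin> S}) + card K * real (card (S - D))"
    unfolding of_nat_mult[symmetric] of_nat_add[symmetric] of_nat_le_iff .
  have "real (card (S - D)) = real (card S) - card D"
    using D S' finD by (simp add: card_Diff_subset card_mono of_nat_diff)
  also have "\<dots> \<le> e * card S" using D by (simp add: algebra_simps)
  finally have "card K * real (card (S - D)) \<le> card K * (e * card S)" by (simp add: mult_left_mono)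
  with 1 have "real (card {a\<in>D. \<exists>k\<in>K. k \<otimes> a \<notin> D}) \<le> d * card S + card K * (e * card S)"
    using S'(5) by linarith
  also have "\<dots> = (d + card K * e) * card S" by (simp add: algebra_simps)
  finally show ?thesis .
qed

text \<open>The boundary bound is relative to S; the factor 1 - e in the hypothesis pays for
  measuring it against the smaller D.\<close>

lemma almost_inv_subset:
  fixes d d' e :: real
  assumes S: "almost_inv K d S" and K: "finite K" "K \<subseteq> carrier G"
    and D: "D \<subseteq> S" "(1 - e) * card S \<le> real (card D)"
    and e: "e < 1" "d + card K * e \<le> d' * (1 - e)" "d' \<ge> 0"
  shows "almost_inv K d' D"
proof -
  note S' = almost_invD[OF S]
  have finD: "finite D" using S' D finite_subset by auto
  have "0 < (1 - e) * card S" using e S' by simp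
  then have D0: "D \<noteq> {}" using D by auto
  note inner_boundary_subset[OF S K D]
  also have "(d + card K * e) * card S \<le> d' * (1 - e) * card S" using e by (intro mult_right_mono) auto
  also have "\<dots> \<le> d' * card D" using D e by (simp add: mult.assoc mult_left_mono)
  finally show ?thesis using finD D0 D S' unfolding almost_inv_def by auto
qed

text \<open>Eventual truth along all finite sets ordered by invariance. Unlike a statement along one
  Folner sequence, it also applies to the pieces, which are not members of the sequence.\<close>

definition inv_eventually :: "('a set \<Rightarrow> bool) \<Rightarrow> bool" where
  "inv_eventually Q \<longleftrightarrow>
     (\<exists>K d. finite K \<and> K \<subseteq> carrier G \<and> d > 0 \<and> (\<forall>A. almost_inv K d A \<longrightarrow> Q A))"

lemma inv_eventuallyI:
  assumes "finite K" "K \<subseteq> carrier G" "d > 0" "\<And>A. almost_inv K d A \<Longrightarrow> Q A"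
  shows "inv_eventually Q"
  unfolding inv_eventually_def
  by (rule exI[of _ K], rule exI[of _ d], intro conjI allI impI) (fact assms)+

lemma inv_eventuallyE:
  assumes "inv_eventually Q"
  obtains K d where "finite K" "K \<subseteq> carrier G" "d > 0" "\<And>A. almost_inv K d A \<Longrightarrow> Q A"
proof -
  obtain K d where *: "finite K \<and> K \<subseteq> carrier G \<and> d > 0 \<and> (\<forall>A. almost_inv K d A \<longrightarrow> Q A)"
    using assms unfolding inv_eventually_def by (elim exE)
  show thesis by (rule that[of K d]) (use * in auto)
qed

lemma inv_eventually_conj:
  assumes "inv_eventually Q" "inv_eventually R"
  shows "inv_eventually (\<lambda>A. Q A \<and> R A)"
proof -
  obtain K d where K: "finite K" "K \<subseteq> carrier G" "d > 0" "\<And>A. almost_inv K d A \<Longrightarrow> Q A"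
    using assms(1) by (rule inv_eventuallyE) (rule that; assumption)
  obtain L e where L: "finite L" "L \<subseteq> carrier G" "e > 0" "\<And>A. almost_inv L e A \<Longrightarrow> R A"
    using assms(2) by (rule inv_eventuallyE) (rule that; assumption)
  show ?thesis
  proof (rule inv_eventuallyI[of "K \<union> L" "min d e"])
    fix A assume A: "almost_inv (K \<union> L) (min d e) A"
    have "almost_inv K d A" "almost_inv L e A" by (rule almost_inv_mono[OF A]; simp)+
    then show "Q A \<and> R A" using K(4) L(4) by simp
  qed (use K L in auto)
qed

lemma inv_eventually_mono:
  assumes "inv_eventually Q" "\<And>A. finite A \<Longrightarrow> A \<noteq> {} \<Longrightarrow> A \<subseteq> carrier G \<Longrightarrow> Q A \<Longrightarrow> R A"
  shows "inv_eventually R"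
proof -
  obtain K d where K: "finite K" "K \<subseteq> carrier G" "d > 0" "\<And>A. almost_inv K d A \<Longrightarrow> Q A"
    using assms(1) by (rule inv_eventuallyE) (rule that; assumption)
  show ?thesis
  proof (rule inv_eventuallyI[OF K(1-3)])
    fix A assume A: "almost_inv K d A"
    show "R A" by (rule assms(2)[OF almost_invD(1-3)[OF A] K(4)[OF A]])
  qed
qed

end

section \<open>Quasi-tilings\<close>

context group
begin

lemma folner_seqD:
  assumes "folner_seq G T"
  shows "T n \<noteq> {}" "finite (T n)" "T n \<subseteq> carrier G" "card (T n) > 0"
  using assms unfolding folner_seq_def by (auto simp: card_gt_0_iff)

text \<open>A pair \<open>(S, D)\<close> in a packing consists of a translate \<open>S\<close> of a shape and of the part
  \<open>D\<close> of \<open>S\<close> that is not shared with other tiles.\<close>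

definition packing :: "(nat \<Rightarrow> 'a set) \<Rightarrow> real \<Rightarrow> nat set \<Rightarrow> ('a set \<times> 'a set) set \<Rightarrow> bool" where
  "packing T e J \<D> \<longleftrightarrow>
     (\<forall>p\<in>\<D>. (\<exists>n\<in>J. \<exists>c\<in>carrier G. fst p = T n #> c) \<and> snd p \<subseteq> fst p \<and>
        (1 - e) * real (card (fst p)) \<le> real (card (snd p))) \<and>
     (\<forall>p\<in>\<D>. \<forall>q\<in>\<D>. p \<noteq> q \<longrightarrow> snd p \<inter> snd q = {}) \<and>
     \<Union>(fst ` \<D>) = \<Union>(snd ` \<D>)"

lemma packingD:
  assumes "packing T e J \<D>"
  shows "p \<in> \<D> \<Longrightarrow> \<exists>n\<in>J. \<exists>c\<in>carrier G. fst p = T n #> c"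
    "p \<in> \<D> \<Longrightarrow> snd p \<subseteq> fst p"
    "p \<in> \<D> \<Longrightarrow> (1 - e) * real (card (fst p)) \<le> real (card (snd p))"
    "p \<in> \<D> \<Longrightarrow> q \<in> \<D> \<Longrightarrow> p \<noteq> q \<Longrightarrow> snd p \<inter> snd q = {}"
    "\<Union>(fst ` \<D>) = \<Union>(snd ` \<D>)"
proof -
  note a = assms[unfolded packing_def]
  show "p \<in> \<D> \<Longrightarrow> \<exists>n\<in>J. \<exists>c\<in>carrier G. fst p = T n #> c"
    "p \<in> \<D> \<Longrightarrow> snd p \<subseteq> fst p"
    "p \<in> \<D> \<Longrightarrow> (1 - e) * real (card (fst p)) \<le> real (card (snd p))"
    using conjunct1[OF a] by blast+
  show "p \<in> \<D> \<Longrightarrow> q \<in> \<D> \<Longrightarrow> p \<noteq> q \<Longrightarrow> snd p \<inter> snd q = {}"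
    using conjunct1[OF conjunct2[OF a]] by blast
  show "\<Union>(fst ` \<D>) = \<Union>(snd ` \<D>)" by (rule conjunct2[OF conjunct2[OF a]])
qed

lemma packing_fst:
  assumes "packing T e J \<D>" "folner_seq G T" "p \<in> \<D>"
  shows "finite (fst p)" "fst p \<subseteq> carrier G"
proof -
  obtain n c where "c \<in> carrier G" "fst p = T n #> c" using packingD(1)[OF assms(1,3)] by blast
  then show "finite (fst p)" "fst p \<subseteq> carrier G"
    using folner_seqD[OF assms(2)] by (simp_all add: finite_r_coset r_coset_subset_G)
qed

text \<open>The parts \<open>snd p\<close> of the tiles inside A are disjoint subsets of A, and each
  keeps at least the proportion 1 - e of its tile.\<close>

lemma packing_sum_le:
  assumes \<D>: "packing T e J \<D>" "folner_seq G T" and A: "finite A"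
  shows "finite {p\<in>\<D>. fst p \<subseteq> A}"
    and "(1 - e) * (\<Sum>p\<in>{p\<in>\<D>. fst p \<subseteq> A}. real (card (fst p))) \<le> real (card A)"
proof -
  let ?P = "{p\<in>\<D>. fst p \<subseteq> A}"
  have "?P \<subseteq> Pow A \<times> Pow A"
    using packingD(2)[OF \<D>(1)] by (fastforce simp: mem_Times_iff)
  then show fin: "finite ?P" by (rule finite_subset) (simp add: A)
  have sub: "snd p \<subseteq> A" if "p \<in> ?P" for p using that packingD(2)[OF \<D>(1), of p] by auto
  have "(\<Sum>p\<in>?P. card (snd p)) = card (\<Union>p\<in>?P. snd p)"
  proof (rule card_UN_disjoint[symmetric, OF fin])
    show "\<forall>p\<in>?P. finite (snd p)" using sub A finite_subset by blast
    show "\<forall>i\<in>?P. \<forall>j\<in>?P. i \<noteq> j \<longrightarrow> snd i \<inter> snd j = {}" using packingD(4)[OF \<D>(1)] by simp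
  qed
  also have "\<dots> \<le> card A" using sub A by (intro card_mono) blast+
  finally have "(\<Sum>p\<in>?P. card (snd p)) \<le> card A" .
  then have "(\<Sum>p\<in>?P. real (card (snd p))) \<le> card A" unfolding of_nat_sum[symmetric] of_nat_le_iff .
  moreover have "(1 - e) * (\<Sum>p\<in>?P. real (card (fst p))) \<le> (\<Sum>p\<in>?P. real (card (snd p)))"
    unfolding sum_distrib_left using packingD(3)[OF \<D>(1)] by (intro sum_mono) auto
  ultimately show "(1 - e) * (\<Sum>p\<in>?P. real (card (fst p))) \<le> real (card A)" by linarith
qed

text \<open>Zorn's lemma gives a packing that is maximal among those extending \<D> by translates of
  \<open>T m\<close>. A translate met by the covered set in a proportion below e could still be
  added, with its uncovered points as its part, so maximality makes every translate meet the covered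
  set in proportion at least e.\<close>

lemma packing_extend:
  assumes \<D>: "packing T e J \<D>" and T: "folner_seq G T" and e: "0 < e" "e < 1"
  obtains \<D>' where "\<D> \<subseteq> \<D>'" "packing T e (insert m J) \<D>'"
    "\<And>a. a \<in> carrier G \<Longrightarrow> e * card (T m) \<le> card ((T m #> a) \<inter> \<Union>(snd ` \<D>'))"
proof -
  let ?\<A> = "{\<D>'. \<D> \<subseteq> \<D>' \<and> packing T e (insert m J) \<D>'}"
  have "packing T e (insert m J) \<D>"
    unfolding packing_def
  proof (intro conjI ballI impI)
    fix p assume p: "p \<in> \<D>"
    show "\<exists>n\<in>insert m J. \<exists>c\<in>carrier G. fst p = T n #> c" using packingD(1)[OF \<D> p] by blast
    show "snd p \<subseteq> fst p" by (rule packingD(2)[OF \<D> p])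
    show "(1 - e) * real (card (fst p)) \<le> real (card (snd p))" by (rule packingD(3)[OF \<D> p])
  next
    fix p q assume "p \<in> \<D>" "q \<in> \<D>" "p \<noteq> q"
    then show "snd p \<inter> snd q = {}" by (rule packingD(4)[OF \<D>])
  qed (rule packingD(5)[OF \<D>])
  then have "\<D> \<in> ?\<A>" by simp
  then have ne: "?\<A> \<noteq> {}" by blast
  have chain: "\<Union>\<C> \<in> ?\<A>" if \<C>: "\<C> \<noteq> {}" "subset.chain ?\<A> \<C>" for \<C>
  proof -
    have mem: "packing T e (insert m J) X" "\<D> \<subseteq> X" if "X \<in> \<C>" for X
      using \<C> that unfolding subset.chain_def by auto
    have "snd p \<inter> snd q = {}" if "p \<in> \<Union>\<C>" "q \<in> \<Union>\<C>" "p \<noteq> q" for p q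
    proof -
      obtain X Y where "X \<in> \<C>" "Y \<in> \<C>" "p \<in> X" "q \<in> Y" using \<open>p \<in> \<Union>\<C>\<close> \<open>q \<in> \<Union>\<C>\<close> by blast
      moreover have "X \<subseteq> Y \<or> Y \<subseteq> X"
        using \<C>(2) calculation unfolding subset.chain_def subset_chain_def by blast
      ultimately obtain Z where "Z \<in> \<C>" "p \<in> Z" "q \<in> Z" by blast
      then show ?thesis using packingD(4)[OF mem(1), of Z p q] that by blast
    qed
    moreover have "(\<exists>n\<in>insert m J. \<exists>c\<in>carrier G. fst p = T n #> c) \<and> snd p \<subseteq> fst p \<and>
        (1 - e) * real (card (fst p)) \<le> real (card (snd p))" if "p \<in> \<Union>\<C>" for p
      using that packingD(1-3)[OF mem(1)] by blast
    moreover have "\<Union>(fst ` \<Union>\<C>) = \<Union>(snd ` \<Union>\<C>)"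
    proof -
      have "\<Union>(fst ` \<Union>\<C>) = (\<Union>X\<in>\<C>. \<Union>(fst ` X))" by blast
      also have "\<dots> = (\<Union>X\<in>\<C>. \<Union>(snd ` X))" using packingD(5)[OF mem(1)] by simp
      finally show ?thesis by blast
    qed
    ultimately have "packing T e (insert m J) (\<Union>\<C>)" unfolding packing_def by (intro conjI ballI impI) (blast | assumption)+
    moreover have "\<D> \<subseteq> \<Union>\<C>" using \<C> mem by blast
    ultimately show ?thesis by blast
  qed
  have "\<exists>M\<in>?\<A>. \<forall>X\<in>?\<A>. M \<subseteq> X \<longrightarrow> X = M" by (rule subset_Zorn_nonempty[OF ne chain])
  then obtain \<D>' where \<D>': "\<D>' \<in> ?\<A>" and "\<forall>X\<in>?\<A>. \<D>' \<subseteq> X \<longrightarrow> X = \<D>'" by (rule bexE)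
  then have max: "\<And>X. X \<in> ?\<A> \<Longrightarrow> \<D>' \<subseteq> X \<Longrightarrow> X = \<D>'" by simp
  have pk: "packing T e (insert m J) \<D>'" using \<D>' by simp
  have "e * card (T m) \<le> card ((T m #> a) \<inter> \<Union>(snd ` \<D>'))" if a: "a \<in> carrier G" for a
  proof (rule ccontr)
    let ?S = "T m #> a" and ?W = "\<Union>(snd ` \<D>')"
    assume "\<not> e * card (T m) \<le> card (?S \<inter> ?W)"
    then have lt: "card (?S \<inter> ?W) < e * card ?S"
      using a folner_seqD[OF T] by (simp add: card_r_coset)
    have finS: "finite ?S" using folner_seqD[OF T] by (simp add: finite_r_coset)
    have S0: "card ?S > 0" using a folner_seqD[OF T] by (simp add: card_r_coset)
    have "card ?S = card (?S \<inter> ?W) + card (?S - ?W)"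
      using finS by (metis card_Diff_subset_Int card_mono finite_Int inf_le1 le_add_diff_inverse)
    then have big: "(1 - e) * card ?S \<le> card (?S - ?W)" using lt by (simp add: algebra_simps)
    moreover have "0 < (1 - e) * card ?S" using e S0 by simp
    ultimately have "card (?S - ?W) > 0" by linarith
    then have ne': "?S - ?W \<noteq> {}" by force
    let ?p = "(?S, ?S - ?W)"
    have "packing T e (insert m J) (insert ?p \<D>')"
      unfolding packing_def
    proof (intro conjI)
      show "\<forall>p\<in>insert ?p \<D>'. (\<exists>n\<in>insert m J. \<exists>c\<in>carrier G. fst p = T n #> c) \<and> snd p \<subseteq> fst p \<and>
        (1 - e) * real (card (fst p)) \<le> real (card (snd p))"
        using big packingD(1-3)[OF pk] a by auto
      show "\<forall>p\<in>insert ?p \<D>'. \<forall>q\<in>insert ?p \<D>'. p \<noteq> q \<longrightarrow> snd p \<inter> snd q = {}"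
        using packingD(4)[OF pk] by auto
      \<comment> \<open>The new tile overlaps older ones only in points already covered, so the
        union of the tiles remains the union of the disjoint parts.\<close>
      have "\<Union>(fst ` insert ?p \<D>') = ?S \<union> ?W" using packingD(5)[OF pk] by simp
      also have "\<dots> = \<Union>(snd ` insert ?p \<D>')" by auto
      finally show "\<Union>(fst ` insert ?p \<D>') = \<Union>(snd ` insert ?p \<D>')" .
    qed
    then have "insert ?p \<D>' = \<D>'" using \<D>' by (intro max) auto
    then have "?p \<in> \<D>'" by blast
    then have "snd ?p \<subseteq> ?W" by (intro Union_upper imageI)
    then have "?S - ?W \<subseteq> ?W" by simp
    then show False using ne' by blast
  qed
  with \<D>' show thesis by (intro that[of \<D>']) auto
qed

text \<open>If t \<otimes> a = s' \<otimes> c, then every s \<otimes> c equals s \<otimes> inv s'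
  \<otimes> t \<otimes> a. So if finitely many products do not move a out of A, any tile reached
  from a lies in A.\<close>

lemma translate_subset:
  assumes T: "T \<subseteq> carrier G" and c: "c \<in> carrier G" and a: "a \<in> carrier G" and t: "t \<in> carrier G"
    and ta: "t \<otimes> a \<in> T #> c"
    and A: "\<And>s s'. s \<in> T \<Longrightarrow> s' \<in> T \<Longrightarrow> s \<otimes> inv s' \<otimes> t \<otimes> a \<in> A"
  shows "T #> c \<subseteq> A"
proof
  fix x assume "x \<in> T #> c"
  then obtain s where s: "s \<in> T" "x = s \<otimes> c" by (auto simp: mem_r_coset)
  obtain s' where s': "s' \<in> T" "t \<otimes> a = s' \<otimes> c" using ta by (auto simp: mem_r_coset)
  have "s \<otimes> inv s' \<otimes> t \<otimes> a = s \<otimes> (inv s' \<otimes> (t \<otimes> a))"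
    using s s' T a t by (simp add: m_assoc subset_iff)
  also have "\<dots> = x" unfolding s'(2) s(2) using s s' T c by (simp add: m_assoc[symmetric] subset_iff)
  finally show "x \<in> A" using A[OF s(1) s'(1)] by simp
qed

text \<open>The greedy step of Ornstein and Weiss. For an uncovered a away from the boundary of A
  and from older tiles, a proportion e of \<open>T m #> a\<close> is newly covered, and counting
  pairs (t, a) shows that the uncovered proportion drops by the factor 1 - e, up to the error
  \<eta>. Older shapes must be almost invariant under \<open>T m\<close>, so that few points lie
  outside an old tile but close to it.\<close>

lemma packing_extend_uncovered:
  fixes \<rho> \<eta> d e :: real
  assumes \<D>: "packing T e J \<D>" and T: "folner_seq G T" and e: "0 < e" "e < 1" and \<eta>: "\<eta> > 0"
    and J: "finite J" "\<And>n. n \<in> J \<Longrightarrow> almost_inv (T m) (\<eta> * (1 - e) / (2 * card (T m))) (T n)"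
    and K: "finite K" "K \<subseteq> carrier G" "d > 0"
    and cov: "\<And>A. almost_inv K d A \<Longrightarrow> card (A - \<Union>(snd ` \<D>)) \<le> \<rho> * card A"
  obtains \<D>' K' d' where "packing T e (insert m J) \<D>'" "finite K'" "K' \<subseteq> carrier G" "d' > 0"
    "\<And>A. almost_inv K' d' A \<Longrightarrow> card (A - \<Union>(snd ` \<D>')) \<le> ((1 - e) * \<rho> + \<eta>) * card A"
proof -
  obtain \<D>' where \<D>': "\<D> \<subseteq> \<D>'" "packing T e (insert m J) \<D>'"
    "\<And>a. a \<in> carrier G \<Longrightarrow> e * card (T m) \<le> card ((T m #> a) \<inter> \<Union>(snd ` \<D>'))"
    using packing_extend[OF \<D> T e] by blast
  note Tm = folner_seqD[OF T]
  \<comment> \<open>There are card (T m) translations for each tile, and the tiles have total size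
    at most card A / (1 - e); so the outer rims of the old tiles take up at most \<eta>/2 of
    A.\<close>
  define d1 where "d1 = \<eta> * (1 - e) / (2 * card (T m))"
  \<comment> \<open>\<open>T m\<close> keeps t \<otimes> a in A; the triple products are those of
    \<open>translate_subset\<close> and put every old tile met by t \<otimes> a inside A.\<close>
  define K' where "K' = K \<union> T m \<union> (\<Union>n\<in>J. (\<lambda>(s, s', t). s \<otimes> inv s' \<otimes> t) ` (T n \<times> T n \<times> T m))"
  define d' where "d' = min d (\<eta> / 2)"
  define W where "W = \<Union>(snd ` \<D>)"
  define W' where "W' = \<Union>(snd ` \<D>')"
  have WW: "W \<subseteq> W'" using \<D>'(1) unfolding W_def W'_def by blast
  have W_fst: "W = \<Union>(fst ` \<D>)" using packingD(5)[OF \<D>] W_def by simp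
  have finK': "finite K'" unfolding K'_def using K J Tm by auto
  have K'c: "K' \<subseteq> carrier G" unfolding K'_def using K Tm by (auto simp: subset_iff)
  have "card (A - W') \<le> ((1 - e) * \<rho> + \<eta>) * card A" if inv: "almost_inv K' d' A" for A
  proof -
    note A = almost_invD[OF inv]
    define Bd where "Bd = {a\<in>A. \<exists>k\<in>K'. k \<otimes> a \<notin> A}"
    define \<P> where "\<P> = {p\<in>\<D>. fst p \<subseteq> A}"
    define Z where "Z = (\<Union>p\<in>\<P>. {a\<in>carrier G. a \<notin> fst p \<and> (\<exists>t\<in>T m. t \<otimes> a \<in> fst p)})"
    define A1 where "A1 = A - W - Bd - Z"
    have Bd: "card Bd \<le> \<eta> / 2 * card A"
    proof -
      have "card Bd \<le> d' * card A" using A(5) unfolding Bd_def .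
      also have "\<dots> \<le> \<eta> / 2 * card A" unfolding d'_def by (intro mult_right_mono) auto
      finally show ?thesis .
    qed
    have fin\<P>: "finite \<P>" and sum\<P>: "(1 - e) * (\<Sum>p\<in>\<P>. real (card (fst p))) \<le> real (card A)"
      using packing_sum_le[OF \<D> T A(1)] unfolding \<P>_def by auto
    have pb: "real (card {a\<in>carrier G. a \<notin> fst p \<and> (\<exists>t\<in>T m. t \<otimes> a \<in> fst p)}) \<le> card (T m) * (d1 * card (fst p))"
      "finite {a\<in>carrier G. a \<notin> fst p \<and> (\<exists>t\<in>T m. t \<otimes> a \<in> fst p)}" if "p \<in> \<P>" for p
    proof -
      obtain n c where n: "n \<in> J" "c \<in> carrier G" "fst p = T n #> c"
        using packingD(1)[OF \<D>, of p] \<open>p \<in> \<P>\<close> unfolding \<P>_def by blast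
      then have "almost_inv (T m) d1 (fst p)"
        using J(2)[OF n(1)] Tm unfolding d1_def by (simp add: almost_inv_r_coset)
      then show "real (card {a\<in>carrier G. a \<notin> fst p \<and> (\<exists>t\<in>T m. t \<otimes> a \<in> fst p)}) \<le> card (T m) * (d1 * card (fst p))"
        "finite {a\<in>carrier G. a \<notin> fst p \<and> (\<exists>t\<in>T m. t \<otimes> a \<in> fst p)}"
        using Tm by (intro card_outer_boundary; simp)+
    qed
    have finZ: "finite Z" unfolding Z_def using fin\<P> pb by blast
    have "card Z \<le> (\<Sum>p\<in>\<P>. card {a\<in>carrier G. a \<notin> fst p \<and> (\<exists>t\<in>T m. t \<otimes> a \<in> fst p)})"
      unfolding Z_def using fin\<P> by (rule card_UN_le)
    also have "real \<dots> \<le> (\<Sum>p\<in>\<P>. card (T m) * (d1 * card (fst p)))"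
      unfolding of_nat_sum using pb by (intro sum_mono)
    also have "\<dots> = card (T m) * d1 * (\<Sum>p\<in>\<P>. real (card (fst p)))"
      by (simp add: sum_distrib_left mult.assoc)
    also have "card (T m) * d1 = \<eta> / 2 * (1 - e)"
      unfolding d1_def using Tm(4)[of m] by (simp add: field_simps)
    also have "\<eta> / 2 * (1 - e) * (\<Sum>p\<in>\<P>. real (card (fst p))) \<le> \<eta> / 2 * card A"
      unfolding mult.assoc using sum\<P> \<eta> by (intro mult_left_mono) auto
    finally have Z: "card Z \<le> \<eta> / 2 * card A" by simp
    have A1: "t \<otimes> a \<in> A" "t \<otimes> a \<notin> W" if a: "a \<in> A1" and t: "t \<in> T m" for a t
    proof -
      have ac: "a \<in> carrier G" "a \<in> A" using a A unfolding A1_def by auto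
      have tc: "t \<in> carrier G" using t Tm(3)[of m] by auto
      have stay: "k \<otimes> a \<in> A" if "k \<in> K'" for k using a that unfolding A1_def Bd_def by auto
      show "t \<otimes> a \<in> A" using t by (intro stay) (simp add: K'_def)
      show "t \<otimes> a \<notin> W"
      proof
        assume "t \<otimes> a \<in> W"
        then obtain p where p: "p \<in> \<D>" "t \<otimes> a \<in> fst p" unfolding W_fst by blast
        obtain n c where n: "n \<in> J" "c \<in> carrier G" "fst p = T n #> c"
          using packingD(1)[OF \<D> p(1)] by blast
        have "fst p \<subseteq> A" unfolding n(3)
        proof (rule translate_subset[OF _ n(2) ac(1) tc])
          show "t \<otimes> a \<in> T n #> c" using p n by simp
          fix s s' assume "s \<in> T n" "s' \<in> T n"
          then have "s \<otimes> inv s' \<otimes> t \<in> K'" using n(1) t unfolding K'_def by force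
          then show "s \<otimes> inv s' \<otimes> t \<otimes> a \<in> A" by (rule stay)
        qed (use Tm in auto)
        then have "p \<in> \<P>" using p unfolding \<P>_def by blast
        moreover have "a \<notin> fst p" using a p(1) unfolding A1_def W_fst by blast
        ultimately have "a \<in> Z" using t p ac unfolding Z_def by blast
        then show False using a unfolding A1_def by blast
      qed
    qed
    have finA1: "finite A1" and A1c: "A1 \<subseteq> carrier G" unfolding A1_def using A by auto
    \<comment> \<open>Double count of the pairs (t, a) with t \<otimes> a in W'. Each a has at least
      e * card (T m) of them; for fixed t, left multiplication embeds the relevant a into the newly
      covered part of A.\<close>
    have "e * card (T m) * card A1 = (\<Sum>a\<in>A1. e * card (T m))" by simp
    also have "\<dots> \<le> (\<Sum>a\<in>A1. real (card (T m \<inter> {t. t \<otimes> a \<in> W'})))"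
    proof (rule sum_mono)
      fix a assume "a \<in> A1"
      then have a: "a \<in> carrier G" using A1c by auto
      have "(T m #> a) \<inter> W' = (\<lambda>t. t \<otimes> a) ` (T m \<inter> {t. t \<otimes> a \<in> W'})"
        by (auto simp: r_coset_def)
      then have "card ((T m #> a) \<inter> W') = card (T m \<inter> {t. t \<otimes> a \<in> W'})"
        using a Tm(3)[of m] by (simp add: card_image inj_on_right_mult le_infI1)
      then show "e * card (T m) \<le> real (card (T m \<inter> {t. t \<otimes> a \<in> W'}))"
        using \<D>'(3)[OF a] unfolding W'_def by simp
    qed
    also have "\<dots> = (\<Sum>a\<in>A1. \<Sum>t\<in>T m. of_bool (t \<otimes> a \<in> W'))"
      using Tm(2) by (simp add: sum_of_bool_eq)
    also have "\<dots> = (\<Sum>t\<in>T m. \<Sum>a\<in>A1. of_bool (t \<otimes> a \<in> W'))" by (rule sum.swap)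
    also have "\<dots> = (\<Sum>t\<in>T m. real (card (A1 \<inter> {a. t \<otimes> a \<in> W'})))"
      using finA1 by (simp add: sum_of_bool_eq)
    also have "\<dots> \<le> (\<Sum>t\<in>T m. real (card (A \<inter> W' - W)))"
    proof (rule sum_mono)
      fix t assume t: "t \<in> T m"
      then have tc: "t \<in> carrier G" using Tm by blast
      have "card (A1 \<inter> {a. t \<otimes> a \<in> W'}) = card ((\<lambda>a. t \<otimes> a) ` (A1 \<inter> {a. t \<otimes> a \<in> W'}))"
        using tc A1c by (intro card_image[symmetric] inj_on_left_mult) auto
      also have "\<dots> \<le> card (A \<inter> W' - W)"
        using A1 t A(1) by (intro card_mono) auto
      finally show "real (card (A1 \<inter> {a. t \<otimes> a \<in> W'})) \<le> real (card (A \<inter> W' - W))" by simp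
    qed
    also have "\<dots> = card (T m) * real (card (A \<inter> W' - W))" by simp
    finally have "card (T m) * (e * card A1) \<le> card (T m) * real (card (A \<inter> W' - W))" by (simp add: mult_ac)
    then have gain: "e * card A1 \<le> card (A \<inter> W' - W)" using Tm(4)[of m] by simp
    have "card (A - W) \<le> card (A1 \<union> Bd \<union> Z)"
      using finA1 finZ A(1) unfolding A1_def Bd_def by (intro card_mono) auto
    also have "\<dots> \<le> card A1 + card Bd + card Z"
      by (meson add_le_mono card_Un_le le_refl le_trans)
    finally have "card (A - W) \<le> card A1 + \<eta> * card A" using Bd Z by linarith
    then have "e * card (A - W) \<le> e * (card A1 + \<eta> * card A)" using e by (intro mult_left_mono) auto
    then have 1: "e * card (A - W) \<le> card (A \<inter> W' - W) + e * \<eta> * card A"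
      using gain by (simp add: algebra_simps)
    have "e * \<eta> * card A \<le> \<eta> * card A" using e \<eta> by (intro mult_right_mono) auto
    moreover have "(1 - e) * card (A - W) \<le> (1 - e) * (\<rho> * card A)"
    proof (intro mult_left_mono)
      have "almost_inv K d A"
        by (rule almost_inv_mono[OF inv]) (auto simp: K'_def d'_def)
      then show "card (A - W) \<le> \<rho> * card A" using cov unfolding W_def by blast
    qed (use e in auto)
    moreover have "card (A - W) = card (A - W') + card (A \<inter> W' - W)"
    proof -
      have "A - W = (A - W') \<union> (A \<inter> W' - W)" using WW by blast
      then have "card (A - W) = card ((A - W') \<union> (A \<inter> W' - W))" by simp
      also have "\<dots> = card (A - W') + card (A \<inter> W' - W)"
        using A(1) by (intro card_Un_disjoint) auto
      finally show ?thesis .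
    qed
    ultimately show ?thesis using 1 by (simp add: algebra_simps)
  qed
  then show thesis
    unfolding W'_def using K \<eta> by (intro that[of \<D>' K' d'] \<D>'(2) finK' K'c) (auto simp: d'_def)
qed

text \<open>The map \<rho> \<mapsto> (1 - e) * \<rho> + \<eta> has fixed point \<eta> / e, so k
  steps from 1 + \<eta> / e give this bound. The shape m is chosen first but placed last: the
  induction hypothesis is used beyond an index from which all shapes are almost invariant under
  \<open>T m\<close>, which is why N is arbitrary.\<close>

lemma exists_packing:
  fixes \<eta> e :: real
  assumes T: "folner_seq G T" and I: "infinite I" and e: "0 < e" "e < 1" and \<eta>: "\<eta> > 0"
  shows "\<exists>J \<D> K d. finite J \<and> J \<subseteq> I \<and> (\<forall>n\<in>J. N \<le> n) \<and> packing T e J \<D> \<and> finite K \<and> K \<subseteq> carrier G \<and> d > 0 \<and>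
    (\<forall>A. almost_inv K d A \<longrightarrow> card (A - \<Union>(snd ` \<D>)) \<le> ((1 - e) ^ k + \<eta> / e) * card A)"
proof (induction k arbitrary: N)
  case 0
  have "card A \<le> (1 + \<eta> / e) * card A" for A :: "'a set"
    using e \<eta> by (simp add: algebra_simps)
  then show ?case
    by (intro exI[of _ "{}"] exI[of _ 1]) (auto simp: packing_def)
next
  case (Suc k)
  obtain m where m: "m \<in> I" "m \<ge> N" using I infinite_nat_iff_unbounded_le by blast
  have "\<eta> * (1 - e) / (2 * card (T m)) > 0" using e \<eta> folner_seqD(4)[OF T, of m] by simp
  then have "eventually (\<lambda>n. almost_inv (T m) (\<eta> * (1 - e) / (2 * card (T m))) (T n)) sequentially"
    using folner_eventually_almost_inv[OF T] folner_seqD[OF T] by simp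
  then obtain N' where N': "\<And>n. n \<ge> N' \<Longrightarrow> almost_inv (T m) (\<eta> * (1 - e) / (2 * card (T m))) (T n)"
    unfolding eventually_sequentially by blast
  obtain J \<D> K d where 1: "finite J" "J \<subseteq> I" "\<forall>n\<in>J. max N N' \<le> n" "packing T e J \<D>"
    "finite K" "K \<subseteq> carrier G" "d > 0"
    "\<And>A. almost_inv K d A \<Longrightarrow> card (A - \<Union>(snd ` \<D>)) \<le> ((1 - e) ^ k + \<eta> / e) * card A"
    using Suc.IH[of "max N N'"] by blast
  obtain \<D>' K' d' where 2: "packing T e (insert m J) \<D>'" "finite K'" "K' \<subseteq> carrier G" "d' > 0"
    "\<And>A. almost_inv K' d' A \<Longrightarrow> card (A - \<Union>(snd ` \<D>')) \<le> ((1 - e) * ((1 - e) ^ k + \<eta> / e) + \<eta>) * card A"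
    using packing_extend_uncovered[OF 1(4) T e \<eta> 1(1) _ 1(5-8), of m] N' 1(3)
    by (metis (no_types, lifting) max.bounded_iff)
  have "(1 - e) * ((1 - e) ^ k + \<eta> / e) + \<eta> = (1 - e) ^ Suc k + \<eta> / e"
    using e by (simp add: field_simps)
  then show ?case
    using 1 2 m by (intro exI[of _ "insert m J"] exI[of _ \<D>'] exI[of _ K'] exI[of _ d']) auto
qed

text \<open>Each tile is replaced by the core of its part, the points that \<open>P\<close> does not
  move out of the part. Then \<open>P\<close> moves a piece only within its own part, which no other
  core meets. Almost invariance of the shapes under \<open>P\<close> keeps the cores nearly as large
  as the tiles.\<close>

theorem quasi_tiling:
  fixes \<epsilon> :: real
  assumes T: "folner_seq G T" and I: "infinite I" and \<epsilon>: "0 < \<epsilon>" "\<epsilon> < 1" and P: "finite P" "P \<subseteq> carrier G"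
  obtains \<A> J K d where "finite J" "J \<subseteq> I"
    "\<And>A. A \<in> \<A> \<Longrightarrow> \<exists>n\<in>J. \<exists>c\<in>carrier G. A \<subseteq> T n #> c \<and> (1 - \<epsilon>) * card (T n) \<le> card A"
    "\<And>A B p a. A \<in> \<A> \<Longrightarrow> B \<in> \<A> \<Longrightarrow> A \<noteq> B \<Longrightarrow> p \<in> P \<Longrightarrow> a \<in> A \<Longrightarrow> p \<otimes> a \<notin> B"
    "disjoint \<A>" "finite K" "K \<subseteq> carrier G" "d > 0"
    "\<And>B. almost_inv K d B \<Longrightarrow> card (B - \<Union>{A\<in>\<A>. A \<subseteq> B}) \<le> \<epsilon> * card B"
proof -
  \<comment> \<open>The losses are 2e for uncovered points, e for the boundary and 2 * (e + card P *
    e) for points cut off from the parts, in total below \<epsilon> = (16 + 8 * card P) * e.\<close>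
  define e where "e = \<epsilon> / (8 * (real (card P) + 2))"
  have e8: "e * (8 * (real (card P) + 2)) = \<epsilon>" unfolding e_def by (simp add: add_nonneg_eq_0_iff)
  have e0: "e > 0" unfolding e_def using \<epsilon> by simp
  have pe: "card P * e \<ge> 0" using e0 by simp
  have e_eq: "8 * (card P * e) + 16 * e = \<epsilon>" using e8 by (simp add: algebra_simps)
  have e1: "e < 1/16" using e_eq \<epsilon> pe by linarith
  have "eventually (\<lambda>n. almost_inv P e (T n)) sequentially"
    using folner_eventually_almost_inv[OF T P e0] .
  then obtain N where N: "\<And>n. n \<ge> N \<Longrightarrow> almost_inv P e (T n)"
    unfolding eventually_sequentially by blast
  obtain k where k: "(1 - e) ^ k < e" using e0 e1 real_arch_pow_inv[of e "1 - e"] by auto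
  have e1': "e < 1" using e1 by simp
  have ee: "e * e > 0" using e0 by simp
  \<comment> \<open>\<eta> = e * e makes the error \<eta> / e equal to e, and (1 - e) ^ k < e, so at
    most 2e stays uncovered.\<close>
  obtain J \<D> K d where 1: "finite J" "J \<subseteq> I" "\<forall>n\<in>J. N \<le> n" and \<D>: "packing T e J \<D>"
    and K: "finite K" "K \<subseteq> carrier G" "d > 0"
    and cov: "\<And>A. almost_inv K d A \<Longrightarrow> card (A - \<Union>(snd ` \<D>)) \<le> ((1 - e) ^ k + (e * e) / e) * card A"
    using exists_packing[OF T I e0 e1' ee, of N k] by blast
  define core where "core p = {a \<in> snd p. \<forall>q\<in>P. q \<otimes> a \<in> snd p}" for p :: "'a set \<times> 'a set"
  \<comment> \<open>If a tile through b leaves B, one of these quotients moves b out of B; so a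
    covered b off the boundary has its whole tile in B.\<close>
  define K' where "K' = K \<union> (\<Union>n\<in>J. (\<lambda>(s, s'). s \<otimes> inv s') ` (T n \<times> T n))"
  define d' where "d' = min d e"
  note Tm = folner_seqD[OF T]
  have K': "finite K'" "K' \<subseteq> carrier G" "d' > 0"
    using K 1 Tm e0 unfolding K'_def d'_def by (auto simp: subset_iff)
  have lost: "card (snd p - core p) \<le> (e + card P * e) * card (fst p)" if p: "p \<in> \<D>" for p
  proof -
    obtain n c where n: "n \<in> J" "c \<in> carrier G" "fst p = T n #> c"
      using packingD(1)[OF \<D> p] by blast
    then have "almost_inv P e (fst p)" using N 1 P by (simp add: almost_inv_r_coset)
    from inner_boundary_subset[OF this P packingD(2)[OF \<D> p] packingD(3)[OF \<D> p]]
    have "real (card {a \<in> snd p. \<exists>k\<in>P. k \<otimes> a \<notin> snd p}) \<le> (e + card P * e) * card (fst p)" .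
    moreover have "{a \<in> snd p. \<exists>k\<in>P. k \<otimes> a \<notin> snd p} = snd p - core p" unfolding core_def by blast
    ultimately show ?thesis by simp
  qed
  have core_card: "(1 - \<epsilon>) * card (fst p) \<le> card (core p)" if p: "p \<in> \<D>" for p
  proof -
    have fin: "finite (snd p)" using packing_fst[OF \<D> T p] packingD(2)[OF \<D> p] finite_subset by blast
    have "card (snd p) = card (core p) + card (snd p - core p)"
      using fin by (subst card_Diff_subset) (auto simp: core_def card_mono)
    then have "(1 - e) * card (fst p) \<le> card (core p) + (e + card P * e) * card (fst p)"
      using lost[OF p] packingD(3)[OF \<D> p] by simp
    then have "(1 - e - (e + card P * e)) * card (fst p) \<le> card (core p)" by (simp add: algebra_simps)
    moreover have "(1 - \<epsilon>) * card (fst p) \<le> (1 - e - (e + card P * e)) * card (fst p)"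
      using e_eq pe e0 by (intro mult_right_mono) auto
    ultimately show ?thesis by linarith
  qed
  have core_disj: "core p \<inter> snd q = {}" if "p \<in> \<D>" "q \<in> \<D>" "core p \<noteq> core q" for p q
    using packingD(4)[OF \<D> that(1,2)] that(3) unfolding core_def by blast
  show thesis
  proof (rule that[of J "core ` \<D>" K' d'])
    show "\<exists>n\<in>J. \<exists>c\<in>carrier G. A \<subseteq> T n #> c \<and> (1 - \<epsilon>) * card (T n) \<le> card A" if A: "A \<in> core ` \<D>" for A
    proof -
      obtain p where p: "p \<in> \<D>" "A = core p" using A by blast
      obtain n c where n: "n \<in> J" "c \<in> carrier G" "fst p = T n #> c"
        using packingD(1)[OF \<D> p(1)] by blast
      have "A \<subseteq> T n #> c" using p packingD(2)[OF \<D> p(1)] n unfolding core_def by blast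
      moreover have "(1 - \<epsilon>) * card (T n) \<le> card A"
        using core_card[OF p(1)] n Tm p by (simp add: card_r_coset)
      ultimately show ?thesis using n by blast
    qed
    show "q \<otimes> a \<notin> B" if AB: "A \<in> core ` \<D>" "B \<in> core ` \<D>" "A \<noteq> B" and q: "q \<in> P" and a: "a \<in> A" for A B q a
    proof -
      obtain p p' where p: "p \<in> \<D>" "A = core p" "p' \<in> \<D>" "B = core p'" using AB by blast
      have "q \<otimes> a \<in> snd p" using a q p unfolding core_def by blast
      moreover have "core p' \<inter> snd p = {}" using AB(3) p by (intro core_disj) auto
      ultimately show ?thesis using p by blast
    qed
    show "disjoint (core ` \<D>)"
      unfolding disjoint_def
    proof (intro ballI impI)
      fix A B assume "A \<in> core ` \<D>" "B \<in> core ` \<D>" "A \<noteq> B"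
      then obtain p q where "p \<in> \<D>" "q \<in> \<D>" "A = core p" "B = core q" "core p \<noteq> core q" by blast
      moreover have "core q \<subseteq> snd q" unfolding core_def by blast
      ultimately show "A \<inter> B = {}" using core_disj[of p q] by blast
    qed
    show "card (B - \<Union>{A\<in>core ` \<D>. A \<subseteq> B}) \<le> \<epsilon> * card B" if inv: "almost_inv K' d' B" for B
    proof -
      note B = almost_invD[OF inv]
      define \<P> where "\<P> = {p\<in>\<D>. fst p \<subseteq> B}"
      have fin\<P>: "finite \<P>" and sum\<P>: "(1 - e) * (\<Sum>p\<in>\<P>. real (card (fst p))) \<le> real (card B)"
        using packing_sum_le[OF \<D> T B(1)] unfolding \<P>_def by auto
      let ?Bd = "{a\<in>B. \<exists>k\<in>K'. k \<otimes> a \<notin> B}" and ?L = "\<Union>p\<in>\<P>. snd p - core p"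
      have "B - \<Union>{A\<in>core ` \<D>. A \<subseteq> B} \<subseteq> (B - \<Union>(snd ` \<D>)) \<union> ?Bd \<union> ?L"
      proof
        fix b assume b: "b \<in> B - \<Union>{A\<in>core ` \<D>. A \<subseteq> B}"
        show "b \<in> (B - \<Union>(snd ` \<D>)) \<union> ?Bd \<union> ?L"
        proof (rule ccontr)
          assume no: "b \<notin> (B - \<Union>(snd ` \<D>)) \<union> ?Bd \<union> ?L"
          then obtain p where p: "p \<in> \<D>" "b \<in> snd p" using b by blast
          obtain n c where n: "n \<in> J" "c \<in> carrier G" "fst p = T n #> c"
            using packingD(1)[OF \<D> p(1)] by blast
          have bc: "b \<in> carrier G" using b B by blast
          have "fst p \<subseteq> B" unfolding n(3)
          proof (rule translate_subset[OF _ n(2) bc one_closed])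
            show "\<one> \<otimes> b \<in> T n #> c" using p n packingD(2)[OF \<D> p(1)] bc by auto
            fix s s' assume s: "s \<in> T n" "s' \<in> T n"
            then have "s \<otimes> inv s' \<in> K'" using n(1) unfolding K'_def by force
            then have "s \<otimes> inv s' \<otimes> b \<in> B" using no b by blast
            moreover have "s \<otimes> inv s' \<otimes> \<one> \<otimes> b = s \<otimes> inv s' \<otimes> b"
              using s Tm(3)[of n] by (simp add: subset_iff)
            ultimately show "s \<otimes> inv s' \<otimes> \<one> \<otimes> b \<in> B" by simp
          qed (use Tm in auto)
          moreover have "core p \<subseteq> fst p" using packingD(2)[OF \<D> p(1)] unfolding core_def by blast
          ultimately have "p \<in> \<P>" "core p \<subseteq> B" using p unfolding \<P>_def by auto
          then show False using b no p by blast
        qed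
      qed
      moreover have finL: "finite ?L"
        using fin\<P> packing_fst[OF \<D> T] packingD(2)[OF \<D>] finite_subset unfolding \<P>_def
        by (metis (no_types, lifting) finite_Diff finite_UN_I mem_Collect_eq)
      ultimately have "card (B - \<Union>{A\<in>core ` \<D>. A \<subseteq> B}) \<le> card ((B - \<Union>(snd ` \<D>)) \<union> ?Bd \<union> ?L)"
        using B(1) by (intro card_mono) auto
      also have "\<dots> \<le> card (B - \<Union>(snd ` \<D>)) + card ?Bd + card ?L"
        by (meson add_le_mono card_Un_le le_refl le_trans)
      finally have le: "real (card (B - \<Union>{A\<in>core ` \<D>. A \<subseteq> B})) \<le> card (B - \<Union>(snd ` \<D>)) + card ?Bd + card ?L"
        by linarith
      have "almost_inv K d B" by (rule almost_inv_mono[OF inv]) (auto simp: K'_def d'_def)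
      then have "card (B - \<Union>(snd ` \<D>)) \<le> ((1 - e) ^ k + (e * e) / e) * card B" by (rule cov)
      also have "\<dots> \<le> (2 * e) * card B" using k e0 by (intro mult_right_mono) auto
      finally have b1: "card (B - \<Union>(snd ` \<D>)) \<le> (2 * e) * card B" .
      have "card ?Bd \<le> d' * card B" by (rule B(5))
      also have "\<dots> \<le> e * card B" unfolding d'_def by (intro mult_right_mono) auto
      finally have b2: "card ?Bd \<le> e * card B" .
      have "card ?L \<le> (\<Sum>p\<in>\<P>. card (snd p - core p))" using fin\<P> by (rule card_UN_le)
      also have "real \<dots> \<le> (\<Sum>p\<in>\<P>. (e + card P * e) * card (fst p))"
        unfolding of_nat_sum using lost unfolding \<P>_def by (intro sum_mono) auto
      also have "\<dots> = (e + card P * e) * (\<Sum>p\<in>\<P>. real (card (fst p)))" by (simp add: sum_distrib_left)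
      also have "\<dots> \<le> (e + card P * e) * (2 * card B)"
      proof (intro mult_left_mono)
        have "(1/2) * (\<Sum>p\<in>\<P>. real (card (fst p))) \<le> (1 - e) * (\<Sum>p\<in>\<P>. real (card (fst p)))"
          using e1 by (intro mult_right_mono sum_nonneg) auto
        then show "(\<Sum>p\<in>\<P>. real (card (fst p))) \<le> 2 * card B" using sum\<P> by simp
      qed (use e0 in auto)
      finally have b3: "card ?L \<le> (2 * e + 2 * (card P * e)) * card B" by (simp add: algebra_simps)
      have "card (B - \<Union>{A\<in>core ` \<D>. A \<subseteq> B}) \<le> (5 * e + 2 * (card P * e)) * card B"
        using le b1 b2 b3 by (simp add: algebra_simps)
      also have "\<dots> \<le> \<epsilon> * card B" using e_eq e0 pe by (intro mult_right_mono) auto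
      finally show ?thesis .
    qed
  qed (use 1 K' in auto)
qed

end

section \<open>The Ornstein--Weiss lemma\<close>

lemma infinite_near_subseq_limit:
  fixes X :: "nat \<Rightarrow> real"
  assumes r: "strict_mono r" and X: "(X \<circ> r) \<longlonglongrightarrow> l" and e: "e > 0"
  shows "infinite {n. \<bar>X n - l\<bar> < e}"
proof -
  obtain N where N: "\<And>n. n \<ge> N \<Longrightarrow> \<bar>X (r n) - l\<bar> < e"
    using X e unfolding lim_sequentially dist_real_def by auto
  have "infinite (r ` {N..})"
    using r by (simp add: finite_image_iff strict_mono_imp_inj_on infinite_Ici)
  moreover have "r ` {N..} \<subseteq> {n. \<bar>X n - l\<bar> < e}" using N by auto
  ultimately show ?thesis using finite_subset by blast
qed

text \<open>If l is a subsequential limit but not the limit, infinitely many terms stay at distance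
  e from l and have a limit point of their own. Limit points are expressed by infinite index sets
  because \<open>quasi_tiling\<close> draws its shapes from an infinite set of indices.\<close>

lemma nonconvergent_two_limit_points:
  fixes X :: "nat \<Rightarrow> real"
  assumes bdd: "bounded (range X)" and nc: "\<not> convergent X"
  obtains a b where "a < b" "\<And>e. e > 0 \<Longrightarrow> infinite {n. \<bar>X n - a\<bar> < e}"
    "\<And>e. e > 0 \<Longrightarrow> infinite {n. \<bar>X n - b\<bar> < e}"
proof -
  obtain l r where lr: "strict_mono r" "(X \<circ> r) \<longlonglongrightarrow> l"
    using bounded_imp_convergent_subsequence[OF bdd] by blast
  have "\<not> X \<longlonglongrightarrow> l" using nc convergentI by blast
  then obtain e where e: "e > 0" "\<And>N. \<exists>n\<ge>N. \<not> \<bar>X n - l\<bar> < e"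
    unfolding lim_sequentially dist_real_def by auto
  let ?I = "{n. \<not> \<bar>X n - l\<bar> < e}"
  have inf: "infinite ?I" unfolding infinite_nat_iff_unbounded_le using e(2) by auto
  let ?X = "X \<circ> enumerate ?I"
  have "bounded (range ?X)" by (rule bounded_subset[OF bdd]) auto
  then obtain l' r' where lr': "strict_mono r'" "(?X \<circ> r') \<longlonglongrightarrow> l'"
    using bounded_imp_convergent_subsequence by blast
  have "strict_mono (enumerate ?I \<circ> r')"
    using lr'(1) inf by (intro strict_mono_o strict_mono_enumerate)
  moreover have "(X \<circ> (enumerate ?I \<circ> r')) \<longlonglongrightarrow> l'" using lr'(2) by (simp add: o_assoc)
  ultimately have l': "\<And>e. e > 0 \<Longrightarrow> infinite {n. \<bar>X n - l'\<bar> < e}"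
    by (rule infinite_near_subseq_limit)
  have "(\<lambda>n. \<bar>(?X \<circ> r') n - l\<bar>) \<longlonglongrightarrow> \<bar>l' - l\<bar>" by (intro tendsto_intros lr'(2))
  moreover have "eventually (\<lambda>n. e \<le> \<bar>(?X \<circ> r') n - l\<bar>) sequentially"
    using enumerate_in_set[OF inf] by (intro always_eventually allI) (auto simp: not_less)
  ultimately have "e \<le> \<bar>l' - l\<bar>"
    using tendsto_lowerbound trivial_limit_sequentially by blast
  then have "l < l' \<or> l' < l" using e(1) by auto
  then show thesis
    using that[of l l'] that[of l' l] infinite_near_subseq_limit[OF lr] l' by blast
qed

lemma disjoint_subsets_card:
  assumes "disjoint \<A>" "finite B"
  shows "finite {A\<in>\<A>. A \<subseteq> B}"
    and "card (\<Union>{A\<in>\<A>. A \<subseteq> B}) = (\<Sum>A\<in>{A\<in>\<A>. A \<subseteq> B}. card A)"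
    and "(\<Sum>A\<in>{A\<in>\<A>. A \<subseteq> B}. real (card A)) = real (card B) - real (card (B - \<Union>{A\<in>\<A>. A \<subseteq> B}))"
proof -
  let ?Q = "{A\<in>\<A>. A \<subseteq> B}"
  show "finite ?Q" by (rule finite_subset[of _ "Pow B"]) (use assms in auto)
  show c: "card (\<Union>?Q) = (\<Sum>A\<in>?Q. card A)"
  proof (rule card_Union_disjoint)
    show "pairwise disjnt ?Q" using assms(1) by (rule pairwise_subset) auto
    show "\<And>A. A \<in> ?Q \<Longrightarrow> finite A" using assms(2) finite_subset by blast
  qed
  have "card (B - \<Union>?Q) = card B - card (\<Union>?Q)" "card (\<Union>?Q) \<le> card B"
    using finite_subset[of "\<Union>?Q" B] assms(2) by (auto intro!: card_Diff_subset card_mono)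
  then show "(\<Sum>A\<in>?Q. real (card A)) = real (card B) - real (card (B - \<Union>?Q))"
    using c by (simp add: of_nat_diff)
qed

text \<open>Modelled on the logarithm of the minimal number of a subcover. The inequality for right
  translates is an equality in disguise, by translating back.\<close>

locale subadditive_set_function = group G for G :: "('a, 'b) monoid_scheme" (structure) +
  fixes f :: "'a set \<Rightarrow> real"
  assumes f_mono: "\<And>A B. finite B \<Longrightarrow> B \<subseteq> carrier G \<Longrightarrow> A \<subseteq> B \<Longrightarrow> f A \<le> f B"
    and f_Un: "\<And>A B. finite A \<Longrightarrow> A \<subseteq> carrier G \<Longrightarrow> finite B \<Longrightarrow> B \<subseteq> carrier G \<Longrightarrow> f (A \<union> B) \<le> f A + f B"
    and f_r_coset: "\<And>A c. finite A \<Longrightarrow> A \<subseteq> carrier G \<Longrightarrow> c \<in> carrier G \<Longrightarrow> f (A #> c) \<le> f A"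
    and f_empty: "f {} = 0"
begin

lemma f_nonneg: "finite A \<Longrightarrow> A \<subseteq> carrier G \<Longrightarrow> 0 \<le> f A"
  using f_mono[of A "{}"] f_empty by simp

lemma f_le_card:
  assumes "finite A" "A \<subseteq> carrier G"
  shows "f A \<le> f {\<one>} * card A"
  using assms
proof (induction A rule: finite_induct)
  case (insert a A)
  have "{\<one>} #> a = {a}" using insert by (simp add: r_coset_def)
  then have "f {a} \<le> f {\<one>}" using f_r_coset[of "{\<one>}" a] insert by simp
  moreover have "f (insert a A) \<le> f {a} + f A" using f_Un[of "{a}" A] insert by simp
  ultimately show ?case using insert by (simp add: algebra_simps)
qed (simp add: f_empty)

lemma f_Union:
  assumes "finite \<Q>" "\<And>A. A \<in> \<Q> \<Longrightarrow> finite A \<and> A \<subseteq> carrier G"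
  shows "f (\<Union>\<Q>) \<le> (\<Sum>A\<in>\<Q>. f A)"
  using assms
proof (induction \<Q> rule: finite_induct)
  case (insert A \<Q>)
  have "finite (\<Union>\<Q>)" "\<Union>\<Q> \<subseteq> carrier G" using insert by auto
  then have "f (A \<union> \<Union>\<Q>) \<le> f A + f (\<Union>\<Q>)" using insert by (intro f_Un) auto
  then show ?case using insert by fastforce
qed (simp add: f_empty)

text \<open>Tile with shapes taken only from the indices where the ratio is at most r. Each piece
  inherits the ratio up to the factor 1 + 2\<epsilon>, the uncovered part costs at most M per point,
  and subadditivity adds this up on every sufficiently invariant set.\<close>

lemma ornstein_weiss_bound:
  fixes r e :: real
  assumes F: "folner_seq G F" and T: "folner_seq G T"
    and r: "infinite {n. f (T n) \<le> r * card (T n)}" and e: "e > 0"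
  shows "eventually (\<lambda>n. f (F n) \<le> (r + e) * card (F n)) sequentially"
proof -
  note Tm = folner_seqD[OF T]
  obtain n0 where "f (T n0) \<le> r * card (T n0)" using r not_finite_existsD by blast
  then have r0: "r \<ge> 0" using f_nonneg[of "T n0"] Tm[of n0] zero_le_mult_iff[of r "real (card (T n0))"] by linarith
  define M where "M = f {\<one>}"
  have M0: "M \<ge> 0" unfolding M_def by (rule f_nonneg) auto
  \<comment> \<open>The pieces being smaller than the shapes costs 2r\<epsilon>, the uncovered
    points M\<epsilon>; the summand 1 keeps the denominator positive.\<close>
  define \<epsilon> where "\<epsilon> = min (1/2) (e / (2 * r + M + 1))"
  have "\<epsilon> \<le> 1/2" unfolding \<epsilon>_def by (rule min.cobounded1)
  moreover have "0 < \<epsilon>" unfolding \<epsilon>_def using e r0 M0 by auto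
  ultimately have \<epsilon>: "0 < \<epsilon>" "\<epsilon> < 1" "\<epsilon> \<le> 1/2" by auto
  have "\<epsilon> * (2 * r + M + 1) \<le> (e / (2 * r + M + 1)) * (2 * r + M + 1)"
    unfolding \<epsilon>_def using r0 M0 by (intro mult_right_mono) auto
  then have \<epsilon>e: "\<epsilon> * (2 * r + M + 1) \<le> e" using r0 M0 by (simp split: if_splits)
  obtain \<A> J K d where J: "finite J" "J \<subseteq> {n. f (T n) \<le> r * card (T n)}"
    and A: "\<And>A. A \<in> \<A> \<Longrightarrow> \<exists>n\<in>J. \<exists>c\<in>carrier G. A \<subseteq> T n #> c \<and> (1 - \<epsilon>) * card (T n) \<le> card A"
    and dj: "disjoint \<A>" and K: "finite K" "K \<subseteq> carrier G" "d > 0"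
    and cov: "\<And>B. almost_inv K d B \<Longrightarrow> card (B - \<Union>{A\<in>\<A>. A \<subseteq> B}) \<le> \<epsilon> * card B"
    by (rule quasi_tiling[OF T r \<epsilon>(1,2), of "{}"]) auto
  have fA: "f A \<le> r * (1 + 2 * \<epsilon>) * card A" if AA: "A \<in> \<A>" for A
  proof -
    obtain n c where n: "n \<in> J" "c \<in> carrier G" "A \<subseteq> T n #> c" "(1 - \<epsilon>) * card (T n) \<le> card A"
      using A[OF AA] by blast
    have "f A \<le> f (T n #> c)" using n Tm by (intro f_mono) (auto simp: finite_r_coset r_coset_subset_G)
    also have "\<dots> \<le> f (T n)" using n Tm by (intro f_r_coset) auto
    also have "\<dots> \<le> r * card (T n)" using n J by auto
    also have "\<dots> \<le> r * ((1 + 2 * \<epsilon>) * card A)"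
    proof (intro mult_left_mono r0)
      have "\<epsilon> * (1 - 2 * \<epsilon>) \<ge> 0" using \<epsilon> by simp
      then have "1 \<le> (1 + 2 * \<epsilon>) * (1 - \<epsilon>)" by (simp add: algebra_simps)
      then have "1 * real (card (T n)) \<le> (1 + 2 * \<epsilon>) * (1 - \<epsilon>) * card (T n)" by (intro mult_right_mono) auto
      also have "\<dots> \<le> (1 + 2 * \<epsilon>) * card A" unfolding mult.assoc using n \<epsilon> by (intro mult_left_mono) auto
      finally show "card (T n) \<le> (1 + 2 * \<epsilon>) * card A" by simp
    qed
    finally show ?thesis by simp
  qed
  have "f B \<le> (r + e) * card B" if inv: "almost_inv K d B" for B
  proof -
    note B = almost_invD[OF inv]
    let ?Q = "{A\<in>\<A>. A \<subseteq> B}"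
    note Q = disjoint_subsets_card[OF dj B(1)]
    have sub: "\<Union>?Q \<subseteq> B" by blast
    have "B = \<Union>?Q \<union> (B - \<Union>?Q)" by blast
    then have "f B \<le> f (\<Union>?Q) + f (B - \<Union>?Q)"
      using f_Un[of "\<Union>?Q" "B - \<Union>?Q"] B sub finite_subset[OF sub B(1)] by auto
    also have "f (\<Union>?Q) \<le> (\<Sum>A\<in>?Q. f A)"
      using Q(1) B finite_subset[OF _ B(1)] by (intro f_Union) auto
    also have "\<dots> \<le> (\<Sum>A\<in>?Q. r * (1 + 2 * \<epsilon>) * card A)" using fA by (intro sum_mono) auto
    also have "\<dots> = r * (1 + 2 * \<epsilon>) * (\<Sum>A\<in>?Q. real (card A))" by (simp add: sum_distrib_left)
    also have "\<dots> \<le> r * (1 + 2 * \<epsilon>) * card B" unfolding Q(3) using r0 \<epsilon> by (intro mult_left_mono) auto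
    also have "f (B - \<Union>?Q) \<le> M * card (B - \<Union>?Q)" unfolding M_def using B by (intro f_le_card) auto
    also have "\<dots> \<le> M * (\<epsilon> * card B)" using cov[OF inv] M0 by (intro mult_left_mono) auto
    finally have "f B \<le> (r + \<epsilon> * (2 * r + M)) * card B" by (simp add: algebra_simps)
    also have "\<dots> \<le> (r + e) * card B"
      using \<epsilon>e \<epsilon> by (intro mult_right_mono) (auto simp: algebra_simps)
    finally show ?thesis .
  qed
  then show ?thesis
    using folner_eventually_almost_inv[OF F K] by (auto elim: eventually_mono)
qed

lemma ornstein_weiss_limit_le:
  assumes F: "folner_seq G F" and T: "folner_seq G T"
    and lF: "(\<lambda>n. f (F n) / card (F n)) \<longlonglongrightarrow> x" and lT: "(\<lambda>n. f (T n) / card (T n)) \<longlonglongrightarrow> y"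
  shows "x \<le> y"
proof (rule field_le_epsilon)
  fix e :: real assume e: "e > 0"
  have "eventually (\<lambda>n. f (T n) / card (T n) < y + e / 2) sequentially"
    using lT e by (intro order_tendstoD) auto
  then have "eventually (\<lambda>n. f (T n) \<le> (y + e / 2) * card (T n)) sequentially"
    by eventually_elim (use folner_seqD(4)[OF T] in \<open>simp add: divide_less_eq\<close>)
  then have "infinite {n. f (T n) \<le> (y + e / 2) * card (T n)}"
    by (auto simp: infinite_nat_iff_unbounded_le eventually_sequentially) (metis nat_le_linear)
  then have "eventually (\<lambda>n. f (F n) \<le> (y + e / 2 + e / 2) * card (F n)) sequentially"
    by (rule ornstein_weiss_bound[OF F T]) (use e in simp)
  then have "eventually (\<lambda>n. f (F n) / card (F n) \<le> y + e) sequentially"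
    by eventually_elim (use folner_seqD(4)[OF F] in \<open>simp add: divide_le_eq algebra_simps\<close>)
  then show "x \<le> y + e" using tendsto_upperbound[OF lF] by simp
qed

text \<open>With \<open>F\<close> in both roles of the bound, infinitely many ratios near a limit
  point a push all later ratios below a larger limit point b. Used between two Folner sequences, the
  bound identifies their limits.\<close>

theorem ornstein_weiss:
  "\<exists>h. \<forall>F. folner_seq G F \<longrightarrow> (\<lambda>n. f (F n) / card (F n)) \<longlonglongrightarrow> h"
proof -
  have conv: "convergent (\<lambda>n. f (F n) / card (F n))" if F: "folner_seq G F" for F
  proof (rule ccontr)
    let ?X = "\<lambda>n. f (F n) / card (F n)"
    assume nc: "\<not> convergent ?X"
    note Fm = folner_seqD[OF F]
    have "bounded (range ?X)"
    proof (rule boundedI)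
      fix x assume "x \<in> range ?X"
      then obtain n where n: "x = ?X n" by blast
      have "0 \<le> f (F n)" "f (F n) \<le> f {\<one>} * card (F n)"
        using f_nonneg f_le_card Fm by auto
      then show "norm x \<le> f {\<one>}" unfolding n using Fm(4)[of n] by (simp add: divide_le_eq)
    qed
    then obtain a b where ab: "a < b" "\<And>e. e > 0 \<Longrightarrow> infinite {n. \<bar>?X n - a\<bar> < e}"
      "\<And>e. e > 0 \<Longrightarrow> infinite {n. \<bar>?X n - b\<bar> < e}"
      using nonconvergent_two_limit_points[OF _ nc] by blast
    \<comment> \<open>Thirds of the gap: ratios at most a + e infinitely often force ratios at most
      a + 2e = b - e eventually, against ratios above b - e infinitely often.\<close>
    define e where "e = (b - a) / 3"
    have e: "e > 0" "a + e + e = b - e" using ab unfolding e_def by (auto simp: field_simps)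
    have "{n. \<bar>?X n - a\<bar> < e} \<subseteq> {n. f (F n) \<le> (a + e) * card (F n)}"
    proof
      fix n assume "n \<in> {n. \<bar>?X n - a\<bar> < e}"
      then have "?X n \<le> a + e" by auto
      then show "n \<in> {n. f (F n) \<le> (a + e) * card (F n)}" using Fm(4)[of n] by (simp add: divide_le_eq)
    qed
    then have "infinite {n. f (F n) \<le> (a + e) * card (F n)}"
      using ab(2)[OF e(1)] finite_subset by blast
    then have "eventually (\<lambda>n. f (F n) \<le> (a + e + e) * card (F n)) sequentially"
      by (rule ornstein_weiss_bound[OF F F _ e(1)])
    then obtain N where N: "\<And>n. n \<ge> N \<Longrightarrow> f (F n) \<le> (b - e) * card (F n)"
      unfolding eventually_sequentially e(2) by blast
    obtain n where n: "n \<ge> N" "\<bar>?X n - b\<bar> < e"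
      using ab(3)[OF e(1)] unfolding infinite_nat_iff_unbounded_le by auto
    have "?X n \<le> b - e" using N[OF n(1)] Fm(4)[of n] by (simp add: divide_le_eq)
    then show False using n(2) by auto
  qed
  show ?thesis
  proof (cases "\<exists>T. folner_seq G T")
    case True
    then obtain T where T: "folner_seq G T" by blast
    obtain h where h: "(\<lambda>n. f (T n) / card (T n)) \<longlonglongrightarrow> h" using conv[OF T] by (auto simp: convergent_def)
    have "(\<lambda>n. f (F n) / card (F n)) \<longlonglongrightarrow> h" if F: "folner_seq G F" for F
    proof -
      obtain x where x: "(\<lambda>n. f (F n) / card (F n)) \<longlonglongrightarrow> x" using conv[OF F] by (auto simp: convergent_def)
      have "x = h" using ornstein_weiss_limit_le[OF F T x h] ornstein_weiss_limit_le[OF T F h x] by simp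
      then show ?thesis using x by simp
    qed
    then show ?thesis by blast
  qed blast
qed

end

section \<open>Covers and the upper bound\<close>

lemma min_subcover_card_le_refine:
  assumes "finite W" "\<Union>W = UNIV" "\<And>w. w \<in> W \<Longrightarrow> \<exists>u\<in>U. w \<subseteq> u"
  shows "min_subcover_card U \<le> card W"
proof -
  obtain g where g: "\<And>w. w \<in> W \<Longrightarrow> g w \<in> U \<and> w \<subseteq> g w" using assms(3) by metis
  have "\<Union>(g ` W) = UNIV" using assms(2) g by blast
  then have "\<exists>V\<subseteq>U. finite V \<and> \<Union>V = UNIV \<and> card V = card (g ` W)"
    using assms(1) g by (intro exI[of _ "g ` W"]) auto
  then have "min_subcover_card U \<le> card (g ` W)"
    unfolding min_subcover_card_def by (rule Least_le)
  also have "\<dots> \<le> card W" using assms(1) by (rule card_image_le)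
  finally show ?thesis .
qed

lemma min_subcover_card_attained:
  assumes "\<exists>V\<subseteq>U. finite V \<and> \<Union>V = UNIV"
  obtains V where "V \<subseteq> U" "finite V" "\<Union>V = UNIV" "card V = min_subcover_card U"
proof -
  have "\<exists>V\<subseteq>U. finite V \<and> \<Union>V = UNIV \<and> card V = min_subcover_card U"
    unfolding min_subcover_card_def by (rule LeastI_ex) (use assms in blast)
  then show thesis using that by blast
qed

lemma open_cover_balls:
  assumes "r > 0"
  shows "open_cover (range (\<lambda>x. ball x r))"
  unfolding open_cover_def
proof
  show "\<Union>(range (\<lambda>x. ball x r)) = UNIV"
  proof (intro equalityI subsetI UnionI)
    show "x \<in> ball x r" for x using assms by simp
  qed auto
qed auto

sublocale dynamical_system \<subseteq> group G
  using group_hom by (rule group_hom.axioms(1))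

context dynamical_system
begin

lemma action_mult:
  "s \<in> carrier G \<Longrightarrow> t \<in> carrier G \<Longrightarrow> \<alpha> (s \<otimes> t) x = \<alpha> s (\<alpha> t x)"
  by (rule composition_rule) auto

lemma action_inv:
  assumes "s \<in> carrier G"
  shows "\<alpha> (inv s) (\<alpha> s x) = x"
  using orbit_sym_aux[of s x "\<alpha> s x"] assms by simp

lemma open_cover_finite_subcover:
  assumes "open_cover (U :: 'x set set)"
  shows "\<exists>V\<subseteq>U. finite V \<and> \<Union>V = UNIV"
proof -
  obtain V where "V \<subseteq> U" "finite V" "UNIV \<subseteq> \<Union>V"
    using compactE[OF compact_space, of U] assms unfolding open_cover_def by auto
  then show ?thesis by blast
qed

lemma min_subcover_card_pos:
  assumes "open_cover (U :: 'x set set)"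
  shows "min_subcover_card U \<ge> 1"
proof -
  obtain V where V: "V \<subseteq> U" "finite V" "\<Union>V = UNIV" "card V = min_subcover_card U"
    by (rule min_subcover_card_attained[OF open_cover_finite_subcover[OF assms]])
  have "V \<noteq> {}" using V(3) by auto
  then have "card V > 0" using V(2) by (simp add: card_gt_0_iff)
  then show ?thesis using V(4) by simp
qed

lemma open_cover_join_over:
  assumes U: "open_cover U" and A: "finite A" "A \<subseteq> carrier G"
  shows "open_cover (join_over \<alpha> A U)"
  unfolding open_cover_def
proof (intro conjI ballI)
  fix B assume "B \<in> join_over \<alpha> A U"
  then obtain c where c: "B = (\<Inter>s\<in>A. \<alpha> s -` c s)" "\<forall>s\<in>A. c s \<in> U"
    unfolding join_over_def by blast
  have "open (\<alpha> s -` c s)" if "s \<in> A" for s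
  proof (rule open_vimage)
    show "open (c s)" using that c(2) U unfolding open_cover_def by simp
    show "continuous_on UNIV (\<alpha> s)" using that A by (intro continuous_action) auto
  qed
  then show "open B" unfolding c using A by (intro open_INT) auto
next
  have "x \<in> \<Union>(join_over \<alpha> A U)" for x
  proof -
    have "\<exists>u. u \<in> U \<and> \<alpha> s x \<in> u" for s
    proof -
      have "\<alpha> s x \<in> \<Union>U" using U unfolding open_cover_def by simp
      then show ?thesis by (auto simp: Union_iff)
    qed
    then have "\<forall>s. \<exists>u. u \<in> U \<and> \<alpha> s x \<in> u" by blast
    then obtain c where c: "\<forall>s. c s \<in> U \<and> \<alpha> s x \<in> c s" by (rule choice[THEN exE])
    then have "x \<in> (\<Inter>s\<in>A. \<alpha> s -` c s)" by simp
    moreover have "(\<Inter>s\<in>A. \<alpha> s -` c s) \<in> join_over \<alpha> A U"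
      unfolding join_over_def mem_Collect_eq by (rule exI[of _ c]) (use c in simp)
    ultimately show ?thesis by (rule UnionI[rotated])
  qed
  then show "\<Union>(join_over \<alpha> A U) = UNIV" by (intro equalityI subsetI) auto
qed

section \<open>Entropy of a cover as a subadditive set function\<close>

definition cover_entropy :: "'x set set \<Rightarrow> 'g set \<Rightarrow> real" where
  "cover_entropy U A = ln (real (min_subcover_card (join_over \<alpha> A U)))"

lemma exp_cover_entropy:
  assumes "open_cover U" "finite A" "A \<subseteq> carrier G"
  shows "exp (cover_entropy U A) = min_subcover_card (join_over \<alpha> A U)"
  using min_subcover_card_pos[OF open_cover_join_over[OF assms]] unfolding cover_entropy_def by simp

text \<open>Subcovers coarsen to smaller index sets, two of them intersect to one for the union, and
  \<alpha> g pulls a subcover for A back to one for \<open>A #> g\<close>; each time a finite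
  refinement bounds the minimal number.\<close>

lemma subadditive_cover_entropy:
  assumes U: "open_cover U"
  shows "subadditive_set_function G (cover_entropy U)"
proof
  have attained: thesis if "finite A" "A \<subseteq> carrier G"
      "\<And>V. V \<subseteq> join_over \<alpha> A U \<Longrightarrow> finite V \<Longrightarrow> \<Union>V = UNIV \<Longrightarrow>
        card V = min_subcover_card (join_over \<alpha> A U) \<Longrightarrow> thesis" for A thesis
    by (rule min_subcover_card_attained[OF open_cover_finite_subcover[OF open_cover_join_over[OF U that(1,2)]]])
      (rule that(3))
  have pos: "min_subcover_card (join_over \<alpha> A U) \<ge> 1" if "finite A" "A \<subseteq> carrier G" for A
    using min_subcover_card_pos[OF open_cover_join_over[OF U that]] .
  show "cover_entropy U A \<le> cover_entropy U B" if B: "finite B" "B \<subseteq> carrier G" "A \<subseteq> B" for A B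
  proof -
    obtain V where V: "V \<subseteq> join_over \<alpha> B U" "finite V" "\<Union>V = UNIV" "card V = min_subcover_card (join_over \<alpha> B U)"
      by (rule attained[OF B(1,2)])
    have "min_subcover_card (join_over \<alpha> A U) \<le> card V"
    proof (rule min_subcover_card_le_refine[OF V(2,3)])
      fix v assume "v \<in> V"
      then obtain c where c: "v = (\<Inter>s\<in>B. \<alpha> s -` c s)" "\<forall>s\<in>B. c s \<in> U"
        using V(1) unfolding join_over_def by blast
      then have "(\<Inter>s\<in>A. \<alpha> s -` c s) \<in> join_over \<alpha> A U" using B unfolding join_over_def by blast
      moreover have "v \<subseteq> (\<Inter>s\<in>A. \<alpha> s -` c s)" unfolding c using B by blast
      ultimately show "\<exists>u\<in>join_over \<alpha> A U. v \<subseteq> u" by blast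
    qed
    moreover have "finite A" "A \<subseteq> carrier G" using B finite_subset by auto
    ultimately show ?thesis using pos[of A] V(4) unfolding cover_entropy_def by simp
  qed
  show "cover_entropy U (A \<union> B) \<le> cover_entropy U A + cover_entropy U B"
    if A: "finite A" "A \<subseteq> carrier G" and B: "finite B" "B \<subseteq> carrier G" for A B
  proof -
    obtain V where V: "V \<subseteq> join_over \<alpha> A U" "finite V" "\<Union>V = UNIV" "card V = min_subcover_card (join_over \<alpha> A U)"
      by (rule attained[OF A])
    obtain W where W: "W \<subseteq> join_over \<alpha> B U" "finite W" "\<Union>W = UNIV" "card W = min_subcover_card (join_over \<alpha> B U)"
      by (rule attained[OF B])
    let ?VW = "(\<lambda>(v, w). v \<inter> w) ` (V \<times> W)"
    have fin: "finite ?VW" using V W by simp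
    have "\<Union>?VW = \<Union>V \<inter> \<Union>W" by auto
    then have un: "\<Union>?VW = UNIV" using V W by simp
    have "min_subcover_card (join_over \<alpha> (A \<union> B) U) \<le> card ?VW"
    proof (rule min_subcover_card_le_refine[OF fin un])
      fix z assume "z \<in> ?VW"
      then obtain v w where z: "z = v \<inter> w" "v \<in> V" "w \<in> W" by auto
      obtain c where c: "v = (\<Inter>s\<in>A. \<alpha> s -` c s)" "\<forall>s\<in>A. c s \<in> U"
        using V(1) z(2) unfolding join_over_def by blast
      obtain c' where c': "w = (\<Inter>s\<in>B. \<alpha> s -` c' s)" "\<forall>s\<in>B. c' s \<in> U"
        using W(1) z(3) unfolding join_over_def by blast
      let ?c = "\<lambda>s. if s \<in> A then c s else c' s"
      have "(\<Inter>s\<in>A \<union> B. \<alpha> s -` ?c s) \<in> join_over \<alpha> (A \<union> B) U"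
        unfolding join_over_def mem_Collect_eq by (rule exI[of _ ?c]) (use c(2) c'(2) in auto)
      moreover have "z \<subseteq> (\<Inter>s\<in>A \<union> B. \<alpha> s -` ?c s)" unfolding z c c' by auto
      ultimately show "\<exists>u\<in>join_over \<alpha> (A \<union> B) U. z \<subseteq> u" by blast
    qed
    also have "\<dots> \<le> card (V \<times> W)" using V W by (intro card_image_le) auto
    also have "\<dots> = min_subcover_card (join_over \<alpha> A U) * min_subcover_card (join_over \<alpha> B U)"
      using V W by (simp add: card_cartesian_product)
    finally have le: "min_subcover_card (join_over \<alpha> (A \<union> B) U) \<le> \<dots>" .
    have "cover_entropy U (A \<union> B) \<le> ln (real (min_subcover_card (join_over \<alpha> A U) * min_subcover_card (join_over \<alpha> B U)))"
      unfolding cover_entropy_def using pos[of "A \<union> B"] A B le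
      by (intro ln_mono) (simp_all del: of_nat_mult)
    also have "\<dots> = cover_entropy U A + cover_entropy U B"
      unfolding cover_entropy_def using pos[OF A] pos[OF B] by (simp add: ln_mult)
    finally show ?thesis .
  qed
  show "cover_entropy U (A #> g) \<le> cover_entropy U A" if A: "finite A" "A \<subseteq> carrier G" and g: "g \<in> carrier G" for A g
  proof -
    obtain V where V: "V \<subseteq> join_over \<alpha> A U" "finite V" "\<Union>V = UNIV" "card V = min_subcover_card (join_over \<alpha> A U)"
      by (rule attained[OF A])
    let ?V = "(\<lambda>v. \<alpha> g -` v) ` V"
    have fin: "finite ?V" using V by simp
    have "\<Union>?V = \<alpha> g -` (\<Union>V)" by auto
    then have un: "\<Union>?V = UNIV" using V by simp
    have "min_subcover_card (join_over \<alpha> (A #> g) U) \<le> card ?V"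
    proof (rule min_subcover_card_le_refine[OF fin un])
      fix z assume "z \<in> ?V"
      then obtain v where v: "v \<in> V" "z = \<alpha> g -` v" by blast
      obtain c where c: "v = (\<Inter>s\<in>A. \<alpha> s -` c s)" "\<forall>s\<in>A. c s \<in> U"
        using V(1) v(1) unfolding join_over_def by blast
      let ?c = "\<lambda>t. c (t \<otimes> inv g)"
      have sg: "(s \<otimes> g) \<otimes> inv g = s" if "s \<in> A" for s using that A g by (auto simp: m_assoc subset_iff)
      have "(\<Inter>t\<in>A #> g. \<alpha> t -` ?c t) \<in> join_over \<alpha> (A #> g) U"
        unfolding join_over_def mem_Collect_eq
        by (rule exI[of _ ?c]) (use c(2) sg in \<open>auto simp: mem_r_coset\<close>)
      moreover have "z \<subseteq> (\<Inter>t\<in>A #> g. \<alpha> t -` ?c t)"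
      proof
        fix x assume x: "x \<in> z"
        have "\<alpha> (s \<otimes> g) x \<in> c (s \<otimes> g \<otimes> inv g)" if s: "s \<in> A" for s
        proof -
          have "\<alpha> (s \<otimes> g) x = \<alpha> s (\<alpha> g x)" using s A g by (intro action_mult) auto
          moreover have "\<alpha> s (\<alpha> g x) \<in> c s" using x s unfolding v c by auto
          ultimately show ?thesis using sg[OF s] by simp
        qed
        then show "x \<in> (\<Inter>t\<in>A #> g. \<alpha> t -` ?c t)" by (auto simp: mem_r_coset)
      qed
      ultimately show "\<exists>u\<in>join_over \<alpha> (A #> g) U. z \<subseteq> u" by blast
    qed
    also have "\<dots> \<le> card V" using V by (intro card_image_le) auto
    finally have "min_subcover_card (join_over \<alpha> (A #> g) U) \<le> min_subcover_card (join_over \<alpha> A U)"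
      using V by simp
    then show ?thesis
      using pos[of "A #> g"] A g unfolding cover_entropy_def
      by (simp add: finite_r_coset r_coset_subset_G)
  qed
  have "join_over \<alpha> {} U = {UNIV}" unfolding join_over_def by auto
  then have "min_subcover_card (join_over \<alpha> {} U) \<le> card {UNIV :: 'x set}"
    by (intro min_subcover_card_le_refine) auto
  then have "min_subcover_card (join_over \<alpha> {} U) = 1" using pos[of "{}"] by simp
  then show "cover_entropy U {} = 0" unfolding cover_entropy_def by simp
qed

text \<open>Shows that the definite description in \<open>top_entropy_cover\<close> denotes:
  existence is the Ornstein--Weiss limit, uniqueness that of limits along the given
  \<open>F\<close>.\<close>

lemma top_entropy_cover_tendsto:
  assumes U: "open_cover U" and F: "folner_seq G F"
  shows "(\<lambda>n. cover_entropy U (F n) / card (F n)) \<longlonglongrightarrow> top_entropy_cover G \<alpha> U"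
proof -
  interpret subadditive_set_function G "cover_entropy U" by (rule subadditive_cover_entropy[OF U])
  let ?P = "\<lambda>h. \<forall>F. folner_seq G F \<longrightarrow> (\<lambda>n. cover_entropy U (F n) / card (F n)) \<longlonglongrightarrow> h"
  obtain h where h: "?P h" using ornstein_weiss by blast
  have "?P (THE h. ?P h)"
  proof (rule theI[where P = ?P, OF h])
    fix h' assume "?P h'"
    then show "h' = h" using h F LIMSEQ_unique by blast
  qed
  then show ?thesis using F unfolding top_entropy_cover_def cover_entropy_def by blast
qed

section \<open>Growth of Folner sets and the upper bound for Bowen entropy\<close>

lemma folner_card_ge:
  assumes F: "folner_seq G F"
  shows "eventually (\<lambda>n. k \<le> card (F n)) sequentially"
proof -
  obtain K where K: "finite K" "card K = k" "K \<subseteq> carrier G"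
    using infinite_arbitrarily_large[OF infinite_group] by blast
  have "eventually (\<lambda>n. almost_inv K (1/2) (F n)) sequentially"
    using folner_eventually_almost_inv[OF F K(1,3)] by simp
  then show ?thesis
    by eventually_elim (use almost_inv_card_ge K in force)
qed

lemma folner_card_at_top:
  assumes F: "folner_seq G F"
  shows "filterlim (\<lambda>n. real (card (F n))) at_top sequentially"
  unfolding filterlim_at_top
proof
  fix Z :: real
  show "eventually (\<lambda>n. Z \<le> real (card (F n))) sequentially"
    using folner_card_ge[OF F, of "nat \<lceil>Z\<rceil>"] by eventually_elim linarith
qed

lemma mem_bowen_ball:
  assumes "finite A" "A \<noteq> {}"
  shows "y \<in> bowen_ball \<alpha> A x \<epsilon> \<longleftrightarrow> (\<forall>s\<in>A. dist (\<alpha> s x) (\<alpha> s y) < \<epsilon>)"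
  unfolding bowen_ball_def using assms by simp

text \<open>Two points of one member of the join of balls of radius \<epsilon>/2 are closer than
  \<epsilon> in the metric of \<open>F n\<close>, so the member lies in the Bowen ball around any of
  its points. A minimal subcover at the single level n bounds the infimum.\<close>

lemma bowen_sum_inf_le:
  assumes F: "folner_seq G F" and n: "N \<le> n" and \<epsilon>: "\<epsilon> > 0"
  shows "bowen_sum_inf \<alpha> F Y \<epsilon> N s \<le>
    ennreal (exp (cover_entropy (range (\<lambda>x. ball x (\<epsilon> / 2))) (F n) - s * card (F n)))"
proof -
  let ?U = "range (\<lambda>x::'x. ball x (\<epsilon> / 2))"
  note Fn = folner_seqD[OF F, of n]
  have U: "open_cover ?U" using \<epsilon> by (intro open_cover_balls) simp
  obtain V where V: "V \<subseteq> join_over \<alpha> (F n) ?U" "finite V" "\<Union>V = UNIV" "card V = min_subcover_card (join_over \<alpha> (F n) ?U)"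
    by (rule min_subcover_card_attained[OF open_cover_finite_subcover[OF open_cover_join_over[OF U Fn(2,3)]]])
  \<comment> \<open>For an empty member the chosen point is arbitrary, but its inclusion in the ball
    is then trivial.\<close>
  define p where "p v = (SOME x. x \<in> v)" for v :: "'x set"
  define C where "C = (\<lambda>v. (n, p v)) ` V"
  have ball: "v \<subseteq> bowen_ball \<alpha> (F n) (p v) \<epsilon>" if v: "v \<in> V" for v
  proof
    fix y assume y: "y \<in> v"
    then have pv: "p v \<in> v" unfolding p_def by (rule someI)
    obtain c where c: "v = (\<Inter>s\<in>F n. \<alpha> s -` c s)" "\<forall>s\<in>F n. c s \<in> ?U"
      using V(1) v unfolding join_over_def by blast
    have "dist (\<alpha> s (p v)) (\<alpha> s y) < \<epsilon>" if s: "s \<in> F n" for s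
    proof -
      obtain z where "c s = ball z (\<epsilon> / 2)" using c s by blast
      then have "dist z (\<alpha> s (p v)) < \<epsilon> / 2" "dist z (\<alpha> s y) < \<epsilon> / 2" using y pv s c(1) by auto
      then show ?thesis using dist_triangle_half_r by blast
    qed
    then show "y \<in> bowen_ball \<alpha> (F n) (p v) \<epsilon>" using Fn by (simp add: mem_bowen_ball)
  qed
  have "Y \<subseteq> (\<Union>(m, x)\<in>C. bowen_ball \<alpha> (F m) x \<epsilon>)"
  proof
    fix y
    have "y \<in> \<Union>V" using V(3) by simp
    then obtain v where "v \<in> V" "y \<in> v" by (rule UnionE)
    then show "y \<in> (\<Union>(m, x)\<in>C. bowen_ball \<alpha> (F m) x \<epsilon>)" using ball[of v] unfolding C_def by auto
  qed
  then have "C \<in> bowen_covers \<alpha> F Y \<epsilon> N"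
    unfolding bowen_covers_def C_def using V(2) n by (auto intro: countable_finite)
  then have "bowen_sum_inf \<alpha> F Y \<epsilon> N s \<le> (\<Sum>\<^sub>\<infinity>(m, x)\<in>C. ennreal (exp (- s * real (card (F m)))))"
    unfolding bowen_sum_inf_def by (rule INF_lower)
  also have "\<dots> = (\<Sum>(m, x)\<in>C. ennreal (exp (- s * real (card (F m)))))"
    using V(2) unfolding C_def by (intro infsum_finite) auto
  also have "\<dots> = (\<Sum>c\<in>C. ennreal (exp (- s * real (card (F n)))))"
    unfolding C_def by (intro sum.cong) auto
  also have "\<dots> = ennreal (card C * exp (- s * real (card (F n))))"
    by (simp add: ennreal_mult ennreal_of_nat_eq_real_of_nat)
  also have "\<dots> \<le> ennreal (card V * exp (- s * real (card (F n))))"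
    unfolding C_def using V(2) by (intro ennreal_leI mult_right_mono) (auto intro: card_image_le)
  also have "real (card V) = exp (cover_entropy ?U (F n))"
    using exp_cover_entropy[OF U Fn(2,3)] V by simp
  also have "\<dots> * exp (- s * real (card (F n))) = exp (cover_entropy ?U (F n) - s * card (F n))"
    by (simp add: exp_add[symmetric])
  finally show ?thesis .
qed

text \<open>If s exceeds the entropy h of the cover by balls of radius \<epsilon>/2, the covers at
  one level n have sum at most exp (- \<eta> * card (F n)) for large n, where \<eta> = (s - h) / 2,
  and this tends to 0 because the Folner sets grow.\<close>

lemma bowen_entropy_scale_le:
  assumes F: "folner_seq G F" and \<epsilon>: "\<epsilon> > 0"
  shows "bowen_entropy_scale \<alpha> F Y \<epsilon> \<le> top_entropy G \<alpha>"
proof -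
  let ?U = "range (\<lambda>x::'x. ball x (\<epsilon> / 2))"
  have U: "open_cover ?U" using \<epsilon> by (intro open_cover_balls) simp
  define h where "h = top_entropy_cover G \<alpha> ?U"
  interpret subadditive_set_function G "cover_entropy ?U" by (rule subadditive_cover_entropy[OF U])
  have lim: "(\<lambda>n. cover_entropy ?U (F n) / card (F n)) \<longlonglongrightarrow> h"
    unfolding h_def by (rule top_entropy_cover_tendsto[OF U F])
  have h0: "h \<ge> 0"
  proof (rule tendsto_lowerbound[OF lim])
    have "0 \<le> cover_entropy ?U (F n) / card (F n)" for n
      using f_nonneg[of "F n"] folner_seqD[OF F, of n] by simp
    then show "eventually (\<lambda>n. 0 \<le> cover_entropy ?U (F n) / card (F n)) sequentially" by simp
  qed simp
  have scale: "bowen_entropy_scale \<alpha> F Y \<epsilon> \<le> ereal s" if s: "s > h" for s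
  proof -
    define \<eta> where "\<eta> = (s - h) / 2"
    have \<eta>: "\<eta> > 0" "h + \<eta> = s - \<eta>" using s unfolding \<eta>_def by (auto simp: field_simps)
    have "bowen_sum_inf \<alpha> F Y \<epsilon> N s = 0" for N
    proof -
      have "bowen_sum_inf \<alpha> F Y \<epsilon> N s \<le> 0 + ennreal e" if e: "e > 0" for e
      proof -
        have "eventually (\<lambda>n. cover_entropy ?U (F n) / card (F n) < s - \<eta>) sequentially"
          using lim \<eta> by (intro order_tendstoD) auto
        moreover have "eventually (\<lambda>n. - ln e / \<eta> \<le> real (card (F n))) sequentially"
          using folner_card_at_top[OF F] unfolding filterlim_at_top by blast
        ultimately have "eventually (\<lambda>n. bowen_sum_inf \<alpha> F Y \<epsilon> N s \<le> ennreal e) sequentially"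
          using eventually_ge_at_top[of N]
        proof eventually_elim
          case (elim n)
          have "cover_entropy ?U (F n) \<le> (s - \<eta>) * card (F n)"
            using elim(1) folner_seqD(4)[OF F, of n] by (simp add: divide_less_eq)
          moreover have "- ln e \<le> \<eta> * card (F n)" using elim(2) \<eta>(1) by (simp only: pos_divide_le_eq mult.commute)
          ultimately have "cover_entropy ?U (F n) - s * card (F n) \<le> ln e" by (simp add: algebra_simps)
          then have "exp (cover_entropy ?U (F n) - s * card (F n)) \<le> e"
            using e by (metis exp_le_cancel_iff exp_ln)
          then show ?case using bowen_sum_inf_le[OF F elim(3) \<epsilon>, of Y s] by (meson ennreal_leI order_trans)
        qed
        then show ?thesis unfolding eventually_sequentially by auto
      qed
      then have "bowen_sum_inf \<alpha> F Y \<epsilon> N s \<le> 0" by (rule ennreal_le_epsilon)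
      then show ?thesis by simp
    qed
    then have "bowen_measure \<alpha> F Y \<epsilon> s = 0" unfolding bowen_measure_def by (simp add: limI)
    then show ?thesis unfolding bowen_entropy_scale_def using s h0 by (intro Inf_lower) auto
  qed
  have "bowen_entropy_scale \<alpha> F Y \<epsilon> \<le> ereal h"
  proof (rule ereal_le_epsilon2)
    fix e :: real assume "e > 0"
    then show "bowen_entropy_scale \<alpha> F Y \<epsilon> \<le> ereal h + ereal e" using scale[of "h + e"] by simp
  qed
  also have "\<dots> \<le> top_entropy G \<alpha>"
    unfolding top_entropy_def h_def using U by (intro SUP_upper) auto
  finally show ?thesis .
qed

text \<open>Let l be a Lebesgue number of the cover. The Bowen balls of radius l around a largest
  l-separated set cover the space, and each lies in a member of the join, so that set is at least as
  large as a minimal subcover.\<close>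

lemma exists_separated_set:
  assumes U: "open_cover U"
  obtains l where "l > 0" "\<And>A. finite A \<Longrightarrow> A \<subseteq> carrier G \<Longrightarrow>
    \<exists>\<Gamma>. finite \<Gamma> \<and> exp (cover_entropy U A) \<le> card \<Gamma> \<and> (\<forall>x\<in>\<Gamma>. \<forall>y\<in>\<Gamma>. x \<noteq> y \<longrightarrow> (\<exists>s\<in>A. l \<le> dist (\<alpha> s x) (\<alpha> s y)))"
proof -
  have "UNIV \<subseteq> \<Union>U" "\<And>u. u \<in> U \<Longrightarrow> open u" using U unfolding open_cover_def by simp_all
  then obtain l where l: "l > 0" "\<And>x::'x. x \<in> UNIV \<Longrightarrow> \<exists>u\<in>U. ball x l \<subseteq> u"
    by (rule Heine_Borel_lemma[OF compact_space]) auto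
  have "\<exists>\<Gamma>. finite \<Gamma> \<and> exp (cover_entropy U A) \<le> card \<Gamma> \<and> (\<forall>x\<in>\<Gamma>. \<forall>y\<in>\<Gamma>. x \<noteq> y \<longrightarrow> (\<exists>s\<in>A. l \<le> dist (\<alpha> s x) (\<alpha> s y)))"
    if A: "finite A" "A \<subseteq> carrier G" for A
  proof (rule ccontr)
    let ?N = "min_subcover_card (join_over \<alpha> A U)"
    let ?sep = "\<lambda>\<Gamma>. finite \<Gamma> \<and> (\<forall>x\<in>\<Gamma>. \<forall>y\<in>\<Gamma>. x \<noteq> y \<longrightarrow> (\<exists>s\<in>A. l \<le> dist (\<alpha> s x) (\<alpha> s y)))"
    assume "\<not> ?thesis"
    then have less: "\<forall>\<Gamma>. ?sep \<Gamma> \<longrightarrow> card \<Gamma> < ?N"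
      unfolding exp_cover_entropy[OF U A] by force
    have "?sep {}" by simp
    from this less have "\<exists>\<Gamma>. ?sep \<Gamma> \<and> (\<forall>\<Gamma>'. ?sep \<Gamma>' \<longrightarrow> card \<Gamma>' \<le> card \<Gamma>)"
      by (rule ex_has_greatest_nat[where P = ?sep])
    then obtain \<Gamma> where *: "?sep \<Gamma> \<and> (\<forall>\<Gamma>'. ?sep \<Gamma>' \<longrightarrow> card \<Gamma>' \<le> card \<Gamma>)" by (rule exE)
    note \<Gamma> = conjunct1[OF *] and max = conjunct2[OF *]
    define B where "B x = {y. \<forall>s\<in>A. dist (\<alpha> s x) (\<alpha> s y) < l}" for x
    have "\<exists>x\<in>\<Gamma>. y \<in> B x" for y
    proof (cases "y \<in> \<Gamma>")
      case True
      then show ?thesis using l unfolding B_def by (intro bexI[of _ y]) auto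
    next
      case False
      have "\<not> ?sep (insert y \<Gamma>)"
      proof
        assume "?sep (insert y \<Gamma>)"
        then have "card (insert y \<Gamma>) \<le> card \<Gamma>" using max by simp
        then show False using False \<Gamma> by simp
      qed
      moreover have "finite (insert y \<Gamma>)" using \<Gamma> by simp
      ultimately have "\<not> (\<forall>a\<in>insert y \<Gamma>. \<forall>b\<in>insert y \<Gamma>. a \<noteq> b \<longrightarrow> (\<exists>s\<in>A. l \<le> dist (\<alpha> s a) (\<alpha> s b)))"
        by blast
      then have "\<exists>a\<in>insert y \<Gamma>. \<exists>b\<in>insert y \<Gamma>. a \<noteq> b \<and> (\<forall>s\<in>A. dist (\<alpha> s a) (\<alpha> s b) < l)"
        by (simp only: not_le[symmetric]) blast
      then obtain a b where ab: "a \<in> insert y \<Gamma>" "b \<in> insert y \<Gamma>" "a \<noteq> b" "\<forall>s\<in>A. dist (\<alpha> s a) (\<alpha> s b) < l"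
        by blast
      have "\<not> (a \<in> \<Gamma> \<and> b \<in> \<Gamma>)"
      proof
        assume "a \<in> \<Gamma> \<and> b \<in> \<Gamma>"
        then obtain s where "s \<in> A" "l \<le> dist (\<alpha> s a) (\<alpha> s b)" using \<Gamma> ab(3) by auto
        then show False using ab(4) by force
      qed
      then consider "a = y" "b \<in> \<Gamma>" | "b = y" "a \<in> \<Gamma>" using ab by auto
      then show ?thesis
      proof cases
        case 1
        then show ?thesis using ab(4) unfolding B_def by (intro bexI[of _ b]) (simp_all add: dist_commute)
      next
        case 2
        then show ?thesis using ab(4) unfolding B_def by (intro bexI[of _ a]) simp_all
      qed
    qed
    then have un: "\<Union>(B ` \<Gamma>) = UNIV" by (auto simp: set_eq_iff)
    have "?N \<le> card (B ` \<Gamma>)"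
    proof (rule min_subcover_card_le_refine[OF _ un])
      fix w assume "w \<in> B ` \<Gamma>"
      then obtain x where x: "w = B x" by blast
      have "\<exists>u. u \<in> U \<and> ball (\<alpha> s x) l \<subseteq> u" for s using l(2)[of "\<alpha> s x"] by auto
      then obtain c where c: "\<And>s. c s \<in> U \<and> ball (\<alpha> s x) l \<subseteq> c s" by metis
      then have "(\<Inter>s\<in>A. \<alpha> s -` c s) \<in> join_over \<alpha> A U"
        unfolding join_over_def mem_Collect_eq by (intro exI[of _ c]) simp
      moreover have "w \<subseteq> (\<Inter>s\<in>A. \<alpha> s -` c s)"
      proof (intro subsetI INT_I vimageI2)
        fix y s assume "y \<in> w" "s \<in> A"
        then have "\<alpha> s y \<in> ball (\<alpha> s x) l" unfolding x B_def by simp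
        then show "\<alpha> s y \<in> c s" using c[of s] by blast
      qed
      ultimately show "\<exists>u\<in>join_over \<alpha> A U. w \<subseteq> u" by blast
    qed (use \<Gamma> in simp)
    also have "\<dots> \<le> card \<Gamma>" using \<Gamma> by (intro card_image_le) simp
    finally show False using less \<Gamma> by (meson leD)
  qed
  then show thesis using that l(1) by blast
qed

end

section \<open>Specification and Birkhoff sums\<close>

lemma exists_large_fibre:
  assumes A: "finite A" and B: "finite B" "B \<noteq> {}" and f: "\<And>x. x \<in> A \<Longrightarrow> f x \<in> B"
  obtains y where "y \<in> B" "card A \<le> card B * card {x\<in>A. f x = y}"
proof -
  let ?c = "\<lambda>y. card {x\<in>A. f x = y}"
  have "Max (?c ` B) \<in> ?c ` B" using B by (intro Max_in) auto
  then obtain y where y: "y \<in> B" "?c y = Max (?c ` B)" by auto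
  have "A = (\<Union>y\<in>B. {x\<in>A. f x = y})" using f by auto
  then have "card A \<le> (\<Sum>y\<in>B. ?c y)" using card_UN_le[OF B(1), of "\<lambda>y. {x\<in>A. f x = y}"] by simp
  also have "\<dots> \<le> of_nat (card B) * ?c y"
    unfolding y(2) using B(1) by (intro sum_bounded_above Max_ge) auto
  finally show thesis using that y by simp
qed

text \<open>Add members one at a time until the sum first reaches t; the last one overshoots by at
  most R.\<close>

lemma exists_subfamily_sum:
  fixes w :: "'i \<Rightarrow> real"
  assumes "finite S" "\<And>x. x \<in> S \<Longrightarrow> w x \<le> R" "t \<le> sum w S" "0 \<le> t" "0 \<le> R"
  shows "\<exists>S'\<subseteq>S. t \<le> sum w S' \<and> sum w S' \<le> t + R"
  using assms
proof (induction S rule: finite_induct)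
  case (insert x S)
  show ?case
  proof (cases "t \<le> sum w S")
    case True
    then obtain S' where "S' \<subseteq> S" "t \<le> sum w S'" "sum w S' \<le> t + R" using insert by auto
    then show ?thesis by blast
  next
    case False
    have "sum w (insert x S) = w x + sum w S" using insert by simp
    moreover have "w x \<le> R" using insert by simp
    ultimately have "t \<le> sum w (insert x S) \<and> sum w (insert x S) \<le> t + R" using insert.prems(2) False by linarith
    then show ?thesis by blast
  qed
qed auto

lemma sum_over_pieces:
  fixes g :: "'a \<Rightarrow> real" and w :: "'a set \<Rightarrow> real" and \<epsilon> \<kappa> b :: real
  assumes dj: "disjoint \<A>" and B: "finite B" and c: "real (card (B - \<Union>{A\<in>\<A>. A \<subseteq> B})) \<le> \<epsilon> * card B"
    and w: "\<And>A. A \<in> \<A> \<Longrightarrow> A \<subseteq> B \<Longrightarrow> \<bar>sum g A - w A * card A\<bar> \<le> \<kappa> * card A"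
    and b: "\<And>s. \<bar>g s\<bar> \<le> b" and \<kappa>: "\<kappa> \<ge> 0"
  shows "\<bar>sum g B - (\<Sum>A\<in>{A\<in>\<A>. A \<subseteq> B}. w A * card A)\<bar> \<le> (\<kappa> + b * \<epsilon>) * card B"
proof -
  let ?Q = "{A\<in>\<A>. A \<subseteq> B}"
  note Q = disjoint_subsets_card[OF dj B]
  have sub: "\<Union>?Q \<subseteq> B" by blast
  have "sum g B = sum g (B - \<Union>?Q) + sum g (\<Union>?Q)" by (rule sum.subset_diff[OF sub B])
  also have "sum g (\<Union>?Q) = (\<Sum>A\<in>?Q. sum g A)"
  proof (subst sum.Union_disjoint)
    show "\<forall>A\<in>?Q. finite A" using B finite_subset by blast
    show "\<forall>A\<in>?Q. \<forall>B\<in>?Q. A \<noteq> B \<longrightarrow> A \<inter> B = {}" using dj unfolding disjoint_def by simp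
  qed simp
  finally have eq: "sum g B - (\<Sum>A\<in>?Q. w A * card A) = sum g (B - \<Union>?Q) + (\<Sum>A\<in>?Q. sum g A - w A * card A)"
    by (simp add: sum_subtractf)
  have b0: "b \<ge> 0" using b[of undefined] by simp
  have "\<bar>sum g (B - \<Union>?Q)\<bar> \<le> (\<Sum>s\<in>B - \<Union>?Q. \<bar>g s\<bar>)" by (rule sum_abs)
  also have "\<dots> \<le> real (card (B - \<Union>?Q)) * b" using b by (intro sum_bounded_above)
  also have "\<dots> \<le> (\<epsilon> * card B) * b" using c b0 by (intro mult_right_mono)
  finally have 1: "\<bar>sum g (B - \<Union>?Q)\<bar> \<le> b * \<epsilon> * card B" by (simp add: mult_ac)
  have "\<bar>\<Sum>A\<in>?Q. sum g A - w A * card A\<bar> \<le> (\<Sum>A\<in>?Q. \<bar>sum g A - w A * card A\<bar>)" by (rule sum_abs)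
  also have "\<dots> \<le> (\<Sum>A\<in>?Q. \<kappa> * card A)" using w by (intro sum_mono) auto
  also have "\<dots> = \<kappa> * (\<Sum>A\<in>?Q. real (card A))" by (simp add: sum_distrib_left)
  also have "\<dots> \<le> \<kappa> * card B" unfolding Q(3) using \<kappa> by (intro mult_left_mono) auto
  finally show ?thesis using 1 unfolding eq by (simp add: algebra_simps)
qed

lemma sum_subset_close:
  fixes g :: "'a \<Rightarrow> real" and b :: real
  assumes "finite B" "A \<subseteq> B" "\<And>s. \<bar>g s\<bar> \<le> b"
  shows "\<bar>sum g B - sum g A\<bar> \<le> b * card (B - A)"
proof -
  have "sum g B - sum g A = sum g (B - A)" using sum.subset_diff[OF assms(2,1), of g] by simp
  moreover have "\<bar>sum g (B - A)\<bar> \<le> (\<Sum>s\<in>B - A. \<bar>g s\<bar>)" by (rule sum_abs)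
  moreover have "\<dots> \<le> real (card (B - A)) * b" using assms(3) by (intro sum_bounded_above)
  ultimately have "\<bar>sum g B - sum g A\<bar> \<le> real (card (B - A)) * b" by linarith
  then show ?thesis by (simp add: mult.commute)
qed

lemma sum_pointwise_close:
  fixes g h :: "'a \<Rightarrow> real" and \<kappa> :: real
  assumes "\<And>s. s \<in> A \<Longrightarrow> \<bar>g s - h s\<bar> \<le> \<kappa>"
  shows "\<bar>sum g A - sum h A\<bar> \<le> \<kappa> * card A"
proof -
  have "\<bar>sum g A - sum h A\<bar> \<le> (\<Sum>s\<in>A. \<bar>g s - h s\<bar>)" unfolding sum_subtractf[symmetric] by (rule sum_abs)
  also have "\<dots> \<le> real (card A) * \<kappa>" using assms by (intro sum_bounded_above)
  finally show ?thesis by (simp add: mult.commute)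
qed

section \<open>Shadowing of infinitely many separated pieces\<close>

context dynamical_system
begin

text \<open>Specification at one precision, with its gap set exposed: \<open>P\<close> has to be
  known before the tiling whose pieces it separates.\<close>

definition spec_gap :: "real \<Rightarrow> 'g set \<Rightarrow> bool" where
  "spec_gap \<epsilon> P \<longleftrightarrow> finite P \<and> P \<subseteq> carrier G \<and>
     (\<forall>(m::nat) (E :: nat \<Rightarrow> 'g set) (x :: nat \<Rightarrow> 'x).
           (\<forall>i\<in>{1..m}. finite (E i) \<and> E i \<subseteq> carrier G) \<and>
           (\<forall>i\<in>{1..m}. \<forall>j\<in>{1..m}. i \<noteq> j \<longrightarrow> (P <#> E i) \<inter> E j = {}) \<longrightarrow>
           (\<exists>y. \<forall>i\<in>{1..m}. \<forall>s\<in>E i. dist (\<alpha> s (x i)) (\<alpha> s y) \<le> \<epsilon>))"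

lemma spec_gap_exists: "specification_property G \<alpha> \<Longrightarrow> \<epsilon> > 0 \<Longrightarrow> \<exists>P. spec_gap \<epsilon> P"
  unfolding specification_property_def spec_gap_def
  by (drule spec[of _ \<epsilon>], drule mp, assumption, erule exE, rule exI, erule conjunct2)

lemma spec_gap_finite_family:
  assumes P: "spec_gap \<epsilon> P" and fin: "finite \<A>"
    and A: "\<And>A. A \<in> \<A> \<Longrightarrow> finite A \<and> A \<subseteq> carrier G"
    and gap: "\<And>A B p a. A \<in> \<A> \<Longrightarrow> B \<in> \<A> \<Longrightarrow> A \<noteq> B \<Longrightarrow> p \<in> P \<Longrightarrow> a \<in> A \<Longrightarrow> p \<otimes> a \<notin> B"
  shows "\<exists>y. \<forall>A\<in>\<A>. \<forall>s\<in>A. dist (\<alpha> s (x A)) (\<alpha> s y) \<le> \<epsilon>"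
proof -
  obtain e where e: "bij_betw e {1..card \<A>} \<A>" using ex_bij_betw_nat_finite_1[OF fin] by blast
  have mem: "e i \<in> \<A>" if "i \<in> {1..card \<A>}" for i using e that by (rule bij_betwE[rule_format])
  have "\<forall>i\<in>{1..card \<A>}. finite (e i) \<and> e i \<subseteq> carrier G" using A mem by blast
  moreover have "\<forall>i\<in>{1..card \<A>}. \<forall>j\<in>{1..card \<A>}. i \<noteq> j \<longrightarrow> (P <#> e i) \<inter> e j = {}"
  proof (intro ballI impI)
    fix i j assume ij: "i \<in> {1..card \<A>}" "j \<in> {1..card \<A>}" "i \<noteq> j"
    then have "e i \<noteq> e j" using e unfolding bij_betw_def inj_on_def by blast
    then show "(P <#> e i) \<inter> e j = {}"
      using gap[OF mem[OF ij(1)] mem[OF ij(2)]] by (auto simp: set_mult_def)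
  qed
  ultimately obtain y where y: "\<forall>i\<in>{1..card \<A>}. \<forall>s\<in>e i. dist (\<alpha> s (x (e i))) (\<alpha> s y) \<le> \<epsilon>"
    using P[unfolded spec_gap_def, THEN conjunct2, THEN conjunct2, rule_format, of "card \<A>" e "\<lambda>i. x (e i)"] by blast
  have "\<forall>s\<in>A. dist (\<alpha> s (x A)) (\<alpha> s y) \<le> \<epsilon>" if "A \<in> \<A>" for A
  proof -
    obtain i where "i \<in> {1..card \<A>}" "A = e i" using e \<open>A \<in> \<A>\<close> unfolding bij_betw_def by blast
    then show ?thesis using y by blast
  qed
  then show ?thesis by blast
qed

text \<open>The points that shadow the prescribed segment on one piece form a closed set.
  Specification gives the finite intersection property, and compactness extends it to infinitely
  many pieces at once.\<close>

lemma spec_gap_family: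
  assumes P: "spec_gap \<epsilon> P"
    and A: "\<And>A. A \<in> \<A> \<Longrightarrow> finite A \<and> A \<subseteq> carrier G"
    and gap: "\<And>A B p a. A \<in> \<A> \<Longrightarrow> B \<in> \<A> \<Longrightarrow> A \<noteq> B \<Longrightarrow> p \<in> P \<Longrightarrow> a \<in> A \<Longrightarrow> p \<otimes> a \<notin> B"
  shows "\<exists>y. \<forall>A\<in>\<A>. \<forall>s\<in>A. dist (\<alpha> s (x A)) (\<alpha> s y) \<le> \<epsilon>"
proof -
  let ?C = "\<lambda>A. {y. \<forall>s\<in>A. dist (\<alpha> s (x A)) (\<alpha> s y) \<le> \<epsilon>}"
  have "UNIV \<inter> (\<Inter>A\<in>\<A>. ?C A) \<noteq> {}"
  proof (rule compact_imp_fip_image[OF compact_space])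
    fix A assume "A \<in> \<A>"
    have "closed {y. dist (\<alpha> s (x A)) (\<alpha> s y) \<le> \<epsilon>}" if "s \<in> A" for s
      using A[OF \<open>A \<in> \<A>\<close>] that continuous_action[of s]
      by (intro closed_Collect_le continuous_intros) auto
    then have "closed (\<Inter>s\<in>A. {y. dist (\<alpha> s (x A)) (\<alpha> s y) \<le> \<epsilon>})" by blast
    moreover have "?C A = (\<Inter>s\<in>A. {y. dist (\<alpha> s (x A)) (\<alpha> s y) \<le> \<epsilon>})" by auto
    ultimately show "closed (?C A)" by simp
  next
    fix \<A>' assume \<A>': "finite \<A>'" "\<A>' \<subseteq> \<A>"
    have "\<exists>y. \<forall>A\<in>\<A>'. \<forall>s\<in>A. dist (\<alpha> s (x A)) (\<alpha> s y) \<le> \<epsilon>"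
    proof (rule spec_gap_finite_family[OF P \<A>'(1)])
      show "finite A \<and> A \<subseteq> carrier G" if "A \<in> \<A>'" for A using A that \<A>'(2) by blast
      show "p \<otimes> a \<notin> B" if "A \<in> \<A>'" "B \<in> \<A>'" "A \<noteq> B" "p \<in> P" "a \<in> A" for A B p a
        using gap[of A B p a] that \<A>'(2) by blast
    qed
    then obtain y where "\<forall>A\<in>\<A>'. \<forall>s\<in>A. dist (\<alpha> s (x A)) (\<alpha> s y) \<le> \<epsilon>" by blast
    then have "y \<in> UNIV \<inter> (\<Inter>A\<in>\<A>'. ?C A)" by simp
    then show "UNIV \<inter> (\<Inter>A\<in>\<A>'. ?C A) \<noteq> {}" by blast
  qed
  then obtain y where "y \<in> UNIV \<inter> (\<Inter>A\<in>\<A>. ?C A)" by blast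
  then show ?thesis by (intro exI[of _ y]) simp
qed

text \<open>Tile with those \<open>F n\<close> whose average at x0 is near a, and let one point z
  shadow a segment of x0 on every piece. On \<open>F n #> c\<close> the shadowed point is \<alpha>
  (inv c) x0, whose segment there is that of x0 over \<open>F n\<close>. Pieces nearly fill every
  sufficiently invariant set, so all its averages at z are near a, although those at x0 need not
  be.\<close>

lemma limit_point_everywhere:
  fixes \<phi> :: "'x \<Rightarrow> real" and \<kappa> a b :: real
  assumes F: "folner_seq G F" and spec: "specification_property G \<alpha>"
    and \<phi>: "continuous_on UNIV \<phi>" and bd: "\<And>x. \<bar>\<phi> x\<bar> \<le> b"
    and a: "\<And>e. e > 0 \<Longrightarrow> infinite {n. \<bar>(\<Sum>s\<in>F n. \<phi> (\<alpha> s x0)) / card (F n) - a\<bar> < e}"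
    and \<kappa>: "\<kappa> > 0"
  shows "\<exists>z. inv_eventually (\<lambda>B. \<bar>(\<Sum>s\<in>B. \<phi> (\<alpha> s z)) - a * card B\<bar> \<le> \<kappa> * card B)"
proof -
  have "uniformly_continuous_on UNIV \<phi>" using \<phi> compact_space by (rule compact_uniformly_continuous)
  moreover have "\<kappa> / 4 > 0" using \<kappa> by simp
  ultimately obtain r where r: "r > 0" "\<And>x y. dist x y < r \<Longrightarrow> \<bar>\<phi> x - \<phi> y\<bar> < \<kappa> / 4"
    unfolding uniformly_continuous_on_def dist_real_def by blast
  obtain P where P: "spec_gap (r / 2) P" using spec_gap_exists[OF spec, of "r / 2"] r by auto
  have Pc: "finite P" "P \<subseteq> carrier G" using P unfolding spec_gap_def by auto
  have b0: "b \<ge> 0" using bd[of undefined] by simp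
  \<comment> \<open>This gives (b + |a|) * \<epsilon> \<le> \<kappa>/8. A piece spends \<kappa>/4 on
    shadowing, \<kappa>/4 on the average over \<open>F n\<close> and 2 * (b + |a|) * \<epsilon> on
    trimming; the uncovered points add (b + |a|) * \<epsilon>.\<close>
  define \<epsilon> where "\<epsilon> = min (1/2) (\<kappa> / (8 * (b + \<bar>a\<bar> + 1)))"
  have "\<epsilon> \<le> 1/2" unfolding \<epsilon>_def by (rule min.cobounded1)
  moreover have "0 < \<epsilon>" unfolding \<epsilon>_def using \<kappa> b0 by auto
  ultimately have \<epsilon>: "0 < \<epsilon>" "\<epsilon> < 1" "\<epsilon> \<le> 1/2" by auto
  have "\<epsilon> \<le> \<kappa> / (8 * (b + \<bar>a\<bar> + 1))" unfolding \<epsilon>_def by (rule min.cobounded2)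
  then have "\<epsilon> * (8 * (b + \<bar>a\<bar> + 1)) \<le> \<kappa>" using b0 by (simp add: pos_le_divide_eq)
  then have \<epsilon>\<kappa>: "8 * ((b + \<bar>a\<bar>) * \<epsilon>) \<le> \<kappa>" using \<epsilon> by (simp add: algebra_simps)
  let ?I = "{n. \<bar>(\<Sum>s\<in>F n. \<phi> (\<alpha> s x0)) / card (F n) - a\<bar> < \<kappa> / 8}"
  have I: "infinite ?I" using a[of "\<kappa> / 8"] \<kappa> by simp
  obtain \<A> J K d where J: "finite J" "J \<subseteq> ?I"
    and A: "\<And>A. A \<in> \<A> \<Longrightarrow> \<exists>n\<in>J. \<exists>c\<in>carrier G. A \<subseteq> F n #> c \<and> (1 - \<epsilon>) * card (F n) \<le> card A"
    and gap: "\<And>A B p a. A \<in> \<A> \<Longrightarrow> B \<in> \<A> \<Longrightarrow> A \<noteq> B \<Longrightarrow> p \<in> P \<Longrightarrow> a \<in> A \<Longrightarrow> p \<otimes> a \<notin> B"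
    and dj: "disjoint \<A>" and K: "finite K" "K \<subseteq> carrier G" "d > 0"
    and cov: "\<And>B. almost_inv K d B \<Longrightarrow> card (B - \<Union>{A\<in>\<A>. A \<subseteq> B}) \<le> \<epsilon> * card B"
    by (rule quasi_tiling[OF F I \<epsilon>(1,2) Pc]) (rule that; assumption)
  note Fm = folner_seqD[OF F]
  have "\<exists>n c. n \<in> J \<and> c \<in> carrier G \<and> A \<subseteq> F n #> c \<and> (1 - \<epsilon>) * card (F n) \<le> card A" if "A \<in> \<A>" for A
    using A[OF that] by blast
  then obtain sh ce where sc: "\<And>A. A \<in> \<A> \<Longrightarrow> sh A \<in> J \<and> ce A \<in> carrier G \<and> A \<subseteq> F (sh A) #> ce A \<and> (1 - \<epsilon>) * card (F (sh A)) \<le> card A"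
    by metis
  have Afin: "finite A \<and> A \<subseteq> carrier G" if "A \<in> \<A>" for A
  proof -
    have "finite (F (sh A) #> ce A)" "F (sh A) #> ce A \<subseteq> carrier G" "A \<subseteq> F (sh A) #> ce A"
      using sc[OF that] Fm by (simp_all add: finite_r_coset r_coset_subset_G)
    then show ?thesis using finite_subset by blast
  qed
  have "\<exists>z. \<forall>A\<in>\<A>. \<forall>s\<in>A. dist (\<alpha> s (\<alpha> (inv (ce A)) x0)) (\<alpha> s z) \<le> r / 2"
  proof (rule spec_gap_family[OF P Afin])
    show "p \<otimes> a \<notin> B" if "A \<in> \<A>" "B \<in> \<A>" "A \<noteq> B" "p \<in> P" "a \<in> A" for A B p a
      by (rule gap[OF that])
  qed
  then obtain z where z: "\<forall>A\<in>\<A>. \<forall>s\<in>A. dist (\<alpha> s (\<alpha> (inv (ce A)) x0)) (\<alpha> s z) \<le> r / 2"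
    by (rule exE)
  have piece: "\<bar>(\<Sum>s\<in>A. \<phi> (\<alpha> s z)) - a * card A\<bar> \<le> (3 * \<kappa> / 4) * card A" if AA: "A \<in> \<A>" for A
  proof -
    let ?n = "sh A" and ?c = "ce A"
    let ?x = "\<alpha> (inv ?c) x0"
    have n: "?n \<in> J" "?c \<in> carrier G" "A \<subseteq> F ?n #> ?c" "(1 - \<epsilon>) * card (F ?n) \<le> card A"
      using sc[OF AA] by auto
    have fF: "finite (F ?n #> ?c)" using Fm by (simp add: finite_r_coset)
    have "(1/2) * real (card (F ?n)) \<le> (1 - \<epsilon>) * card (F ?n)" using \<epsilon> by (intro mult_right_mono) auto
    then have half: "card (F ?n) \<le> 2 * real (card A)" using n(4) by simp
    have "\<epsilon> * card (F ?n) \<le> \<epsilon> * (2 * real (card A))" using half \<epsilon> by (intro mult_left_mono) auto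
    moreover have "card (F ?n) - real (card A) \<le> \<epsilon> * card (F ?n)" using n(4) by (simp add: algebra_simps)
    ultimately have diff: "card (F ?n) - real (card A) \<le> 2 * \<epsilon> * card A" by simp
    have cF: "card (F ?n #> ?c) = card (F ?n)" using Fm n by (simp add: card_r_coset)
    have "card A \<le> card (F ?n #> ?c)" using n(3) fF by (rule card_mono[rotated])
    then have diff0: "card (F ?n) \<ge> real (card A)" using cF by simp
    have "card ((F ?n #> ?c) - A) = card (F ?n) - card A"
      using n(3) cF fF by (simp add: card_Diff_subset finite_subset)
    then have cd: "real (card ((F ?n #> ?c) - A)) = card (F ?n) - real (card A)" using diff0 by simp
    have 1: "\<bar>(\<Sum>s\<in>A. \<phi> (\<alpha> s z)) - (\<Sum>s\<in>A. \<phi> (\<alpha> s ?x))\<bar> \<le> \<kappa> / 4 * card A"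
    proof (rule sum_pointwise_close)
      fix s assume "s \<in> A"
      then have "dist (\<alpha> s ?x) (\<alpha> s z) \<le> r / 2" using z AA by blast
      then have "\<bar>\<phi> (\<alpha> s ?x) - \<phi> (\<alpha> s z)\<bar> < \<kappa> / 4" using r(1) by (intro r(2)) linarith
      then show "\<bar>\<phi> (\<alpha> s z) - \<phi> (\<alpha> s ?x)\<bar> \<le> \<kappa> / 4" by linarith
    qed
    have "\<bar>(\<Sum>s\<in>F ?n #> ?c. \<phi> (\<alpha> s ?x)) - (\<Sum>s\<in>A. \<phi> (\<alpha> s ?x))\<bar> \<le> b * card ((F ?n #> ?c) - A)"
      using fF n(3) bd by (intro sum_subset_close)
    also have "\<dots> \<le> b * (2 * \<epsilon> * card A)" unfolding cd using diff b0 by (intro mult_left_mono)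
    finally have 2: "\<bar>(\<Sum>s\<in>F ?n #> ?c. \<phi> (\<alpha> s ?x)) - (\<Sum>s\<in>A. \<phi> (\<alpha> s ?x))\<bar> \<le> 2 * (b * \<epsilon>) * card A"
      by (simp add: mult_ac)
    have "F ?n #> ?c = (\<lambda>t. t \<otimes> ?c) ` F ?n" by (auto simp: r_coset_def)
    then have "(\<Sum>s\<in>F ?n #> ?c. \<phi> (\<alpha> s ?x)) = (\<Sum>t\<in>F ?n. \<phi> (\<alpha> (t \<otimes> ?c) ?x))"
      using inj_on_right_mult[OF n(2) Fm(3)] by (simp add: sum.reindex)
    also have "\<dots> = (\<Sum>t\<in>F ?n. \<phi> (\<alpha> t x0))"
    proof (rule sum.cong[OF refl])
      fix t assume "t \<in> F ?n"
      then have t: "t \<in> carrier G" using Fm by blast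
      have "\<alpha> ?c ?x = x0" using action_inv[of "inv ?c" x0] n(2) by simp
      then show "\<phi> (\<alpha> (t \<otimes> ?c) ?x) = \<phi> (\<alpha> t x0)" using action_mult[OF t n(2)] by simp
    qed
    finally have 3: "(\<Sum>s\<in>F ?n #> ?c. \<phi> (\<alpha> s ?x)) = (\<Sum>t\<in>F ?n. \<phi> (\<alpha> t x0))" .
    have "\<bar>(\<Sum>t\<in>F ?n. \<phi> (\<alpha> t x0)) / card (F ?n) - a\<bar> < \<kappa> / 8" using n(1) J by blast
    then have "\<bar>(\<Sum>t\<in>F ?n. \<phi> (\<alpha> t x0)) / card (F ?n) - a\<bar> * card (F ?n) \<le> \<kappa> / 8 * card (F ?n)"
      by (intro mult_right_mono) auto
    moreover have "\<bar>(\<Sum>t\<in>F ?n. \<phi> (\<alpha> t x0)) / card (F ?n) - a\<bar> * card (F ?n) = \<bar>((\<Sum>t\<in>F ?n. \<phi> (\<alpha> t x0)) / card (F ?n) - a) * card (F ?n)\<bar>"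
      by (simp add: abs_mult)
    moreover have "((\<Sum>t\<in>F ?n. \<phi> (\<alpha> t x0)) / card (F ?n) - a) * card (F ?n) = (\<Sum>t\<in>F ?n. \<phi> (\<alpha> t x0)) - a * card (F ?n)"
      using Fm(4)[of ?n] by (simp add: field_simps)
    moreover have "\<kappa> / 8 * card (F ?n) \<le> \<kappa> / 8 * (2 * card A)" using half \<kappa> by (intro mult_left_mono) auto
    ultimately have 4: "\<bar>(\<Sum>t\<in>F ?n. \<phi> (\<alpha> t x0)) - a * card (F ?n)\<bar> \<le> \<kappa> / 4 * card A" by linarith
    have "\<bar>a * card (F ?n) - a * card A\<bar> = \<bar>a\<bar> * (card (F ?n) - real (card A))"
      using diff0 by (simp add: abs_mult right_diff_distrib[symmetric])
    also have "\<dots> \<le> \<bar>a\<bar> * (2 * \<epsilon> * card A)" using diff by (intro mult_left_mono) auto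
    finally have 5: "\<bar>a * card (F ?n) - a * card A\<bar> \<le> 2 * (\<bar>a\<bar> * \<epsilon>) * card A" by (simp add: mult_ac)
    have "\<bar>(\<Sum>s\<in>A. \<phi> (\<alpha> s z)) - a * card A\<bar> \<le> (\<kappa> / 4 + 2 * (b * \<epsilon>) + \<kappa> / 4 + 2 * (\<bar>a\<bar> * \<epsilon>)) * card A"
      using 1 2 4 5 unfolding 3 distrib_right by linarith
    also have "\<dots> \<le> (3 * \<kappa> / 4) * card A" using \<epsilon>\<kappa> by (intro mult_right_mono) (simp_all add: algebra_simps)
    finally show ?thesis .
  qed
  have "\<bar>(\<Sum>s\<in>B. \<phi> (\<alpha> s z)) - a * card B\<bar> \<le> \<kappa> * card B" if inv: "almost_inv K d B" for B
  proof -
    note B = almost_invD[OF inv]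
    let ?Q = "{A\<in>\<A>. A \<subseteq> B}"
    have "\<bar>(\<Sum>s\<in>B. \<phi> (\<alpha> s z)) - (\<Sum>A\<in>?Q. a * card A)\<bar> \<le> (3 * \<kappa> / 4 + b * \<epsilon>) * card B"
      by (rule sum_over_pieces[where w = "\<lambda>_. a", OF dj B(1) cov[OF inv] piece bd]) (use \<kappa> in auto)
    moreover have "(\<Sum>A\<in>?Q. a * card A) = a * (real (card B) - card (B - \<Union>?Q))"
      unfolding sum_distrib_left[symmetric] disjoint_subsets_card(3)[OF dj B(1)] ..
    moreover have "\<bar>a * card (B - \<Union>?Q)\<bar> \<le> \<bar>a\<bar> * (\<epsilon> * card B)"
      unfolding abs_mult using cov[OF inv] by (intro mult_mono) auto
    ultimately have "\<bar>(\<Sum>s\<in>B. \<phi> (\<alpha> s z)) - a * card B\<bar> \<le> (3 * \<kappa> / 4 + b * \<epsilon>) * card B + \<bar>a\<bar> * (\<epsilon> * card B)"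
      unfolding right_diff_distrib by linarith
    also have "\<dots> = (3 * \<kappa> / 4 + (b + \<bar>a\<bar>) * \<epsilon>) * card B" by (simp add: algebra_simps)
    also have "\<dots> \<le> \<kappa> * card B" using \<epsilon>\<kappa> \<kappa> by (intro mult_right_mono) auto
    finally show ?thesis .
  qed
  then have "inv_eventually (\<lambda>B. \<bar>(\<Sum>s\<in>B. \<phi> (\<alpha> s z)) - a * card B\<bar> \<le> \<kappa> * card B)"
    by (rule inv_eventuallyI[OF K])
  then show ?thesis by (rule exI)
qed

text \<open>Collect whole tiles inside A until their total size reaches \<theta> * card A. A
  disjoint union of almost invariant tiles is almost invariant, and the overshoot is at most the
  bound R on the size of a tile.\<close>

lemma exists_invariant_portion:
  fixes \<theta> d1 :: real
  assumes F: "folner_seq G F" and K1: "finite K1" "K1 \<subseteq> carrier G" "d1 > 0" and \<theta>: "0 < \<theta>" "\<theta> \<le> 1/2"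
  shows "inv_eventually (\<lambda>A. \<exists>Q\<subseteq>A. almost_inv K1 d1 Q \<and> \<theta> * card A \<le> card Q \<and> card Q \<le> 2 * \<theta> * card A)"
proof -
  \<comment> \<open>\<epsilon> \<le> 1/2 makes the tiles fill at least half of A, hence at least
    \<theta> of it; the other bound lets tiles trimmed from (K1, d1/4)-invariant shapes remain (K1,
    d1)-invariant.\<close>
  define \<epsilon> where "\<epsilon> = min (1/2) (d1 / (4 * (card K1 + 1)))"
  have "\<epsilon> \<le> 1/2" unfolding \<epsilon>_def by (rule min.cobounded1)
  moreover have "0 < \<epsilon>" unfolding \<epsilon>_def using K1 by auto
  ultimately have \<epsilon>: "0 < \<epsilon>" "\<epsilon> < 1" "\<epsilon> \<le> 1/2" by auto
  have "\<epsilon> \<le> d1 / (4 * (card K1 + 1))" unfolding \<epsilon>_def by (rule min.cobounded2)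
  then have "\<epsilon> * (4 * (real (card K1) + 1)) \<le> d1" by (subst (asm) pos_le_divide_eq) (auto simp: algebra_simps)
  then have "card K1 * \<epsilon> \<le> d1 / 4" using \<epsilon> by (simp add: algebra_simps)
  moreover have "d1 * (1/2) \<le> d1 * (1 - \<epsilon>)" using \<epsilon> K1 by (intro mult_left_mono) auto
  ultimately have \<epsilon>d: "d1 / 4 + card K1 * \<epsilon> \<le> d1 * (1 - \<epsilon>)" by linarith
  have "eventually (\<lambda>n. almost_inv K1 (d1 / 4) (F n)) sequentially"
    using folner_eventually_almost_inv[OF F K1(1,2)] K1 by simp
  then obtain N where N: "\<And>n. n \<ge> N \<Longrightarrow> almost_inv K1 (d1 / 4) (F n)"
    unfolding eventually_sequentially by blast
  obtain \<A> J K d where J: "finite J" "J \<subseteq> {N..}"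
    and A: "\<And>A. A \<in> \<A> \<Longrightarrow> \<exists>n\<in>J. \<exists>c\<in>carrier G. A \<subseteq> F n #> c \<and> (1 - \<epsilon>) * card (F n) \<le> card A"
    and dj: "disjoint \<A>" and K: "finite K" "K \<subseteq> carrier G" "d > 0"
    and cov: "\<And>B. almost_inv K d B \<Longrightarrow> card (B - \<Union>{A\<in>\<A>. A \<subseteq> B}) \<le> \<epsilon> * card B"
    by (rule quasi_tiling[OF F infinite_Ici \<epsilon>(1,2), of "{}" N]) auto
  note Fm = folner_seqD[OF F]
  define R where "R = real (\<Sum>n\<in>J. card (F n))"
  have R0: "R \<ge> 0" unfolding R_def by (rule of_nat_0_le_iff)
  have tile: "almost_inv K1 d1 A \<and> card A \<le> R" if AA: "A \<in> \<A>" for A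
  proof -
    obtain n c where n: "n \<in> J" "c \<in> carrier G" "A \<subseteq> F n #> c" "(1 - \<epsilon>) * card (F n) \<le> card A"
      using A[OF AA] by blast
    have cF: "card (F n #> c) = card (F n)" using Fm n by (simp add: card_r_coset)
    have "almost_inv K1 (d1 / 4) (F n #> c)" using N J n K1 by (intro almost_inv_r_coset) auto
    then have "almost_inv K1 d1 A"
      by (rule almost_inv_subset[OF _ K1(1,2) n(3) _ \<epsilon>(2) \<epsilon>d]) (use n cF K1 in auto)
    moreover have "card A \<le> card (F n)"
      using card_mono[OF _ n(3)] Fm cF by (simp add: finite_r_coset)
    moreover have "card (F n) \<le> (\<Sum>n\<in>J. card (F n))" using J n by (intro member_le_sum) auto
    ultimately show ?thesis unfolding R_def by linarith
  qed
  \<comment> \<open>Invariance under \<open>K2\<close> forces card A \<ge> R / \<theta>, so the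
    overshoot R is at most \<theta> * card A.\<close>
  obtain K2 where K2: "finite K2" "card K2 = nat \<lceil>R / \<theta>\<rceil>" "K2 \<subseteq> carrier G"
    using infinite_arbitrarily_large[OF infinite_group] by blast
  have "\<exists>Q\<subseteq>A. almost_inv K1 d1 Q \<and> \<theta> * card A \<le> card Q \<and> card Q \<le> 2 * \<theta> * card A"
    if inv: "almost_inv (K \<union> K2) (min d (1/2)) A" for A
  proof -
    note A' = almost_invD[OF inv]
    have "almost_inv K2 (1/2) A" by (rule almost_inv_mono[OF inv]) auto
    then have "card K2 \<le> card A" using K2 by (intro almost_inv_card_ge) auto
    then have "R / \<theta> \<le> card A" using K2(2) by linarith
    then have R: "R \<le> \<theta> * card A" using \<theta> by (simp add: divide_le_eq mult.commute)
    let ?S = "{B\<in>\<A>. B \<subseteq> A}"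
    note S = disjoint_subsets_card[OF dj A'(1)]
    have "almost_inv K d A" by (rule almost_inv_mono[OF inv]) auto
    then have "card (A - \<Union>?S) \<le> \<epsilon> * card A" by (rule cov)
    moreover have "\<epsilon> * card A \<le> (1/2) * card A" "\<theta> * card A \<le> (1/2) * card A"
      using \<epsilon> \<theta> by (intro mult_right_mono; simp)+
    ultimately have big: "\<theta> * card A \<le> (\<Sum>B\<in>?S. real (card B))" unfolding S(3) by linarith
    have t0: "0 < \<theta> * card A" using \<theta> A'(4) by simp
    obtain S' where S': "S' \<subseteq> ?S" "\<theta> * card A \<le> (\<Sum>B\<in>S'. real (card B))" "(\<Sum>B\<in>S'. real (card B)) \<le> \<theta> * card A + R"
      using exists_subfamily_sum[OF S(1) _ big, of R] tile t0 R0 by auto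
    have finS': "finite S'" using S'(1) S(1) finite_subset by blast
    have S'A: "B \<in> \<A>" "B \<subseteq> A" if "B \<in> S'" for B using S'(1) that by auto
    have dj': "disjoint S'" using dj S'A(1) unfolding disjoint_def by auto
    have "card (\<Union>S') = (\<Sum>B\<in>S'. card B)"
    proof (rule card_Union_disjoint[OF dj'])
      show "finite B" if "B \<in> S'" for B using S'A(2)[OF that] A'(1) by (rule finite_subset)
    qed
    then have cQ: "real (card (\<Union>S')) = (\<Sum>B\<in>S'. real (card B))" by simp
    have "S' \<noteq> {}" using S'(2) t0 by auto
    have "almost_inv K1 d1 (\<Union>S')"
    proof (rule almost_inv_Union[OF finS' \<open>S' \<noteq> {}\<close> _ dj'])
      show "almost_inv K1 d1 B" if "B \<in> S'" for B using tile[OF S'A(1)[OF that]] by simp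
    qed
    moreover have "\<Union>S' \<subseteq> A" using S'A by blast
    ultimately show ?thesis using cQ S' R by (intro exI[of _ "\<Union>S'"]) auto
  qed
  then show ?thesis
    by (rule inv_eventuallyI[of "K \<union> K2" "min d (1/2)", rotated 3]) (use K K2 in simp_all)
qed

section \<open>Two families of orbit segments on one piece\<close>

lemma inv_eventually_card_ge: "inv_eventually (\<lambda>A. k \<le> card A)"
proof -
  obtain K where K: "finite K" "card K = k" "K \<subseteq> carrier G"
    using infinite_arbitrarily_large[OF infinite_group] by blast
  show ?thesis
  proof (rule inv_eventuallyI[OF K(1,3), of "1/2"])
    show "k \<le> card A" if "almost_inv K (1/2) A" for A
      using almost_inv_card_ge[OF that] K by simp
  qed simp
qed

text \<open>t selects one of two families, and u t is the average of \<phi> over A common to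
  \<open>\<Gamma> t\<close>, up to \<kappa>. Both families obey the same size and separation bounds,
  so mass estimates do not depend on which one is chosen on which piece.\<close>

definition two_sided_family ::
  "('x \<Rightarrow> real) \<Rightarrow> real \<Rightarrow> real \<Rightarrow> real \<Rightarrow> real \<Rightarrow> 'g set \<Rightarrow> (bool \<Rightarrow> 'x set) \<Rightarrow> (bool \<Rightarrow> real) \<Rightarrow> bool" where
  "two_sided_family \<phi> \<kappa> \<gamma> l N A \<Gamma> u \<longleftrightarrow> u False + \<gamma> \<le> u True \<and>
     (\<forall>t. finite (\<Gamma> t) \<and> \<Gamma> t \<noteq> {} \<and> exp N \<le> card (\<Gamma> t) \<and>
       (\<forall>x\<in>\<Gamma> t. \<forall>y\<in>\<Gamma> t. x \<noteq> y \<longrightarrow> (\<exists>s\<in>A. l \<le> dist (\<alpha> s x) (\<alpha> s y))) \<and>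
       (\<forall>y\<in>\<Gamma> t. \<bar>(\<Sum>s\<in>A. \<phi> (\<alpha> s y)) - u t * card A\<bar> \<le> \<kappa> * card A))"

text \<open>On a portion Q of proportion about \<theta> the segment follows z True or z False; on
  the rest Ro it follows a separated set whose sums of \<phi> lie in one short interval. Both
  families use the same set on Ro, so their averages differ only through Q, by at least \<theta> *
  g. Entropy is lost on A - Ro, at most 3 * \<theta> * M per element, and by the pigeonhole step, at
  most \<kappa>.\<close>

lemma two_averages:
  fixes \<phi> :: "'x \<Rightarrow> real" and \<kappa> b \<theta> g r l :: real
  assumes F: "folner_seq G F" and P: "spec_gap r P"
    and modulus: "\<And>x y. dist x y \<le> r \<Longrightarrow> \<bar>\<phi> x - \<phi> y\<bar> \<le> \<kappa>"
    and bd: "\<And>x. \<bar>\<phi> x\<bar> \<le> b" and \<kappa>: "\<kappa> > 0"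
    and z: "inv_eventually (\<lambda>Q. g * card Q \<le> (\<Sum>s\<in>Q. \<phi> (\<alpha> s (z True))) - (\<Sum>s\<in>Q. \<phi> (\<alpha> s (z False))))"
    and g: "g \<ge> 0" and \<theta>: "0 < \<theta>" "\<theta> \<le> 1/2" and U: "open_cover U"
    and sep: "\<And>A. finite A \<Longrightarrow> A \<subseteq> carrier G \<Longrightarrow>
      \<exists>\<Gamma>. finite \<Gamma> \<and> exp (cover_entropy U A) \<le> card \<Gamma> \<and> (\<forall>x\<in>\<Gamma>. \<forall>y\<in>\<Gamma>. x \<noteq> y \<longrightarrow> (\<exists>s\<in>A. l \<le> dist (\<alpha> s x) (\<alpha> s y)))"
    and l: "2 * r < l"
  shows "inv_eventually (\<lambda>A. \<exists>\<Gamma> u. two_sided_family \<phi> (4 * \<kappa>) (\<theta> * g) (l - 2 * r)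
    (cover_entropy U A - (3 * \<theta> * cover_entropy U {\<one>} + \<kappa>) * card A) A \<Gamma> u)"
proof -
  interpret f: subadditive_set_function G "cover_entropy U" by (rule subadditive_cover_entropy[OF U])
  define M where "M = cover_entropy U {\<one>}"
  have M0: "M \<ge> 0" unfolding M_def by (rule f.f_nonneg) auto
  have b0: "b \<ge> 0" using bd[of undefined] by simp
  have Pc: "finite P" "P \<subseteq> carrier G" using P unfolding spec_gap_def by auto
  obtain K1 d1 where K1: "finite K1" "K1 \<subseteq> carrier G" "d1 > 0"
    "\<And>Q. almost_inv K1 d1 Q \<Longrightarrow> g * card Q \<le> (\<Sum>s\<in>Q. \<phi> (\<alpha> s (z True))) - (\<Sum>s\<in>Q. \<phi> (\<alpha> s (z False)))"
    using z by (rule inv_eventuallyE) (rule that; assumption)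
  \<comment> \<open>Bounds the proportion of points given up to gaps: b * \<kappa>' \<le> \<kappa>
    makes them negligible in the sums, and \<kappa>' \<le> \<theta> keeps A - Ro below 3 * \<theta>
    * card A.\<close>
  define \<kappa>' where "\<kappa>' = min \<theta> (\<kappa> / (b + 1))"
  have \<kappa>'0: "\<kappa>' > 0" unfolding \<kappa>'_def using \<theta> \<kappa> b0 by simp
  have \<kappa>'\<theta>: "\<kappa>' \<le> \<theta>" unfolding \<kappa>'_def by simp
  have "\<kappa>' \<le> \<kappa> / (b + 1)" unfolding \<kappa>'_def by simp
  then have "\<kappa>' * (b + 1) \<le> \<kappa>" using b0 by (simp add: pos_le_divide_eq)
  then have b\<kappa>': "b * \<kappa>' \<le> \<kappa>" using \<kappa>'0 by (simp add: algebra_simps)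
  \<comment> \<open>Eroding Q costs d2 and clearing a strip around Q costs card P * d2, together
    \<kappa>'.\<close>
  define d2 where "d2 = \<kappa>' / (1 + real (card P))"
  have d2: "d2 > 0" unfolding d2_def using \<kappa>'0 by simp
  have "d2 * (1 + real (card P)) = \<kappa>'" unfolding d2_def by simp
  then have d2\<kappa>: "d2 + card P * d2 = \<kappa>'" by (simp add: algebra_simps)
  \<comment> \<open>The classes are floors of numbers of modulus at most b / \<kappa>, so they lie
    between -m and m; their number does not depend on A.\<close>
  define m where "m = \<lceil>b / \<kappa>\<rceil> + 1"
  define Nc where "Nc = card {-m..m}"
  have "0 \<le> b / \<kappa>" using b0 \<kappa> by simp
  then have m0: "m \<ge> 0" unfolding m_def by linarith
  then have Nc0: "Nc > 0" unfolding Nc_def by simp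
  \<comment> \<open>Once card A \<ge> k, there are at most exp (\<kappa> * card A) classes, so
    keeping only one costs \<kappa> per element.\<close>
  define k where "k = nat \<lceil>ln (real Nc) / \<kappa>\<rceil>"
  have k: "ln (real Nc) \<le> \<kappa> * k"
  proof -
    have "ln (real Nc) / \<kappa> \<le> k" unfolding k_def by linarith
    then show ?thesis using \<kappa> by (simp add: divide_le_eq mult.commute)
  qed
  have portion: "inv_eventually (\<lambda>A. \<exists>Q\<subseteq>A. almost_inv (K1 \<union> P) (min d1 d2) Q \<and> \<theta> * card A \<le> card Q \<and> card Q \<le> 2 * \<theta> * card A)"
    using K1 Pc d2 by (intro exists_invariant_portion[OF F _ _ _ \<theta>]) auto
  show ?thesis
  proof (rule inv_eventually_mono[OF inv_eventually_conj[OF portion inv_eventually_card_ge[of k]]], elim conjE)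
    fix A assume A: "finite A" "A \<noteq> {}" "A \<subseteq> carrier G" and kA: "k \<le> card A"
      and "\<exists>Q\<subseteq>A. almost_inv (K1 \<union> P) (min d1 d2) Q \<and> \<theta> * card A \<le> card Q \<and> card Q \<le> 2 * \<theta> * card A"
    then obtain Q where Q: "Q \<subseteq> A" "almost_inv (K1 \<union> P) (min d1 d2) Q" "\<theta> * card A \<le> card Q" "card Q \<le> 2 * \<theta> * card A"
      by blast
    have cA: "real (card A) > 0" using A by (simp add: card_gt_0_iff)
    have QK: "almost_inv K1 d1 Q" by (rule almost_inv_mono[OF Q(2)]) auto
    have QP: "almost_inv P d2 Q" by (rule almost_inv_mono[OF Q(2)]) auto
    note QP' = almost_invD[OF QP]
    have cQA: "card Q \<le> card A" using Q(1) A(1) by (rule card_mono[rotated])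
    \<comment> \<open>Specification needs the gap in both directions: \<open>P\<close> moves Qo only
      within Q, which Ro avoids, and points that \<open>P\<close> moves into Qo are dropped from
      Ro.\<close>
    define Qo where "Qo = {q\<in>Q. \<forall>p\<in>P. p \<otimes> q \<in> Q}"
    define Ro where "Ro = {a\<in>A - Q. \<forall>p\<in>P. p \<otimes> a \<notin> Qo}"
    have QoQ: "Qo \<subseteq> Q" unfolding Qo_def by blast
    have RoA: "Ro \<subseteq> A - Q" unfolding Ro_def by blast
    have finQo: "finite Qo" "Qo \<subseteq> carrier G" using QoQ QP' finite_subset by auto
    have finRo: "finite Ro" "Ro \<subseteq> carrier G" using RoA A finite_subset[of Ro A] by auto
    have "Q - Qo = {a\<in>Q. \<exists>p\<in>P. p \<otimes> a \<notin> Q}" unfolding Qo_def by blast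
    then have lossQ: "card (Q - Qo) \<le> d2 * card Q" using QP'(5) by simp
    have lossQA: "card (Q - Qo) \<le> d2 * card A"
    proof -
      have "d2 * card Q \<le> d2 * card A" using cQA d2 by (intro mult_left_mono) auto
      then show ?thesis using lossQ by linarith
    qed
    have "A - Q - Ro \<subseteq> {a\<in>carrier G. a \<notin> Q \<and> (\<exists>p\<in>P. p \<otimes> a \<in> Q)}"
      using A(3) QoQ unfolding Ro_def by blast
    then have "card (A - Q - Ro) \<le> card {a\<in>carrier G. a \<notin> Q \<and> (\<exists>p\<in>P. p \<otimes> a \<in> Q)}"
      using card_outer_boundary(2)[OF QP Pc] by (rule card_mono[rotated])
    also have "real \<dots> \<le> card P * (d2 * card Q)" by (rule card_outer_boundary(1)[OF QP Pc])
    also have "\<dots> \<le> card P * (d2 * card A)" using cQA d2 by (intro mult_left_mono) auto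
    finally have lossR: "card (A - Q - Ro) \<le> card P * d2 * card A" by simp
    have "d2 * card A + card P * d2 * card A = \<kappa>' * card A" unfolding d2\<kappa>[symmetric] by (simp add: algebra_simps)
    then have loss: "card (Q - Qo) + card (A - Q - Ro) \<le> \<kappa>' * card A" using lossQA lossR by simp
    have "A - Ro = Q \<union> (A - Q - Ro)" using Q(1) RoA by blast
    then have "card (A - Ro) \<le> card Q + card (A - Q - Ro)" by (metis card_Un_le)
    then have "real (card (A - Ro)) \<le> real (card Q) + real (card (A - Q - Ro))" by linarith
    also have "\<dots> \<le> 2 * \<theta> * card A + \<kappa>' * card A" using Q(4) loss by linarith
    also have "\<dots> \<le> 3 * \<theta> * card A" using mult_right_mono[OF \<kappa>'\<theta>, of "real (card A)"] by linarith
    finally have cAR: "card (A - Ro) \<le> 3 * \<theta> * card A" .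
    have "cover_entropy U A \<le> cover_entropy U Ro + cover_entropy U (A - Ro)"
    proof -
      have "Ro \<union> (A - Ro) = A" using RoA by blast
      then show ?thesis using f.f_Un[of Ro "A - Ro"] finRo A by auto
    qed
    also have "cover_entropy U (A - Ro) \<le> M * card (A - Ro)"
      unfolding M_def using A by (intro f.f_le_card) auto
    also have "\<dots> \<le> M * (3 * \<theta> * card A)" using cAR M0 by (intro mult_left_mono)
    finally have fR: "cover_entropy U A - 3 * \<theta> * M * card A \<le> cover_entropy U Ro" by (simp add: mult_ac)
    obtain \<Gamma>r where \<Gamma>r: "finite \<Gamma>r" "exp (cover_entropy U Ro) \<le> card \<Gamma>r"
      "\<forall>x\<in>\<Gamma>r. \<forall>y\<in>\<Gamma>r. x \<noteq> y \<longrightarrow> (\<exists>s\<in>Ro. l \<le> dist (\<alpha> s x) (\<alpha> s y))"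
      using sep[OF finRo] by blast
    define cls where "cls x = \<lfloor>(\<Sum>s\<in>Ro. \<phi> (\<alpha> s x)) / (\<kappa> * card A)\<rfloor>" for x
    have \<kappa>A: "\<kappa> * card A > 0" using \<kappa> cA by simp
    have cls: "cls x \<in> {-m..m}" for x
    proof -
      have "\<bar>\<Sum>s\<in>Ro. \<phi> (\<alpha> s x)\<bar> \<le> (\<Sum>s\<in>Ro. \<bar>\<phi> (\<alpha> s x)\<bar>)" by (rule sum_abs)
      also have "\<dots> \<le> real (card Ro) * b" using bd by (intro sum_bounded_above)
      also have "\<dots> \<le> real (card A) * b"
        using b0 card_mono[OF A(1), of Ro] RoA by (intro mult_right_mono) auto
      finally have "\<bar>(\<Sum>s\<in>Ro. \<phi> (\<alpha> s x)) / (\<kappa> * card A)\<bar> \<le> real (card A) * b / (\<kappa> * card A)"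
        unfolding abs_divide abs_of_pos[OF \<kappa>A] by (rule divide_right_mono) (use \<kappa>A in linarith)
      also have "\<dots> = b / \<kappa>" using cA by simp
      finally show ?thesis unfolding cls_def m_def atLeastAtMost_iff by linarith
    qed
    obtain j where j: "card \<Gamma>r \<le> Nc * card {x\<in>\<Gamma>r. cls x = j}"
      unfolding Nc_def by (rule exists_large_fibre[OF \<Gamma>r(1), of "{-m..m}" cls]) (use cls m0 in auto)
    define \<Gamma>' where "\<Gamma>' = {x\<in>\<Gamma>r. cls x = j}"
    have "exp (cover_entropy U Ro) \<le> real (Nc * card \<Gamma>')"
      using \<Gamma>r(2) j unfolding \<Gamma>'_def by (meson of_nat_le_iff order_trans)
    also have "\<dots> = real Nc * card \<Gamma>'" by simp
    also have "\<dots> \<le> exp (\<kappa> * card A) * card \<Gamma>'"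
    proof (rule mult_right_mono)
      have "\<kappa> * k \<le> \<kappa> * card A" using kA \<kappa> by (intro mult_left_mono) auto
      then have "ln (real Nc) \<le> \<kappa> * card A" using k by linarith
      then show "real Nc \<le> exp (\<kappa> * card A)" using Nc0 by (metis exp_ln exp_le_cancel_iff of_nat_0_less_iff)
    qed simp
    finally have "exp (cover_entropy U Ro) / exp (\<kappa> * card A) \<le> card \<Gamma>'"
      by (simp add: divide_le_eq mult.commute)
    then have "exp (cover_entropy U Ro - \<kappa> * card A) \<le> card \<Gamma>'" by (simp add: exp_diff)
    moreover have "cover_entropy U A - (3 * \<theta> * M + \<kappa>) * card A \<le> cover_entropy U Ro - \<kappa> * card A"
      using fR by (simp add: algebra_simps)
    ultimately have card\<Gamma>': "exp (cover_entropy U A - (3 * \<theta> * M + \<kappa>) * card A) \<le> card \<Gamma>'"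
      by (meson exp_le_cancel_iff order_trans)
    define v where "v = j * (\<kappa> * card A)"
    have vx: "\<bar>(\<Sum>s\<in>Ro. \<phi> (\<alpha> s x)) - v\<bar> \<le> \<kappa> * card A" if "x \<in> \<Gamma>'" for x
    proof -
      let ?q = "(\<Sum>s\<in>Ro. \<phi> (\<alpha> s x)) / (\<kappa> * card A)"
      have "cls x = j" using that unfolding \<Gamma>'_def by simp
      then have "real_of_int j \<le> ?q" "?q \<le> real_of_int j + 1" unfolding cls_def by linarith+
      note this[THEN mult_right_mono, OF less_imp_le[OF \<kappa>A]]
      then have "v \<le> ?q * (\<kappa> * card A)" "?q * (\<kappa> * card A) \<le> (real_of_int j + 1) * (\<kappa> * card A)"
        unfolding v_def .
      moreover have "?q * (\<kappa> * card A) = (\<Sum>s\<in>Ro. \<phi> (\<alpha> s x))"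
        by (rule nonzero_eq_divide_eq[THEN iffD1, OF _ refl]) (use \<kappa>A in linarith)
      ultimately show ?thesis unfolding v_def distrib_right by linarith
    qed
    have shadow: "\<exists>y. (\<forall>s\<in>Ro. dist (\<alpha> s x) (\<alpha> s y) \<le> r) \<and> (\<forall>s\<in>Qo. dist (\<alpha> s (z t)) (\<alpha> s y) \<le> r)" for x t
    proof -
      \<comment> \<open>Segments are indexed by the sets themselves; if Ro and Qo coincide, both are
        empty and the choice is immaterial.\<close>
      have "\<exists>y. \<forall>B\<in>{Ro, Qo}. \<forall>s\<in>B. dist (\<alpha> s (if B = Qo then z t else x)) (\<alpha> s y) \<le> r"
      proof (rule spec_gap_finite_family[OF P])
        show "finite B \<and> B \<subseteq> carrier G" if "B \<in> {Ro, Qo}" for B using that finRo finQo by blast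
        show "p \<otimes> a \<notin> C" if "B \<in> {Ro, Qo}" "C \<in> {Ro, Qo}" "B \<noteq> C" "p \<in> P" "a \<in> B" for B C p a
        proof (cases "B = Qo")
          case True
          then have "p \<otimes> a \<in> Q" "C = Ro" using that unfolding Qo_def by auto
          then show ?thesis using RoA by blast
        next
          case False
          then have "B = Ro" "C = Qo" using that by auto
          then show ?thesis using that unfolding Ro_def by blast
        qed
      qed simp
      then obtain y where y: "\<forall>B\<in>{Ro, Qo}. \<forall>s\<in>B. dist (\<alpha> s (if B = Qo then z t else x)) (\<alpha> s y) \<le> r" by (rule exE)
      have "\<forall>s\<in>Ro. dist (\<alpha> s x) (\<alpha> s y) \<le> r"
      proof (cases "Ro = Qo")
        case True
        then have "Ro = {}" using RoA QoQ by blast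
        then show ?thesis by simp
      next
        case False
        then show ?thesis using y by simp
      qed
      moreover have "\<forall>s\<in>Qo. dist (\<alpha> s (z t)) (\<alpha> s y) \<le> r" using y by simp
      ultimately show ?thesis by (intro exI[of _ y] conjI)
    qed
    then have "\<forall>t x. \<exists>y. (\<forall>s\<in>Ro. dist (\<alpha> s x) (\<alpha> s y) \<le> r) \<and> (\<forall>s\<in>Qo. dist (\<alpha> s (z t)) (\<alpha> s y) \<le> r)"
      by (intro allI)
    then obtain Y where Y: "\<And>t x. (\<forall>s\<in>Ro. dist (\<alpha> s x) (\<alpha> s (Y t x)) \<le> r) \<and> (\<forall>s\<in>Qo. dist (\<alpha> s (z t)) (\<alpha> s (Y t x)) \<le> r)"
      by metis
    have Ysep: "\<exists>s\<in>A. l - 2 * r \<le> dist (\<alpha> s (Y t x)) (\<alpha> s (Y t x'))" if x: "x \<in> \<Gamma>'" "x' \<in> \<Gamma>'" "x \<noteq> x'" for t x x'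
    proof -
      obtain s where s: "s \<in> Ro" "l \<le> dist (\<alpha> s x) (\<alpha> s x')" using \<Gamma>r(3) x unfolding \<Gamma>'_def by blast
      have "dist (\<alpha> s x) (\<alpha> s x') \<le> dist (\<alpha> s x) (\<alpha> s (Y t x)) + dist (\<alpha> s (Y t x)) (\<alpha> s (Y t x')) + dist (\<alpha> s (Y t x')) (\<alpha> s x')"
        by (metis add_right_mono dist_triangle order_trans)
      moreover have "dist (\<alpha> s x) (\<alpha> s (Y t x)) \<le> r" "dist (\<alpha> s (Y t x')) (\<alpha> s x') \<le> r"
        using Y[of x t] Y[of x' t] s(1) by (simp_all add: dist_commute)
      ultimately have "l - 2 * r \<le> dist (\<alpha> s (Y t x)) (\<alpha> s (Y t x'))" using s(2) by linarith
      then show ?thesis using s(1) RoA by blast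
    qed
    have Yinj: "inj_on (Y t) \<Gamma>'" for t
    proof (rule inj_onI, rule ccontr)
      fix x x' assume "x \<in> \<Gamma>'" "x' \<in> \<Gamma>'" "Y t x = Y t x'" "x \<noteq> x'"
      then show False using Ysep[of x x' t] l by auto
    qed
    define u where "u t = (v + (\<Sum>s\<in>Q. \<phi> (\<alpha> s (z t)))) / card A" for t
    have Ysum: "\<bar>(\<Sum>s\<in>A. \<phi> (\<alpha> s (Y t x))) - u t * card A\<bar> \<le> 4 * \<kappa> * card A" if x: "x \<in> \<Gamma>'" for t x
    proof -
      let ?y = "Y t x"
      have 0: "(\<Sum>s\<in>A. \<phi> (\<alpha> s ?y)) = (\<Sum>s\<in>A - Q. \<phi> (\<alpha> s ?y)) + (\<Sum>s\<in>Q. \<phi> (\<alpha> s ?y))"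
        by (rule sum.subset_diff[OF Q(1) A(1)])
      have 1: "\<bar>(\<Sum>s\<in>A - Q. \<phi> (\<alpha> s ?y)) - (\<Sum>s\<in>Ro. \<phi> (\<alpha> s ?y))\<bar> \<le> b * card (A - Q - Ro)"
        using A(1) RoA bd by (intro sum_subset_close) auto
      have 2: "\<bar>(\<Sum>s\<in>Ro. \<phi> (\<alpha> s ?y)) - (\<Sum>s\<in>Ro. \<phi> (\<alpha> s x))\<bar> \<le> \<kappa> * card Ro"
        using Y[of x t] by (intro sum_pointwise_close modulus) (simp add: dist_commute)
      have 3: "\<bar>(\<Sum>s\<in>Q. \<phi> (\<alpha> s ?y)) - (\<Sum>s\<in>Qo. \<phi> (\<alpha> s ?y))\<bar> \<le> b * card (Q - Qo)"
        using QP'(1) QoQ bd by (intro sum_subset_close) auto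
      have 4: "\<bar>(\<Sum>s\<in>Qo. \<phi> (\<alpha> s ?y)) - (\<Sum>s\<in>Qo. \<phi> (\<alpha> s (z t)))\<bar> \<le> \<kappa> * card Qo"
        using Y[of x t] by (intro sum_pointwise_close modulus) (simp add: dist_commute)
      have 5: "\<bar>(\<Sum>s\<in>Q. \<phi> (\<alpha> s (z t))) - (\<Sum>s\<in>Qo. \<phi> (\<alpha> s (z t)))\<bar> \<le> b * card (Q - Qo)"
        using QP'(1) QoQ bd by (intro sum_subset_close) auto
      have "card Ro + card Qo = card (Ro \<union> Qo)"
        using finRo finQo RoA QoQ by (intro card_Un_disjoint[symmetric]) auto
      also have "\<dots> \<le> card A" using RoA QoQ Q(1) A(1) by (intro card_mono) auto
      finally have "\<kappa> * (real (card Ro) + card Qo) \<le> \<kappa> * card A" using \<kappa> by (intro mult_left_mono) auto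
      then have 6: "\<kappa> * card Ro + \<kappa> * card Qo \<le> \<kappa> * card A" by (simp add: algebra_simps)
      have "b * (card (Q - Qo) + real (card (A - Q - Ro))) \<le> b * (\<kappa>' * card A)"
        using loss b0 by (intro mult_left_mono) auto
      also have "\<dots> \<le> \<kappa> * card A" unfolding mult.assoc[symmetric] using b\<kappa>' by (intro mult_right_mono) auto
      finally have 7: "b * card (Q - Qo) + b * card (A - Q - Ro) \<le> \<kappa> * card A" by (simp add: algebra_simps)
      have 8: "b * card (A - Q - Ro) \<ge> 0" using b0 by simp
      have "u t * card A = v + (\<Sum>s\<in>Q. \<phi> (\<alpha> s (z t)))" unfolding u_def using cA by simp
      \<comment> \<open>Four times \<kappa> * card A: one for shadowing on Ro and Qo, one for the
        width of the class, two for the dropped points, since Q - Qo is paid for both at the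
        shadowing point and at z t.\<close>
      then have "\<bar>(\<Sum>s\<in>A. \<phi> (\<alpha> s ?y)) - u t * card A\<bar> \<le>
          b * card (A - Q - Ro) + \<kappa> * card Ro + \<kappa> * card A + b * card (Q - Qo) + \<kappa> * card Qo + b * card (Q - Qo)"
        using 0 1 2 3 4 5 vx[OF x] by linarith
      then show ?thesis using 6 7 8 by linarith
    qed
    have "u False + \<theta> * g \<le> u True"
    proof -
      have "\<theta> * card A * g \<le> card Q * g" by (rule mult_right_mono[OF Q(3) g])
      also have "\<dots> \<le> (\<Sum>s\<in>Q. \<phi> (\<alpha> s (z True))) - (\<Sum>s\<in>Q. \<phi> (\<alpha> s (z False)))"
        using K1(4)[OF QK] by (simp add: mult.commute)
      also have "\<dots> = (u True - u False) * card A" unfolding u_def using cA by (simp add: field_simps)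
      finally have "\<theta> * g * card A \<le> (u True - u False) * card A" by (simp add: mult_ac)
      then show ?thesis using cA by simp
    qed
    moreover have "finite (Y t ` \<Gamma>') \<and> Y t ` \<Gamma>' \<noteq> {} \<and>
        exp (cover_entropy U A - (3 * \<theta> * cover_entropy U {\<one>} + \<kappa>) * card A) \<le> card (Y t ` \<Gamma>') \<and>
       (\<forall>x\<in>Y t ` \<Gamma>'. \<forall>y\<in>Y t ` \<Gamma>'. x \<noteq> y \<longrightarrow> (\<exists>s\<in>A. l - 2 * r \<le> dist (\<alpha> s x) (\<alpha> s y))) \<and>
       (\<forall>y\<in>Y t ` \<Gamma>'. \<bar>(\<Sum>s\<in>A. \<phi> (\<alpha> s y)) - u t * card A\<bar> \<le> 4 * \<kappa> * card A)" for t
    proof (intro conjI)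
      show "finite (Y t ` \<Gamma>')" using \<Gamma>r(1) unfolding \<Gamma>'_def by simp
      show c: "exp (cover_entropy U A - (3 * \<theta> * cover_entropy U {\<one>} + \<kappa>) * card A) \<le> card (Y t ` \<Gamma>')"
        using card\<Gamma>' Yinj[of t] unfolding M_def by (simp add: card_image)
      show "Y t ` \<Gamma>' \<noteq> {}"
      proof
        assume "Y t ` \<Gamma>' = {}"
        then have "exp (cover_entropy U A - (3 * \<theta> * cover_entropy U {\<one>} + \<kappa>) * card A) \<le> 0" using c by simp
        then show False using exp_gt_zero by (meson leD)
      qed
      show "\<forall>x\<in>Y t ` \<Gamma>'. \<forall>y\<in>Y t ` \<Gamma>'. x \<noteq> y \<longrightarrow> (\<exists>s\<in>A. l - 2 * r \<le> dist (\<alpha> s x) (\<alpha> s y))"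
        using Ysep by (auto simp del: bex_simps)
      show "\<forall>y\<in>Y t ` \<Gamma>'. \<bar>(\<Sum>s\<in>A. \<phi> (\<alpha> s y)) - u t * card A\<bar> \<le> 4 * \<kappa> * card A"
        using Ysum by blast
    qed
    ultimately show "\<exists>\<Gamma> u. two_sided_family \<phi> (4 * \<kappa>) (\<theta> * g) (l - 2 * r)
      (cover_entropy U A - (3 * \<theta> * cover_entropy U {\<one>} + \<kappa>) * card A) A \<Gamma> u"
      unfolding two_sided_family_def
      by (intro exI[of _ "\<lambda>t. Y t ` \<Gamma>'"] exI[of _ u] conjI allI) blast+
  qed
qed

end

section \<open>Mass distribution on shadowing points\<close>

text \<open>Countable subadditivity in the form of the sums over Bowen covers, which are unordered;
  an enumeration turns them into series whose partial sums are finite subsums.\<close>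

lemma emeasure_UN_le_infsum:
  fixes f :: "'c \<Rightarrow> ennreal"
  assumes C: "countable C" and B: "\<And>c. c \<in> C \<Longrightarrow> B c \<in> sets M" and le: "\<And>c. c \<in> C \<Longrightarrow> emeasure M (B c) \<le> f c"
  shows "emeasure M (\<Union>c\<in>C. B c) \<le> infsum f C"
proof (cases "finite C")
  case True
  have "emeasure M (\<Union>c\<in>C. B c) \<le> (\<Sum>c\<in>C. emeasure M (B c))"
    using True B by (intro emeasure_subadditive_finite) auto
  also have "\<dots> \<le> (\<Sum>c\<in>C. f c)" using le by (rule sum_mono)
  finally show ?thesis using True by simp
next
  case False
  let ?e = "from_nat_into C"
  have e: "bij_betw ?e UNIV C" using C False by (rule bij_betw_from_nat_into)
  then have eC: "?e n \<in> C" for n by (auto simp: bij_betw_def)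
  have "C = range ?e" using e by (auto simp: bij_betw_def)
  then have "(\<Union>c\<in>C. B c) = (\<Union>c\<in>range ?e. B c)" by (rule arg_cong)
  also have "\<dots> = (\<Union>n. B (?e n))" by blast
  also have "emeasure M \<dots> \<le> (\<Sum>n. emeasure M (B (?e n)))"
    using B eC by (intro emeasure_subadditive_countably) auto
  also have "\<dots> \<le> (\<Sum>n. f (?e n))" using le eC by (intro suminf_le summableI) auto
  also have "\<dots> \<le> infsum f C"
  proof (rule suminf_le_const[OF summableI])
    fix n
    have inj: "inj_on ?e {..<n}" using e by (auto simp: bij_betw_def intro: inj_on_subset)
    have "(\<Sum>i<n. f (?e i)) = sum f (?e ` {..<n})" using inj by (simp add: sum.reindex)
    also have "\<dots> \<le> (SUP A\<in>{A. finite A \<and> A \<subseteq> C}. sum f A)"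
      using eC by (intro SUP_upper) auto
    also have "\<dots> = infsum f C" by (rule nonneg_infsum_complete[symmetric]) simp
    finally show "(\<Sum>i<n. f (?e i)) \<le> infsum f C" .
  qed
  finally show ?thesis .
qed

section \<open>Lower bounds from the product measure\<close>

context dynamical_system
begin

text \<open>The mass distribution principle, on the space of choices \<omega> of one segment per
  piece instead of on \<open>Y\<close>, so that the shadowing map need not be measurable. Choices
  whose shadowing points lie in the same Bowen ball over \<open>F m\<close> agree on every piece
  inside \<open>F m\<close>; otherwise points at distance at least l would be closer than 2 * r + 2
  * \<epsilon>. A ball thus hits only a cylinder, of measure at most exp (- s * card (F m)), and the
  cylinders of a cover exhaust the total mass 1.\<close>

lemma bowen_sum_inf_ge_1:
  fixes l r \<epsilon> s \<sigma> \<delta> :: real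
  assumes F: "folner_seq G F"
    and dj: "disjoint \<A>" and A: "\<And>A. A \<in> \<A> \<Longrightarrow> finite A \<and> A \<subseteq> carrier G"
    and \<Gamma>: "\<And>A. A \<in> \<A> \<Longrightarrow> finite (\<Gamma> A) \<and> \<Gamma> A \<noteq> {} \<and> exp (\<sigma> * card A) \<le> card (\<Gamma> A)"
    and sep: "\<And>A x y. A \<in> \<A> \<Longrightarrow> x \<in> \<Gamma> A \<Longrightarrow> y \<in> \<Gamma> A \<Longrightarrow> x \<noteq> y \<Longrightarrow> \<exists>s\<in>A. l \<le> dist (\<alpha> s x) (\<alpha> s y)"
    and Y: "\<And>\<omega>. (\<And>A. A \<in> \<A> \<Longrightarrow> \<omega> A \<in> \<Gamma> A) \<Longrightarrow>
      \<exists>y\<in>Y. \<forall>A\<in>\<A>. \<forall>s\<in>A. dist (\<alpha> s (\<omega> A)) (\<alpha> s y) \<le> r"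
    and cov: "\<And>n. N \<le> n \<Longrightarrow> card (F n - \<Union>{A\<in>\<A>. A \<subseteq> F n}) \<le> \<delta> * card (F n)"
    and l: "2 * r + 2 * \<epsilon> < l" and \<sigma>: "\<sigma> \<ge> 0" and s: "s \<le> \<sigma> * (1 - \<delta>)"
  shows "1 \<le> bowen_sum_inf \<alpha> F Y \<epsilon> N s"
  unfolding bowen_sum_inf_def
proof (rule INF_greatest)
  fix C assume "C \<in> bowen_covers \<alpha> F Y \<epsilon> N"
  then have C: "countable C" "\<forall>(m, x)\<in>C. N \<le> m" "Y \<subseteq> (\<Union>(m, x)\<in>C. bowen_ball \<alpha> (F m) x \<epsilon>)"
    unfolding bowen_covers_def by auto
  define M where "M A = uniform_count_measure (\<Gamma> A)" for A
  define \<Omega> where "\<Omega> = space (PiM \<A> M)"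
  have Mp: "prob_space (M A)" if "A \<in> \<A>" for A
    unfolding M_def using \<Gamma>[OF that] by (intro prob_space_uniform_count_measure) auto
  interpret P: prob_space "PiM \<A> M" using Mp by (rule prob_space_PiM)
  have spM: "space (M A) = \<Gamma> A" for A unfolding M_def by (simp add: space_uniform_count_measure)
  have setsM: "sets (M A) = Pow (\<Gamma> A)" for A unfolding M_def by (simp add: sets_uniform_count_measure)
  have \<Omega>: "\<omega> A \<in> \<Gamma> A" if "\<omega> \<in> \<Omega>" "A \<in> \<A>" for \<omega> A
    using that unfolding \<Omega>_def space_PiM spM by auto
  define Sh where "Sh \<omega> y \<longleftrightarrow> y \<in> Y \<and> (\<forall>A\<in>\<A>. \<forall>s\<in>A. dist (\<alpha> s (\<omega> A)) (\<alpha> s y) \<le> r)" for \<omega> y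
  define sh where "sh \<omega> = (SOME y. Sh \<omega> y)" for \<omega>
  have sh: "Sh \<omega> (sh \<omega>)" if "\<omega> \<in> \<Omega>" for \<omega>
  proof -
    have "\<exists>y\<in>Y. \<forall>A\<in>\<A>. \<forall>s\<in>A. dist (\<alpha> s (\<omega> A)) (\<alpha> s y) \<le> r" by (rule Y) (rule \<Omega>[OF that])
    then have "\<exists>y. Sh \<omega> y" unfolding Sh_def by blast
    then show ?thesis unfolding sh_def by (rule someI_ex)
  qed
  define Q where "Q m = {A\<in>\<A>. A \<subseteq> F m}" for m
  \<comment> \<open>This set need not be measurable; it is used only through the cylinder
    \<open>cyl c\<close> around it, which fixes the coordinates inside \<open>F (fst c)\<close> to
    those of one representative.\<close>
  define hit where "hit c = {\<omega>\<in>\<Omega>. sh \<omega> \<in> bowen_ball \<alpha> (F (fst c)) (snd c) \<epsilon>}" for c :: "nat \<times> 'x"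
  define rep where "rep c = (SOME \<omega>. \<omega> \<in> hit c)" for c
  define cyl where "cyl c = (if hit c = {} then {} else
    prod_emb \<A> M (Q (fst c)) (Pi\<^sub>E (Q (fst c)) (\<lambda>A. {rep c A})))" for c
  have rep: "rep c \<in> hit c" if "hit c \<noteq> {}" for c
    unfolding rep_def using that by (simp add: some_in_eq)
  have Qfin: "finite (Q m)" "Q m \<subseteq> \<A>" for m
    using disjoint_subsets_card(1)[OF dj folner_seqD(2)[OF F]] unfolding Q_def by auto
  have repQ: "rep c A \<in> \<Gamma> A" if "hit c \<noteq> {}" "A \<in> Q m" for c A m
    using rep[OF that(1)] \<Omega> that(2) Qfin(2) unfolding hit_def by blast
  have hit_cyl: "hit c \<subseteq> cyl c" for c
  proof
    fix \<omega> assume \<omega>: "\<omega> \<in> hit c"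
    then have ne: "hit c \<noteq> {}" by blast
    have \<omega>\<Omega>: "\<omega> \<in> \<Omega>" "rep c \<in> \<Omega>" using \<omega> rep[OF ne] unfolding hit_def by auto
    let ?m = "fst c" and ?x = "snd c"
    have "\<omega> A = rep c A" if A: "A \<in> Q ?m" for A
    proof (rule ccontr)
      assume neq: "\<omega> A \<noteq> rep c A"
      have A': "A \<in> \<A>" "A \<subseteq> F ?m" using A unfolding Q_def by auto
      obtain s where s: "s \<in> A" "l \<le> dist (\<alpha> s (\<omega> A)) (\<alpha> s (rep c A))"
        using sep[OF A'(1) \<Omega>[OF \<omega>\<Omega>(1) A'(1)] \<Omega>[OF \<omega>\<Omega>(2) A'(1)] neq] by blast
      have sF: "s \<in> F ?m" using s A' by blast
      have "dist (\<alpha> s ?x) (\<alpha> s (sh \<omega>)) < \<epsilon>" "dist (\<alpha> s ?x) (\<alpha> s (sh (rep c))) < \<epsilon>"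
        using \<omega> rep[OF ne] sF folner_seqD(1,2)[OF F] unfolding hit_def by (auto simp: mem_bowen_ball)
      moreover have "dist (\<alpha> s (\<omega> A)) (\<alpha> s (sh \<omega>)) \<le> r" "dist (\<alpha> s (rep c A)) (\<alpha> s (sh (rep c))) \<le> r"
        using sh[OF \<omega>\<Omega>(1)] sh[OF \<omega>\<Omega>(2)] A'(1) s(1) unfolding Sh_def by auto
      moreover have "dist (\<alpha> s (\<omega> A)) (\<alpha> s (rep c A)) \<le> dist (\<alpha> s (\<omega> A)) (\<alpha> s (sh \<omega>))
          + (dist (\<alpha> s (sh \<omega>)) (\<alpha> s ?x) + dist (\<alpha> s ?x) (\<alpha> s (sh (rep c)))) + dist (\<alpha> s (sh (rep c))) (\<alpha> s (rep c A))"
        using dist_triangle[of "\<alpha> s (\<omega> A)" "\<alpha> s (rep c A)" "\<alpha> s (sh (rep c))"]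
          dist_triangle[of "\<alpha> s (\<omega> A)" "\<alpha> s (sh (rep c))" "\<alpha> s (sh \<omega>)"]
          dist_triangle[of "\<alpha> s (sh \<omega>)" "\<alpha> s (sh (rep c))" "\<alpha> s ?x"] by linarith
      ultimately show False using s(2) l by (simp add: dist_commute)
    qed
    then have "\<omega> \<in> prod_emb \<A> M (Q ?m) (Pi\<^sub>E (Q ?m) (\<lambda>A. {rep c A}))"
      using \<omega>\<Omega>(1) Qfin(2)[of ?m] unfolding \<Omega>_def prod_emb_def space_PiM by (auto simp: PiE_iff extensional_def)
    then show "\<omega> \<in> cyl c" using ne unfolding cyl_def by simp
  qed
  have cyl_sets: "cyl c \<in> sets (PiM \<A> M)" for c
  proof (cases "hit c = {}")
    case False
    have "prod_emb \<A> M (Q (fst c)) (Pi\<^sub>E (Q (fst c)) (\<lambda>A. {rep c A})) \<in> sets (PiM \<A> M)"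
      using repQ[OF False] setsM by (intro sets_PiM_I Qfin) auto
    then show ?thesis unfolding cyl_def using False by simp
  qed (simp add: cyl_def)
  have cyl_le: "emeasure (PiM \<A> M) (cyl c) \<le> (case c of (m, x) \<Rightarrow> ennreal (exp (- s * real (card (F m)))))" if c: "c \<in> C" for c
  proof (cases "hit c = {}")
    case True
    then show ?thesis unfolding cyl_def by simp
  next
    case False
    let ?m = "fst c"
    have m: "N \<le> ?m" using c C(2) by auto
    have "emeasure (PiM \<A> M) (cyl c) = (\<Prod>A\<in>Q ?m. emeasure (M A) {rep c A})"
      unfolding cyl_def using False Mp Qfin[of ?m] repQ[OF False] setsM
      by (simp add: emeasure_PiM_emb)
    also have "\<dots> = (\<Prod>A\<in>Q ?m. ennreal (1 / card (\<Gamma> A)))"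
    proof (rule prod.cong[OF refl])
      fix A assume A: "A \<in> Q ?m"
      then have "finite (\<Gamma> A)" using \<Gamma> Qfin(2) by blast
      then show "emeasure (M A) {rep c A} = ennreal (1 / card (\<Gamma> A))"
        unfolding M_def using repQ[OF False A] by (simp add: emeasure_uniform_count_measure)
    qed
    also have "\<dots> = ennreal (\<Prod>A\<in>Q ?m. 1 / card (\<Gamma> A))" by (rule prod_ennreal) simp
    also have "\<dots> \<le> ennreal (exp (- s * real (card (F ?m))))"
    proof (rule ennreal_leI)
      have "(\<Prod>A\<in>Q ?m. 1 / real (card (\<Gamma> A))) \<le> (\<Prod>A\<in>Q ?m. exp (- (\<sigma> * card A)))"
      proof (rule prod_mono)
        fix A assume "A \<in> Q ?m"
        then have le: "exp (\<sigma> * card A) \<le> card (\<Gamma> A)" using \<Gamma> Qfin(2) by blast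
        have "1 / real (card (\<Gamma> A)) \<le> 1 / exp (\<sigma> * card A)" using le by (intro divide_left_mono) (auto intro: mult_pos_pos less_le_trans[OF exp_gt_zero])
        then show "0 \<le> 1 / real (card (\<Gamma> A)) \<and> 1 / real (card (\<Gamma> A)) \<le> exp (- (\<sigma> * card A))"
          by (simp add: exp_minus inverse_eq_divide)
      qed
      also have "\<dots> = exp (\<Sum>A\<in>Q ?m. - (\<sigma> * card A))" by (rule exp_sum[OF Qfin(1), symmetric])
      also have "(\<Sum>A\<in>Q ?m. - (\<sigma> * card A)) = - (\<sigma> * (\<Sum>A\<in>Q ?m. real (card A)))"
        by (simp add: sum_negf sum_distrib_left)
      \<comment> \<open>The pieces inside \<open>F ?m\<close> fill at least 1 - \<delta> of it,
        which turns the rate \<sigma> into \<sigma> * (1 - \<delta>) \<ge> s.\<close>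
      also have "exp \<dots> \<le> exp (- s * real (card (F ?m)))"
      proof -
        have "(\<Sum>A\<in>Q ?m. real (card A)) = real (card (F ?m)) - card (F ?m - \<Union>{A\<in>\<A>. A \<subseteq> F ?m})"
          unfolding Q_def by (rule disjoint_subsets_card(3)[OF dj folner_seqD(2)[OF F]])
        then have "(1 - \<delta>) * card (F ?m) \<le> (\<Sum>A\<in>Q ?m. real (card A))"
          using cov[OF m] by (simp add: algebra_simps)
        then have "\<sigma> * ((1 - \<delta>) * card (F ?m)) \<le> \<sigma> * (\<Sum>A\<in>Q ?m. real (card A))"
          using \<sigma> by (rule mult_left_mono)
        moreover have "s * card (F ?m) \<le> \<sigma> * (1 - \<delta>) * card (F ?m)" using s by (intro mult_right_mono) auto
        ultimately show ?thesis by simp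
      qed
      finally show "(\<Prod>A\<in>Q ?m. 1 / real (card (\<Gamma> A))) \<le> exp (- s * real (card (F ?m)))" .
    qed
    finally show ?thesis by (simp add: case_prod_beta)
  qed
  have "\<Omega> \<subseteq> (\<Union>c\<in>C. cyl c)"
  proof
    fix \<omega> assume \<omega>: "\<omega> \<in> \<Omega>"
    then have "sh \<omega> \<in> Y" using sh unfolding Sh_def by blast
    then obtain c where "c \<in> C" "sh \<omega> \<in> bowen_ball \<alpha> (F (fst c)) (snd c) \<epsilon>" using C(3) by fastforce
    then have "\<omega> \<in> hit c" "c \<in> C" using \<omega> unfolding hit_def by auto
    then show "\<omega> \<in> (\<Union>c\<in>C. cyl c)" using hit_cyl by blast
  qed
  then have "emeasure (PiM \<A> M) \<Omega> \<le> emeasure (PiM \<A> M) (\<Union>c\<in>C. cyl c)"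
    using cyl_sets C(1) by (intro emeasure_mono sets.countable_UN') auto
  also have "\<dots> \<le> (\<Sum>\<^sub>\<infinity>c\<in>C. case c of (m, x) \<Rightarrow> ennreal (exp (- s * real (card (F m)))))"
    by (rule emeasure_UN_le_infsum[OF C(1) cyl_sets cyl_le])
  finally show "1 \<le> (\<Sum>\<^sub>\<infinity>(m, x)\<in>C. ennreal (exp (- s * real (card (F m)))))"
    unfolding \<Omega>_def P.emeasure_space_1 .
qed

text \<open>Larger N admits fewer covers, so the limit in \<open>bowen_measure\<close> is a
  supremum, and the bound 1 at a single N excludes every t \<le> s from the infimum.\<close>

lemma bowen_entropy_scale_ge:
  assumes "\<And>t. t \<le> s \<Longrightarrow> 1 \<le> bowen_sum_inf \<alpha> F Y \<epsilon> N t"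
  shows "ereal s \<le> bowen_entropy_scale \<alpha> F Y \<epsilon>"
  unfolding bowen_entropy_scale_def
proof (rule Inf_greatest)
  fix e assume "e \<in> {ereal t |t. 0 < t \<and> bowen_measure \<alpha> F Y \<epsilon> t = 0}"
  then obtain t where t: "e = ereal t" "bowen_measure \<alpha> F Y \<epsilon> t = 0" by blast
  show "ereal s \<le> e"
  proof (rule ccontr)
    assume "\<not> ereal s \<le> e"
    then have "t \<le> s" using t by simp
    then have ge: "1 \<le> bowen_sum_inf \<alpha> F Y \<epsilon> N t" by (rule assms)
    have "incseq (\<lambda>N. bowen_sum_inf \<alpha> F Y \<epsilon> N t)"
    proof (rule incseq_SucI)
      fix N
      have "bowen_covers \<alpha> F Y \<epsilon> (Suc N) \<subseteq> bowen_covers \<alpha> F Y \<epsilon> N"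
        unfolding bowen_covers_def by (auto dest: Suc_leD)
      then show "bowen_sum_inf \<alpha> F Y \<epsilon> N t \<le> bowen_sum_inf \<alpha> F Y \<epsilon> (Suc N) t"
        unfolding bowen_sum_inf_def by (rule INF_superset_mono) simp
    qed
    then have "(\<lambda>N. bowen_sum_inf \<alpha> F Y \<epsilon> N t) \<longlonglongrightarrow> (SUP N. bowen_sum_inf \<alpha> F Y \<epsilon> N t)" by (rule LIMSEQ_SUP)
    then have "bowen_measure \<alpha> F Y \<epsilon> t = (SUP N. bowen_sum_inf \<alpha> F Y \<epsilon> N t)"
      unfolding bowen_measure_def by (rule limI)
    moreover have "bowen_sum_inf \<alpha> F Y \<epsilon> N t \<le> (SUP N. bowen_sum_inf \<alpha> F Y \<epsilon> N t)" by (rule SUP_upper) simp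
    ultimately show False using ge t(2) by simp
  qed
qed

end

text \<open>Applied to sizes of Folner sets: everything inside the earlier chosen sets is negligible
  in the next one.\<close>

lemma exists_sparse_subsequence:
  fixes a :: "nat \<Rightarrow> real"
  assumes a: "filterlim a at_top sequentially" and nonneg: "\<And>n. a n \<ge> 0" and \<delta>: "\<delta> > 0"
  shows "\<exists>k :: nat \<Rightarrow> nat. strict_mono k \<and> (\<forall>j. (\<Sum>i<j. a (k i)) \<le> \<delta> * a (k j))"
proof -
  \<comment> \<open>The state pairs the current index with the sum of all terms so far, so that the
    condition on the next index refers to the previous state alone.\<close>
  let ?P = "\<lambda>j (x :: nat \<times> real). j = (0::nat) \<longrightarrow> snd x = a (fst x)"
  let ?Q = "\<lambda>(j::nat) (x :: nat \<times> real) (y :: nat \<times> real). fst x < fst y \<and> snd x \<le> \<delta> * a (fst y) \<and> snd y = snd x + a (fst y)"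
  have "\<exists>f. \<forall>n. ?P n (f n) \<and> ?Q n (f n) (f (Suc n))"
  proof (rule dependent_nat_choice)
    show "\<exists>x. ?P 0 x" by (rule exI[of _ "(0, a 0)"]) simp
    fix x :: "nat \<times> real" and j :: nat
    have "eventually (\<lambda>n. snd x / \<delta> \<le> a n) sequentially"
      using a unfolding filterlim_at_top by blast
    moreover have "eventually (\<lambda>n. fst x < n) sequentially" by (rule eventually_gt_at_top)
    ultimately have "eventually (\<lambda>n. snd x / \<delta> \<le> a n \<and> fst x < n) sequentially" by (rule eventually_conj)
    then obtain n where n: "snd x / \<delta> \<le> a n" "fst x < n" unfolding eventually_sequentially by blast
    have "snd x \<le> \<delta> * a n" using n(1) \<delta> by (simp add: pos_divide_le_eq mult.commute)
    then show "\<exists>y. ?P (Suc j) y \<and> ?Q j x y" using n(2) by (intro exI[of _ "(n, snd x + a n)"]) simp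
  qed
  then obtain f where f: "\<And>n. ?P n (f n)" "\<And>n. ?Q n (f n) (f (Suc n))" by blast
  let ?k = "\<lambda>j. fst (f j)"
  have S: "snd (f j) = (\<Sum>i<Suc j. a (?k i))" for j
  proof (induction j)
    case 0
    show ?case using f(1)[of 0] by simp
  next
    case (Suc j)
    have "snd (f (Suc j)) = snd (f j) + a (?k (Suc j))" using f(2)[of j] by simp
    then show ?case using Suc by simp
  qed
  have "(\<Sum>i<j. a (?k i)) \<le> \<delta> * a (?k j)" for j
  proof (cases j)
    case 0
    then show ?thesis using nonneg[of "?k 0"] \<delta> by simp
  next
    case (Suc i)
    then show ?thesis using f(2)[of i] S[of i] by simp
  qed
  then have 1: "\<forall>j. (\<Sum>i<j. a (?k i)) \<le> \<delta> * a (?k j)" by simp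
  have "strict_mono ?k" unfolding strict_mono_Suc_iff using f(2) by simp
  then have "strict_mono ?k \<and> (\<forall>j. (\<Sum>i<j. a (?k i)) \<le> \<delta> * a (?k j))" using 1 by (rule conjI)
  then show ?thesis by (rule exI[where x = ?k])
qed

section \<open>Irregularity of the shadowing points and the choice of constants\<close>

context dynamical_system
begin

text \<open>The type of a piece is the parity of the first \<open>j\<close> for which \<open>F\<^bsub>n j\<^esub>\<close> contains it. Since the
  sequence \<open>n\<close> is sparse, almost all pieces of \<open>F\<^bsub>n j\<^esub>\<close> have the type given by the parity of \<open>j\<close>.\<close>

lemma exists_irregular_types:
  fixes \<phi> :: "'x \<Rightarrow> real" and \<kappa> \<gamma> b r \<delta> l :: real
  assumes F: "folner_seq G F" and dj: "disjoint \<A>"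
    and A: "\<And>A. A \<in> \<A> \<Longrightarrow> finite A \<and> A \<noteq> {} \<and> A \<subseteq> carrier G"
    and fam: "\<And>A. A \<in> \<A> \<Longrightarrow> two_sided_family \<phi> (4 * \<kappa>) \<gamma> l (M A) A (\<Gamma> A) (u A)"
    and cov: "\<And>n. N \<le> n \<Longrightarrow> card (F n - \<Union>{A\<in>\<A>. A \<subseteq> F n}) \<le> \<delta> * card (F n)"
    and \<delta>: "\<delta> \<le> 1/2" "b * \<delta> \<le> \<kappa>"
    and modulus: "\<And>x y. dist x y \<le> r \<Longrightarrow> \<bar>\<phi> x - \<phi> y\<bar> \<le> \<kappa>"
    and bd: "\<And>x. \<bar>\<phi> x\<bar> \<le> b" and \<kappa>: "\<kappa> > 0" and \<gamma>: "64 * \<kappa> \<le> \<gamma>"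
  shows "\<exists>\<tau>. \<forall>\<omega> y. (\<forall>A\<in>\<A>. \<omega> A \<in> \<Gamma> A (\<tau> A)) \<longrightarrow>
    (\<forall>A\<in>\<A>. \<forall>s\<in>A. dist (\<alpha> s (\<omega> A)) (\<alpha> s y) \<le> r) \<longrightarrow> y \<in> irregular_set \<alpha> F \<phi>"
proof -
  note Fm = folner_seqD[OF F]
  have b0: "b \<ge> 0" using bd[of undefined] by simp
  define B where "B = b + 4 * \<kappa>"
  have B0: "B > 0" unfolding B_def using b0 \<kappa> by simp
  have gap: "u A False + \<gamma> \<le> u A True" if "A \<in> \<A>" for A
    using fam[OF that] unfolding two_sided_family_def by blast
  have avg: "\<bar>(\<Sum>s\<in>A. \<phi> (\<alpha> s y)) - u A t * card A\<bar> \<le> 4 * \<kappa> * card A" if "A \<in> \<A>" "y \<in> \<Gamma> A t" for A t y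
    using fam[OF that(1)] that(2) unfolding two_sided_family_def by blast
  have uB: "\<bar>u A t\<bar> \<le> B" if AA: "A \<in> \<A>" for A t
  proof -
    obtain y where y: "y \<in> \<Gamma> A t" using fam[OF AA] unfolding two_sided_family_def by blast
    have cA: "real (card A) > 0" using A[OF AA] by (simp add: card_gt_0_iff)
    have "\<bar>\<Sum>s\<in>A. \<phi> (\<alpha> s y)\<bar> \<le> (\<Sum>s\<in>A. \<bar>\<phi> (\<alpha> s y)\<bar>)" by (rule sum_abs)
    also have "\<dots> \<le> real (card A) * b" using bd by (intro sum_bounded_above)
    finally have "\<bar>u A t * card A\<bar> \<le> real (card A) * b + 4 * \<kappa> * card A" using avg[OF AA y] by linarith
    also have "\<dots> = B * card A" unfolding B_def by (simp add: algebra_simps)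
    finally show ?thesis using cA by (simp add: abs_mult)
  qed
  define Q where "Q n = {A\<in>\<A>. A \<subseteq> F n}" for n
  have Qfin: "finite (Q n)" for n unfolding Q_def by (rule disjoint_subsets_card(1)[OF dj Fm(2)])
  have Qsum: "(\<Sum>A\<in>Q n. real (card A)) = real (card (F n)) - card (F n - \<Union>{A\<in>\<A>. A \<subseteq> F n})" for n
    unfolding Q_def by (rule disjoint_subsets_card(3)[OF dj Fm(2)])
  have Qle: "(\<Sum>A\<in>Q n. real (card A)) \<le> card (F n)" for n unfolding Qsum by simp
  \<comment> \<open>The average over \<open>F n\<close> if all its pieces had type t, up to
    uncovered points. The subsequence r0 makes the values for False converge; those for True need no
    limit, as they stay 32 * \<kappa> above.\<close>
  define W where "W t n = (\<Sum>A\<in>Q n. u A t * card A) / card (F n)" for t n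
  have WB: "\<bar>W t n\<bar> \<le> B" for t n
  proof -
    have "\<bar>\<Sum>A\<in>Q n. u A t * card A\<bar> \<le> (\<Sum>A\<in>Q n. \<bar>u A t * card A\<bar>)" by (rule sum_abs)
    also have "\<dots> \<le> (\<Sum>A\<in>Q n. B * card A)"
      using uB unfolding Q_def by (intro sum_mono) (auto simp: abs_mult intro: mult_right_mono)
    also have "\<dots> = B * (\<Sum>A\<in>Q n. real (card A))" by (simp add: sum_distrib_left)
    also have "\<dots> \<le> B * card (F n)" using Qle B0 by (intro mult_left_mono) auto
    finally show ?thesis unfolding W_def using Fm(4)[of n] by (simp add: abs_divide divide_le_eq)
  qed
  have "bounded (range (W False))" by (rule boundedI[of _ B]) (use WB in auto)
  then obtain v r0 where r0: "strict_mono r0" "(W False \<circ> r0) \<longlonglongrightarrow> v"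
    using bounded_imp_convergent_subsequence by blast
  have "filterlim (\<lambda>n. real (card (F (r0 n)))) at_top sequentially"
    using filterlim_compose[OF folner_card_at_top[OF F] filterlim_subseq[OF r0(1)]] .
  \<comment> \<open>A piece of the wrong type lies in an earlier set and changes the sum by at most
    2 * B per element; the ratio \<kappa> / (2 * B) limits the total change to \<kappa> * card (F (n
    j)).\<close>
  then obtain k :: "nat \<Rightarrow> nat" where k: "strict_mono k"
    "\<And>j. (\<Sum>i<j. real (card (F (r0 (k i))))) \<le> \<kappa> / (2 * B) * card (F (r0 (k j)))"
    using exists_sparse_subsequence[of "\<lambda>n. real (card (F (r0 n)))" "\<kappa> / (2 * B)"] \<kappa> B0 by auto
  define n where "n j = r0 (k j)" for j
  have n_mono: "strict_mono n" using strict_mono_o[OF r0(1) k(1)] unfolding n_def o_def .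
  have n_lim: "(\<lambda>j. W False (n j)) \<longlonglongrightarrow> v"
    using LIMSEQ_subseq_LIMSEQ[OF r0(2) k(1)] unfolding n_def o_def .
  \<comment> \<open>For a piece contained in none of the chosen sets the minimum is an arbitrary
    default; such a piece belongs to no Q (n j).\<close>
  define \<tau> where "\<tau> A = odd (LEAST j. A \<subseteq> F (n j))" for A
  have types: "\<bar>(\<Sum>A\<in>Q (n j). u A (\<tau> A) * card A) - (\<Sum>A\<in>Q (n j). u A (odd j) * card A)\<bar> \<le> \<kappa> * card (F (n j))" for j
  proof -
    let ?V = "\<Union>i<j. F (n i)"
    let ?Z = "{A\<in>\<A>. A \<subseteq> ?V}"
    have finV: "finite ?V" using Fm by auto
    have finZ: "finite ?Z" by (rule disjoint_subsets_card(1)[OF dj finV])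
    have "\<bar>(\<Sum>A\<in>Q (n j). u A (\<tau> A) * card A) - (\<Sum>A\<in>Q (n j). u A (odd j) * card A)\<bar>
      \<le> (\<Sum>A\<in>Q (n j). \<bar>u A (\<tau> A) * card A - u A (odd j) * card A\<bar>)"
      unfolding sum_subtractf[symmetric] by (rule sum_abs)
    also have "\<dots> \<le> (\<Sum>A\<in>Q (n j). if A \<in> ?Z then 2 * B * card A else 0)"
    proof (rule sum_mono)
      fix A assume "A \<in> Q (n j)"
      then have AA: "A \<in> \<A>" "A \<subseteq> F (n j)" unfolding Q_def by auto
      show "\<bar>u A (\<tau> A) * card A - u A (odd j) * card A\<bar> \<le> (if A \<in> ?Z then 2 * B * card A else 0)"
      proof (cases "(LEAST j. A \<subseteq> F (n j)) = j")
        case True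
        then show ?thesis using B0 unfolding \<tau>_def by simp
      next
        case False
        have "A \<subseteq> F (n (LEAST j. A \<subseteq> F (n j)))" using AA(2) by (rule LeastI)
        moreover have "(LEAST j. A \<subseteq> F (n j)) \<le> j" using AA(2) by (rule Least_le)
        ultimately have "A \<in> ?Z" using AA(1) False by force
        moreover have "\<bar>u A (\<tau> A) * card A - u A (odd j) * card A\<bar> \<le> 2 * B * card A"
        proof -
          have "\<bar>u A (\<tau> A) - u A (odd j)\<bar> \<le> 2 * B" using uB[OF AA(1), of "\<tau> A"] uB[OF AA(1), of "odd j"] by linarith
          then have "\<bar>u A (\<tau> A) - u A (odd j)\<bar> * card A \<le> 2 * B * card A" by (rule mult_right_mono) simp
          moreover have "\<bar>u A (\<tau> A) * card A - u A (odd j) * card A\<bar> = \<bar>u A (\<tau> A) - u A (odd j)\<bar> * card A"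
            by (simp add: left_diff_distrib[symmetric] abs_mult)
          ultimately show ?thesis by simp
        qed
        ultimately show ?thesis by simp
      qed
    qed
    also have "\<dots> = (\<Sum>A\<in>Q (n j) \<inter> ?Z. 2 * B * card A)" by (rule sum.inter_restrict[OF Qfin, symmetric])
    also have "\<dots> \<le> (\<Sum>A\<in>?Z. 2 * B * card A)" using finZ B0 by (intro sum_mono2) auto
    also have "\<dots> = 2 * B * (\<Sum>A\<in>?Z. real (card A))" by (simp add: sum_distrib_left)
    also have "\<dots> \<le> 2 * B * (\<kappa> / (2 * B) * card (F (n j)))"
    proof (rule mult_left_mono)
      have "(\<Sum>A\<in>?Z. real (card A)) \<le> card ?V" unfolding disjoint_subsets_card(3)[OF dj finV] by simp
      also have "card ?V \<le> (\<Sum>i<j. card (F (n i)))" by (rule card_UN_le) simp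
      also have "real (\<Sum>i<j. card (F (n i))) \<le> \<kappa> / (2 * B) * card (F (n j))" using k(2)[of j] unfolding n_def by simp
      finally show "(\<Sum>A\<in>?Z. real (card A)) \<le> \<kappa> / (2 * B) * card (F (n j))" by simp
    qed (use B0 in simp)
    also have "\<dots> = \<kappa> * card (F (n j))" using B0 by simp
    finally show ?thesis .
  qed
  have "y \<in> irregular_set \<alpha> F \<phi>"
    if \<omega>: "\<forall>A\<in>\<A>. \<omega> A \<in> \<Gamma> A (\<tau> A)" and y: "\<forall>A\<in>\<A>. \<forall>s\<in>A. dist (\<alpha> s (\<omega> A)) (\<alpha> s y) \<le> r" for \<omega> y
    unfolding irregular_set_def
  proof
    let ?S = "\<lambda>n. (\<Sum>s\<in>F n. \<phi> (\<alpha> s y)) / real (card (F n))"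
    have piece: "\<bar>(\<Sum>s\<in>A. \<phi> (\<alpha> s y)) - u A (\<tau> A) * card A\<bar> \<le> (5 * \<kappa>) * card A" if AA: "A \<in> \<A>" for A
    proof -
      have "\<bar>(\<Sum>s\<in>A. \<phi> (\<alpha> s y)) - (\<Sum>s\<in>A. \<phi> (\<alpha> s (\<omega> A)))\<bar> \<le> \<kappa> * card A"
        using y AA by (intro sum_pointwise_close modulus) (simp add: dist_commute)
      moreover have "\<bar>(\<Sum>s\<in>A. \<phi> (\<alpha> s (\<omega> A))) - u A (\<tau> A) * card A\<bar> \<le> 4 * \<kappa> * card A"
        using \<omega> AA by (intro avg) auto
      ultimately show ?thesis by linarith
    qed
    \<comment> \<open>5 * \<kappa> on the pieces, \<kappa> from b * \<delta> for the uncovered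
      points, and \<kappa> for the pieces of the wrong type.\<close>
    have close: "\<bar>?S (n j) - W (odd j) (n j)\<bar> \<le> 7 * \<kappa>" if j: "N \<le> n j" for j
    proof -
      have c: "real (card (F (n j))) > 0" using Fm(4) by simp
      have "\<bar>(\<Sum>s\<in>F (n j). \<phi> (\<alpha> s y)) - (\<Sum>A\<in>Q (n j). u A (\<tau> A) * card A)\<bar> \<le> (5 * \<kappa> + b * \<delta>) * card (F (n j))"
        unfolding Q_def
        by (rule sum_over_pieces[where w = "\<lambda>A. u A (\<tau> A)", OF dj Fm(2) cov[OF j] piece bd]) (use \<kappa> in auto)
      also have "\<dots> \<le> (6 * \<kappa>) * card (F (n j))" using \<delta> by (intro mult_right_mono) auto
      finally have "\<bar>(\<Sum>s\<in>F (n j). \<phi> (\<alpha> s y)) - (\<Sum>A\<in>Q (n j). u A (odd j) * card A)\<bar> \<le> 7 * \<kappa> * card (F (n j))"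
        using types[of j] by linarith
      moreover have "?S (n j) - W (odd j) (n j) = ((\<Sum>s\<in>F (n j). \<phi> (\<alpha> s y)) - (\<Sum>A\<in>Q (n j). u A (odd j) * card A)) / card (F (n j))"
        unfolding W_def by (simp add: diff_divide_distrib)
      ultimately show ?thesis using c by (simp add: abs_divide divide_le_eq)
    qed
    \<comment> \<open>The averages differ by at least 64 * \<kappa> on pieces that fill at least
      half of the set.\<close>
    have apart: "W False m + 32 * \<kappa> \<le> W True m" if m: "N \<le> m" for m
    proof -
      have c: "real (card (F m)) > 0" using Fm(4) by simp
      have "card (F m - \<Union>{A\<in>\<A>. A \<subseteq> F m}) \<le> (1/2) * card (F m)"
        using cov[OF m] mult_right_mono[OF \<delta>(1), of "real (card (F m))"] by simp
      then have "(1/2) * card (F m) \<le> (\<Sum>A\<in>Q m. real (card A))" unfolding Qsum by simp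
      then have "64 * \<kappa> * ((1/2) * card (F m)) \<le> 64 * \<kappa> * (\<Sum>A\<in>Q m. real (card A))"
        using \<kappa> by (intro mult_left_mono) auto
      also have "\<dots> = (\<Sum>A\<in>Q m. 64 * \<kappa> * card A)" by (simp add: sum_distrib_left)
      also have "\<dots> \<le> (\<Sum>A\<in>Q m. u A True * card A - u A False * card A)"
      proof (rule sum_mono)
        fix A assume "A \<in> Q m"
        then have "64 * \<kappa> \<le> u A True - u A False" using gap[of A] \<gamma> unfolding Q_def by auto
        then have "64 * \<kappa> * card A \<le> (u A True - u A False) * card A" by (rule mult_right_mono) simp
        then show "64 * \<kappa> * card A \<le> u A True * card A - u A False * card A" by (simp add: left_diff_distrib)
      qed
      also have "\<dots> = (W True m - W False m) * card (F m)"
        unfolding W_def sum_subtractf left_diff_distrib using c by simp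
      finally have "32 * \<kappa> * card (F m) \<le> (W True m - W False m) * card (F m)" by simp
      then show ?thesis using c by simp
    qed
    show "\<not> convergent ?S"
    proof
      assume "convergent ?S"
      then obtain L where "?S \<longlonglongrightarrow> L" unfolding convergent_def by blast
      then have "(\<lambda>j. ?S (n j)) \<longlonglongrightarrow> L" using LIMSEQ_subseq_LIMSEQ[OF _ n_mono] unfolding o_def by blast
      then obtain j1 where j1: "\<And>j. j \<ge> j1 \<Longrightarrow> \<bar>?S (n j) - L\<bar> < \<kappa>"
        using \<kappa> unfolding lim_sequentially dist_real_def by blast
      obtain j2 where j2: "\<And>j. j \<ge> j2 \<Longrightarrow> \<bar>W False (n j) - v\<bar> < \<kappa>"
        using n_lim \<kappa> unfolding lim_sequentially dist_real_def by blast
      \<comment> \<open>An even index beyond all thresholds, compared with its odd successor. Both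
        values of W False are within \<kappa> of v, so the averages at y differ by at least (32 - 2
        * 7 - 2) * \<kappa>, more than the 2 * \<kappa> that convergence allows.\<close>
      define j where "j = 2 * (j1 + j2 + N)"
      have Nj: "N \<le> n j" "N \<le> n (Suc j)"
        using strict_mono_imp_increasing[OF n_mono, of j] strict_mono_imp_increasing[OF n_mono, of "Suc j"] unfolding j_def by simp_all
      have "odd j = False" "odd (Suc j) = True" unfolding j_def by simp_all
      then have c: "\<bar>?S (n j) - W False (n j)\<bar> \<le> 7 * \<kappa>" "\<bar>?S (n (Suc j)) - W True (n (Suc j))\<bar> \<le> 7 * \<kappa>"
        using close[OF Nj(1)] close[OF Nj(2)] by simp_all
      have "j \<ge> j1" "j \<ge> j2" "Suc j \<ge> j1" "Suc j \<ge> j2" unfolding j_def by simp_all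
      then show False
        using c apart[OF Nj(2)] j1[of j] j1[of "Suc j"] j2[of j] j2[of "Suc j"] \<kappa> by linarith
    qed
  qed
  then show ?thesis by (intro exI[of _ \<tau>] allI impI)
qed

text \<open>A cover of entropy h > s0 supplies the separated sets, the irregular point the two
  averages, and the surplus e = h - s0 pays for all losses. The constants depend on each other in
  the order \<theta>, \<kappa>, r, P, (K, d), \<delta>; only then is the group tiled.\<close>

lemma bowen_entropy_scale_irregular_ge:
  fixes \<phi> :: "'x \<Rightarrow> real" and s0 :: real
  assumes F: "folner_seq G F" and spec: "specification_property G \<alpha>"
    and \<phi>: "continuous_on UNIV \<phi>" and irr: "irregular_set \<alpha> F \<phi> \<noteq> {}"
    and s0: "0 < s0" "ereal s0 < top_entropy G \<alpha>"
  shows "\<exists>\<epsilon>0>0. \<forall>\<epsilon>. 0 < \<epsilon> \<longrightarrow> \<epsilon> \<le> \<epsilon>0 \<longrightarrow> ereal s0 \<le> bowen_entropy_scale \<alpha> F (irregular_set \<alpha> F \<phi>) \<epsilon>"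
proof -
  note Fm = folner_seqD[OF F]
  have "bounded (range \<phi>)" using compact_continuous_image[OF \<phi> compact_space] by (rule compact_imp_bounded)
  then obtain b where bd: "\<And>x. \<bar>\<phi> x\<bar> \<le> b" unfolding bounded_iff by auto
  have b0: "b \<ge> 0" using bd[of undefined] by simp
  obtain U where U: "open_cover U" "s0 < top_entropy_cover G \<alpha> U"
    using s0(2) unfolding top_entropy_def less_SUP_iff by auto
  define h where "h = top_entropy_cover G \<alpha> U"
  define e where "e = h - s0"
  have e: "e > 0" using U(2) unfolding e_def h_def by simp
  interpret f: subadditive_set_function G "cover_entropy U" by (rule subadditive_cover_entropy[OF U(1)])
  define M where "M = cover_entropy U {\<one>}"
  have M0: "M \<ge> 0" unfolding M_def by (rule f.f_nonneg) auto
  obtain l where l: "l > 0" and sep: "\<And>A. finite A \<Longrightarrow> A \<subseteq> carrier G \<Longrightarrow>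
    \<exists>\<Gamma>. finite \<Gamma> \<and> exp (cover_entropy U A) \<le> card \<Gamma> \<and> (\<forall>x\<in>\<Gamma>. \<forall>y\<in>\<Gamma>. x \<noteq> y \<longrightarrow> (\<exists>s\<in>A. l \<le> dist (\<alpha> s x) (\<alpha> s y)))"
    by (rule exists_separated_set[OF U(1)]) (rule that; assumption)

  obtain x0 where x0: "x0 \<in> irregular_set \<alpha> F \<phi>" using irr by blast
  let ?X = "\<lambda>n. (\<Sum>s\<in>F n. \<phi> (\<alpha> s x0)) / real (card (F n))"
  have nc: "\<not> convergent ?X" using x0 unfolding irregular_set_def by simp
  have "bounded (range ?X)"
  proof (rule boundedI)
    fix x assume "x \<in> range ?X"
    then obtain n where n: "x = ?X n" by blast
    have "\<bar>\<Sum>s\<in>F n. \<phi> (\<alpha> s x0)\<bar> \<le> (\<Sum>s\<in>F n. \<bar>\<phi> (\<alpha> s x0)\<bar>)" by (rule sum_abs)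
    also have "\<dots> \<le> real (card (F n)) * b" using bd by (intro sum_bounded_above)
    finally show "norm x \<le> b" unfolding n using Fm(4)[of n] by (simp add: divide_le_eq mult.commute)
  qed
  then obtain a0 a1 where a: "a0 < a1" "\<And>e. e > 0 \<Longrightarrow> infinite {n. \<bar>?X n - a0\<bar> < e}"
    "\<And>e. e > 0 \<Longrightarrow> infinite {n. \<bar>?X n - a1\<bar> < e}"
    using nonconvergent_two_limit_points[OF _ nc] by blast
  define g where "g = (a1 - a0) / 2"
  have g: "g > 0" "g / 2 > 0" using a(1) unfolding g_def by simp_all
  obtain z0 where z0: "inv_eventually (\<lambda>B. \<bar>(\<Sum>s\<in>B. \<phi> (\<alpha> s z0)) - a0 * card B\<bar> \<le> g / 2 * card B)"
    using limit_point_everywhere[OF F spec \<phi> bd a(2) g(2)] by blast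
  obtain z1 where z1: "inv_eventually (\<lambda>B. \<bar>(\<Sum>s\<in>B. \<phi> (\<alpha> s z1)) - a1 * card B\<bar> \<le> g / 2 * card B)"
    using limit_point_everywhere[OF F spec \<phi> bd a(3) g(2)] by blast
  define z where "z t = (if t then z1 else z0)" for t :: bool
  have z: "inv_eventually (\<lambda>Q. g * card Q \<le> (\<Sum>s\<in>Q. \<phi> (\<alpha> s (z True))) - (\<Sum>s\<in>Q. \<phi> (\<alpha> s (z False))))"
  proof (rule inv_eventually_mono[OF inv_eventually_conj[OF z0 z1]])
    fix Q :: "'g set"
    assume Q: "\<bar>(\<Sum>s\<in>Q. \<phi> (\<alpha> s z0)) - a0 * card Q\<bar> \<le> g / 2 * card Q \<and> \<bar>(\<Sum>s\<in>Q. \<phi> (\<alpha> s z1)) - a1 * card Q\<bar> \<le> g / 2 * card Q"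
    have "a1 * card Q - a0 * card Q = 2 * (g * card Q)" unfolding g_def by (simp add: algebra_simps)
    then show "g * card Q \<le> (\<Sum>s\<in>Q. \<phi> (\<alpha> s (z True))) - (\<Sum>s\<in>Q. \<phi> (\<alpha> s (z False)))"
      using Q[THEN conjunct1] Q[THEN conjunct2] unfolding z_def if_True if_False by linarith
  qed

  \<comment> \<open>Keeps the entropy 3 * \<theta> * M given up to the invariant portions at most
    e/4.\<close>
  define \<theta> where "\<theta> = min (1/2) (e / (12 * (M + 1)))"
  have "0 < \<theta>" unfolding \<theta>_def using e M0 by auto
  moreover have "\<theta> \<le> 1/2" unfolding \<theta>_def by (rule min.cobounded1)
  ultimately have \<theta>: "0 < \<theta>" "\<theta> \<le> 1/2" by auto
  have "\<theta> \<le> e / (12 * (M + 1))" unfolding \<theta>_def by simp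
  then have "\<theta> * (12 * (M + 1)) \<le> e" using M0 by (simp add: pos_le_divide_eq)
  then have \<theta>e: "3 * \<theta> * M \<le> e / 4" using \<theta> by (simp add: algebra_simps)
  \<comment> \<open>The first bound makes the gap \<theta> * g at least 64 * \<kappa>, as the
    alternation of types requires; the second limits the cost of the pigeonhole step.\<close>
  define \<kappa> where "\<kappa> = min (\<theta> * g / 64) (e / 4)"
  have "\<kappa> \<le> \<theta> * g / 64" unfolding \<kappa>_def by (rule min.cobounded1)
  moreover have "\<kappa> > 0" "\<kappa> \<le> e / 4" unfolding \<kappa>_def using \<theta> g e by auto
  ultimately have \<kappa>: "\<kappa> > 0" "64 * \<kappa> \<le> \<theta> * g" "\<kappa> \<le> e / 4" by auto
  have "uniformly_continuous_on UNIV \<phi>" using \<phi> compact_space by (rule compact_uniformly_continuous)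
  then obtain r1 where r1: "r1 > 0" "\<And>x y. dist x y < r1 \<Longrightarrow> \<bar>\<phi> x - \<phi> y\<bar> < \<kappa>"
    unfolding uniformly_continuous_on_def dist_real_def using \<kappa>(1) by blast
  \<comment> \<open>r1/2 reconciles non-strict shadowing with the strict modulus of continuity; l/8
    gives 2 * r + 2 * \<epsilon> < l - 2 * r for all \<epsilon> \<le> l/8.\<close>
  define r where "r = min (r1 / 2) (l / 8)"
  have r: "r > 0" "r \<le> l / 8" unfolding r_def using r1 l by auto
  have modulus: "\<bar>\<phi> x - \<phi> y\<bar> \<le> \<kappa>" if "dist x y \<le> r" for x y
  proof -
    have "dist x y < r1" using that r1(1) unfolding r_def by auto
    then show ?thesis using r1(2) by fastforce
  qed
  obtain P where P: "spec_gap r P" using spec_gap_exists[OF spec r(1)] by blast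
  have Pc: "finite P" "P \<subseteq> carrier G" using P unfolding spec_gap_def by auto
  have rl: "2 * r < l" using r l by linarith
  have "inv_eventually (\<lambda>A. \<exists>\<Gamma> u. two_sided_family \<phi> (4 * \<kappa>) (\<theta> * g) (l - 2 * r)
    (cover_entropy U A - (3 * \<theta> * M + \<kappa>) * card A) A \<Gamma> u)"
    unfolding M_def by (rule two_averages[OF F P modulus bd \<kappa>(1) z less_imp_le[OF g(1)] \<theta> U(1) sep rl])
  then obtain K d where K: "finite K" "K \<subseteq> carrier G" "d > 0"
    and two: "\<And>A. almost_inv K d A \<Longrightarrow> \<exists>\<Gamma> u. two_sided_family \<phi> (4 * \<kappa>) (\<theta> * g) (l - 2 * r)
      (cover_entropy U A - (3 * \<theta> * M + \<kappa>) * card A) A \<Gamma> u"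
    by (rule inv_eventuallyE) (rule that; assumption)

  define \<sigma> where "\<sigma> = s0 + e / 4"
  \<comment> \<open>\<delta> must satisfy several bounds on a factor times \<delta>. As c dominates
    each factor and q is below each bound, \<delta> \<le> q / c yields them all: invariance of
    trimmed pieces, entropy lost by trimming, sums over uncovered points, and the step from \<sigma>
    to s0.\<close>
  define q where "q = min (min (d / 4) (e / 8)) (min \<kappa> (e / 4))"
  define c where "c = card K + M + b + \<sigma> + 1"
  define \<delta> where "\<delta> = min (1/2) (q / c)"
  have \<sigma>0: "\<sigma> > 0" unfolding \<sigma>_def using s0 e by simp
  have q: "q > 0" "q \<le> d / 4" "q \<le> e / 8" "q \<le> \<kappa>" "q \<le> e / 4" unfolding q_def using K e \<kappa> by auto
  have c0: "c > 0" unfolding c_def using M0 b0 \<sigma>0 by (intro add_nonneg_pos add_nonneg_nonneg) auto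
  have "\<delta> > 0" unfolding \<delta>_def using q c0 by auto
  moreover have "\<delta> \<le> 1/2" unfolding \<delta>_def by (rule min.cobounded1)
  ultimately have \<delta>: "\<delta> > 0" "\<delta> \<le> 1/2" "\<delta> < 1" by auto
  have "\<delta> \<le> q / c" unfolding \<delta>_def by simp
  then have "\<delta> * c \<le> q" using c0 by (simp add: pos_le_divide_eq)
  then have "card K * \<delta> + M * \<delta> + b * \<delta> + \<sigma> * \<delta> + \<delta> \<le> q" unfolding c_def by (simp add: algebra_simps)
  moreover have "card K * \<delta> \<ge> 0" "M * \<delta> \<ge> 0" "b * \<delta> \<ge> 0" "\<sigma> * \<delta> \<ge> 0" using \<delta> M0 b0 \<sigma>0 by auto
  ultimately have \<delta>q: "card K * \<delta> \<le> d / 4" "M * \<delta> \<le> e / 8" "b * \<delta> \<le> \<kappa>" "\<sigma> * \<delta> \<le> e / 4"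
    using \<delta>(1) q by linarith+
  have s\<sigma>: "s0 \<le> \<sigma> * (1 - \<delta>)" using \<delta>q(4) unfolding \<sigma>_def by (simp add: algebra_simps)
  have "d * (1/2) \<le> d * (1 - \<delta>)" using \<delta> K by (intro mult_left_mono) auto
  then have Kd: "d / 4 + card K * \<delta> \<le> d * (1 - \<delta>)" using \<delta>q(1) by linarith
  have "eventually (\<lambda>n. almost_inv K (d / 4) (F n)) sequentially"
    using folner_eventually_almost_inv[OF F K(1,2)] K(3) by simp
  moreover have "eventually (\<lambda>n. h - e / 8 < cover_entropy U (F n) / card (F n)) sequentially"
    using top_entropy_cover_tendsto[OF U(1) F] e unfolding h_def by (intro order_tendstoD(1)) auto
  ultimately have "eventually (\<lambda>n. almost_inv K (d / 4) (F n) \<and> h - e / 8 < cover_entropy U (F n) / card (F n)) sequentially"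
    by (rule eventually_conj)
  then obtain N where N: "\<And>n. n \<ge> N \<Longrightarrow> almost_inv K (d / 4) (F n)"
    "\<And>n. n \<ge> N \<Longrightarrow> h - e / 8 < cover_entropy U (F n) / card (F n)"
    unfolding eventually_sequentially by blast
  obtain \<A> J K' d' where J: "finite J" "J \<subseteq> {N..}"
    and A: "\<And>A. A \<in> \<A> \<Longrightarrow> \<exists>n\<in>J. \<exists>c\<in>carrier G. A \<subseteq> F n #> c \<and> (1 - \<delta>) * card (F n) \<le> card A"
    and gap: "\<And>A B p a. A \<in> \<A> \<Longrightarrow> B \<in> \<A> \<Longrightarrow> A \<noteq> B \<Longrightarrow> p \<in> P \<Longrightarrow> a \<in> A \<Longrightarrow> p \<otimes> a \<notin> B"
    and dj: "disjoint \<A>" and K': "finite K'" "K' \<subseteq> carrier G" "d' > 0"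
    and cov: "\<And>B. almost_inv K' d' B \<Longrightarrow> card (B - \<Union>{A\<in>\<A>. A \<subseteq> B}) \<le> \<delta> * card B"
    by (rule quasi_tiling[OF F infinite_Ici[of N] \<delta>(1,3) Pc]) (rule that; assumption)
  have piece: "finite A \<and> A \<noteq> {} \<and> A \<subseteq> carrier G \<and>
      (\<exists>\<Gamma> u. two_sided_family \<phi> (4 * \<kappa>) (\<theta> * g) (l - 2 * r) (\<sigma> * card A) A \<Gamma> u)" if AA: "A \<in> \<A>" for A
  proof -
    obtain n c where n: "n \<in> J" "c \<in> carrier G" "A \<subseteq> F n #> c" "(1 - \<delta>) * card (F n) \<le> card A"
      using A[OF AA] by blast
    have nN: "n \<ge> N" using n(1) J(2) by auto
    have cF: "card (F n #> c) = card (F n)" using Fm n by (simp add: card_r_coset)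
    have fc: "finite (F n #> c)" "F n #> c \<subseteq> carrier G" using Fm n by (simp_all add: finite_r_coset r_coset_subset_G)
    have "almost_inv K (d / 4) (F n #> c)" using N(1)[OF nN] K(2) n(2) by (rule almost_inv_r_coset)
    then have inv: "almost_inv K d A"
      by (rule almost_inv_subset[OF _ K(1,2) n(3) _ \<delta>(3) Kd]) (use n(4) cF K(3) in simp_all)
    note A' = almost_invD[OF inv]
    obtain \<Gamma> u where \<Gamma>: "two_sided_family \<phi> (4 * \<kappa>) (\<theta> * g) (l - 2 * r)
      (cover_entropy U A - (3 * \<theta> * M + \<kappa>) * card A) A \<Gamma> u" using two[OF inv] by blast
    have "F n = (F n #> c) #> inv c" using Fm n by (simp add: coset_mult_assoc coset_mult_one)
    then have "cover_entropy U (F n) \<le> cover_entropy U (F n #> c)"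
      using f.f_r_coset[OF fc, of "inv c"] n(2) by simp
    also have "F n #> c = A \<union> ((F n #> c) - A)" using n(3) by blast
    also have "cover_entropy U \<dots> \<le> cover_entropy U A + cover_entropy U ((F n #> c) - A)"
      using fc A' by (intro f.f_Un) auto
    also have "cover_entropy U ((F n #> c) - A) \<le> M * card ((F n #> c) - A)"
      unfolding M_def using fc by (intro f.f_le_card) auto
    also have "\<dots> \<le> M * (\<delta> * card (F n))"
    proof (rule mult_left_mono[OF _ M0])
      have "card ((F n #> c) - A) = card (F n) - card A" using n(3) A'(1) cF by (simp add: card_Diff_subset)
      moreover have "card A \<le> card (F n)" using card_mono[OF fc(1) n(3)] cF by simp
      ultimately have "real (card ((F n #> c) - A)) = real (card (F n)) - card A" by simp
      also have "\<dots> \<le> \<delta> * card (F n)" using n(4) by (simp add: algebra_simps)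
      finally show "real (card ((F n #> c) - A)) \<le> \<delta> * card (F n)" .
    qed
    also have "\<dots> \<le> e / 8 * card (F n)" unfolding mult.assoc[symmetric] using \<delta>q(2) by (intro mult_right_mono) auto
    finally have "cover_entropy U (F n) - e / 8 * card (F n) \<le> cover_entropy U A" by simp
    moreover have "(h - e / 8) * card (F n) \<le> cover_entropy U (F n)"
      using N(2)[OF nN] Fm(4)[of n] by (simp add: less_divide_eq)
    ultimately have "(h - e / 4) * card (F n) \<le> cover_entropy U A" by (simp add: algebra_simps)
    moreover have "(h - e / 4) * card A \<le> (h - e / 4) * card (F n)"
      using card_mono[OF fc(1) n(3)] cF s0 e unfolding e_def by (intro mult_left_mono) auto
    ultimately have hA: "(h - e / 4) * card A \<le> cover_entropy U A" by linarith
    \<comment> \<open>Of h = s0 + e, trimming and the approximation of h on \<open>F n\<close> use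
      e/8 each, the invariant portion e/4 and the pigeonhole step e/4, which leaves \<sigma> = s0 +
      e/4.\<close>
    have "(\<sigma> + (3 * \<theta> * M + \<kappa>)) * card A \<le> (h - e / 4) * card A"
    proof (rule mult_right_mono)
      have "h = s0 + e" unfolding e_def by simp
      then show "\<sigma> + (3 * \<theta> * M + \<kappa>) \<le> h - e / 4" using \<theta>e \<kappa>(3) unfolding \<sigma>_def by linarith
    qed simp
    then have "\<sigma> * card A \<le> cover_entropy U A - (3 * \<theta> * M + \<kappa>) * card A" using hA by (simp add: algebra_simps)
    then have "two_sided_family \<phi> (4 * \<kappa>) (\<theta> * g) (l - 2 * r) (\<sigma> * card A) A \<Gamma> u"
      using \<Gamma> unfolding two_sided_family_def by (meson exp_le_cancel_iff order_trans)
    then show ?thesis using A' by blast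
  qed
  have "\<forall>A. \<exists>\<Gamma> u. A \<in> \<A> \<longrightarrow> two_sided_family \<phi> (4 * \<kappa>) (\<theta> * g) (l - 2 * r) (\<sigma> * card A) A \<Gamma> u"
    using piece by blast
  then obtain \<Gamma> where "\<forall>A. \<exists>u. A \<in> \<A> \<longrightarrow> two_sided_family \<phi> (4 * \<kappa>) (\<theta> * g) (l - 2 * r) (\<sigma> * card A) A (\<Gamma> A) u"
    by (rule choice[THEN exE])
  then obtain u where "\<forall>A. A \<in> \<A> \<longrightarrow> two_sided_family \<phi> (4 * \<kappa>) (\<theta> * g) (l - 2 * r) (\<sigma> * card A) A (\<Gamma> A) (u A)"
    by (rule choice[THEN exE])
  then have fam: "two_sided_family \<phi> (4 * \<kappa>) (\<theta> * g) (l - 2 * r) (\<sigma> * card A) A (\<Gamma> A) (u A)" if "A \<in> \<A>" for A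
    using that by simp
  obtain N' where N': "\<And>n. n \<ge> N' \<Longrightarrow> almost_inv K' d' (F n)"
    using folner_eventually_almost_inv[OF F K'] unfolding eventually_sequentially by blast
  have covF: "card (F n - \<Union>{A\<in>\<A>. A \<subseteq> F n}) \<le> \<delta> * card (F n)" if "N' \<le> n" for n
    by (rule cov[OF N'[OF that]])
  have Afin: "finite A \<and> A \<noteq> {} \<and> A \<subseteq> carrier G" "finite A \<and> A \<subseteq> carrier G" if "A \<in> \<A>" for A
    using piece[OF that] by simp_all
  have "\<exists>\<tau>. \<forall>\<omega> y. (\<forall>A\<in>\<A>. \<omega> A \<in> \<Gamma> A (\<tau> A)) \<longrightarrow>
    (\<forall>A\<in>\<A>. \<forall>s\<in>A. dist (\<alpha> s (\<omega> A)) (\<alpha> s y) \<le> r) \<longrightarrow> y \<in> irregular_set \<alpha> F \<phi>"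
    by (rule exists_irregular_types[OF F dj Afin(1) fam covF \<delta>(2) \<delta>q(3) modulus bd \<kappa>(1,2)])
  then obtain \<tau> where \<tau>': "\<forall>\<omega> y. (\<forall>A\<in>\<A>. \<omega> A \<in> \<Gamma> A (\<tau> A)) \<longrightarrow>
    (\<forall>A\<in>\<A>. \<forall>s\<in>A. dist (\<alpha> s (\<omega> A)) (\<alpha> s y) \<le> r) \<longrightarrow> y \<in> irregular_set \<alpha> F \<phi>"
    by (rule exE)
  have \<tau>: "y \<in> irregular_set \<alpha> F \<phi>" if "\<And>A. A \<in> \<A> \<Longrightarrow> \<omega> A \<in> \<Gamma> A (\<tau> A)"
    "\<forall>A\<in>\<A>. \<forall>s\<in>A. dist (\<alpha> s (\<omega> A)) (\<alpha> s y) \<le> r" for \<omega> y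
    using \<tau>'[rule_format, of \<omega> y] that by simp
  have "ereal s0 \<le> bowen_entropy_scale \<alpha> F (irregular_set \<alpha> F \<phi>) \<epsilon>" if \<epsilon>: "0 < \<epsilon>" "\<epsilon> \<le> l / 8" for \<epsilon>
  proof (rule bowen_entropy_scale_ge)
    fix t assume t: "t \<le> s0"
    show "1 \<le> bowen_sum_inf \<alpha> F (irregular_set \<alpha> F \<phi>) \<epsilon> N' t"
    proof (rule bowen_sum_inf_ge_1[where l = "l - 2 * r" and r = r and \<sigma> = \<sigma> and \<delta> = \<delta> and \<Gamma> = "\<lambda>A. \<Gamma> A (\<tau> A)", OF F dj Afin(2)])
      show "finite (\<Gamma> A (\<tau> A)) \<and> \<Gamma> A (\<tau> A) \<noteq> {} \<and> exp (\<sigma> * card A) \<le> card (\<Gamma> A (\<tau> A))" if "A \<in> \<A>" for A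
        using fam[OF that] unfolding two_sided_family_def by blast
      show "\<exists>s\<in>A. l - 2 * r \<le> dist (\<alpha> s x) (\<alpha> s y)"
        if "A \<in> \<A>" "x \<in> \<Gamma> A (\<tau> A)" "y \<in> \<Gamma> A (\<tau> A)" "x \<noteq> y" for A x y
        using fam[OF that(1)] that(2-4) unfolding two_sided_family_def by blast
      show "\<exists>y\<in>irregular_set \<alpha> F \<phi>. \<forall>A\<in>\<A>. \<forall>s\<in>A. dist (\<alpha> s (\<omega> A)) (\<alpha> s y) \<le> r"
        if \<omega>: "\<And>A. A \<in> \<A> \<Longrightarrow> \<omega> A \<in> \<Gamma> A (\<tau> A)" for \<omega>
      proof -
        have "\<exists>y. \<forall>A\<in>\<A>. \<forall>s\<in>A. dist (\<alpha> s (\<omega> A)) (\<alpha> s y) \<le> r"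
        proof (rule spec_gap_family[OF P Afin(2)])
          show "p \<otimes> a \<notin> B" if "A \<in> \<A>" "B \<in> \<A>" "A \<noteq> B" "p \<in> P" "a \<in> A" for A B p a
            by (rule gap[OF that])
        qed
        then obtain y where y: "\<forall>A\<in>\<A>. \<forall>s\<in>A. dist (\<alpha> s (\<omega> A)) (\<alpha> s y) \<le> r" by (rule exE)
        show ?thesis
        proof
          show "\<forall>A\<in>\<A>. \<forall>s\<in>A. dist (\<alpha> s (\<omega> A)) (\<alpha> s y) \<le> r" by (rule y)
          show "y \<in> irregular_set \<alpha> F \<phi>" by (rule \<tau>[OF _ y]) (rule \<omega>)
        qed
      qed
      show "card (F n - \<Union>{A\<in>\<A>. A \<subseteq> F n}) \<le> \<delta> * card (F n)" if "N' \<le> n" for n by (rule covF[OF that])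
      show "2 * r + 2 * \<epsilon> < l - 2 * r" using r \<epsilon> l by linarith
    qed (use \<sigma>0 s\<sigma> t in auto)
  qed
  then show ?thesis using l by (intro exI[of _ "l / 8"]) auto
qed

text \<open>A squeeze: the upper bound holds at every scale, and each positive s below the
  topological entropy is a lower bound at all small scales.\<close>

lemma bowen_entropy_irregular_set:
  assumes F: "folner_seq G F" and spec: "specification_property G \<alpha>"
    and \<phi>: "continuous_on UNIV \<phi>" and irr: "irregular_set \<alpha> F \<phi> \<noteq> {}"
  shows "bowen_entropy \<alpha> F (irregular_set \<alpha> F \<phi>) = top_entropy G \<alpha>"
proof -
  let ?h = "bowen_entropy_scale \<alpha> F (irregular_set \<alpha> F \<phi>)"
  have "(?h \<longlongrightarrow> top_entropy G \<alpha>) (at_right 0)"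
  proof (rule order_tendstoI)
    fix a assume "a < top_entropy G \<alpha>"
    show "eventually (\<lambda>\<epsilon>. a < ?h \<epsilon>) (at_right 0)"
    proof (cases "a < 0")
      \<comment> \<open>The lower bound requires s > 0, so a negative a is settled by nonnegativity
        at every scale; this includes the case of zero entropy.\<close>
      case True
      have "0 \<le> ?h \<epsilon>" for \<epsilon>
        unfolding bowen_entropy_scale_def by (rule Inf_greatest) auto
      then show ?thesis using True by (auto intro: always_eventually less_le_trans)
    next
      case False
      obtain s where s: "a < ereal s" "ereal s < top_entropy G \<alpha>"
        using ereal_dense2[OF \<open>a < top_entropy G \<alpha>\<close>] by blast
      have "0 < s" using False s(1) by (meson ereal_less(2) le_less_trans not_less)
      then obtain \<epsilon>0 where \<epsilon>0: "\<epsilon>0 > 0" "\<And>\<epsilon>. 0 < \<epsilon> \<Longrightarrow> \<epsilon> \<le> \<epsilon>0 \<Longrightarrow> ereal s \<le> ?h \<epsilon>"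
        using bowen_entropy_scale_irregular_ge[OF F spec \<phi> irr _ s(2)] by blast
      show ?thesis
        unfolding eventually_at_right_field
        using \<epsilon>0 s(1) by (intro exI[of _ \<epsilon>0]) (auto intro: less_le_trans)
    qed
  next
    fix a assume a: "top_entropy G \<alpha> < a"
    show "eventually (\<lambda>\<epsilon>. ?h \<epsilon> < a) (at_right 0)"
      unfolding eventually_at_right_field
      using bowen_entropy_scale_le[OF F] a by (intro exI[of _ 1]) (auto intro: le_less_trans)
  qed
  then show ?thesis unfolding bowen_entropy_def by (intro tendsto_Lim) simp_all
qed

end

theorem theorem1p2:
  fixes G :: "('g, 'b) monoid_scheme"
    and \<alpha> :: "'g \<Rightarrow> 'x::metric_space \<Rightarrow> 'x"
    and F :: "nat \<Rightarrow> 'g set"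
    and \<phi> :: "'x \<Rightarrow> real"
  assumes "dynamical_system G \<alpha>"
    and "folner_seq G F"
    and "filterlim (\<lambda>n. real (card (F n)) / ln (real n)) at_top sequentially"
    and "specification_property G \<alpha>"
    and "uniform_separation_property G \<alpha>"
    and "continuous_on UNIV \<phi>"
    and "irregular_set \<alpha> F \<phi> \<noteq> {}"
  shows "bowen_entropy \<alpha> F (irregular_set \<alpha> F \<phi>) = top_entropy G \<alpha>"
  using dynamical_system.bowen_entropy_irregular_set[OF assms(1,2,4,6,7)] .

end
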